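(* Let $G$ be a non-Hausdorff ample groupoid with unit space $X=G^{(0)}$. Assume that $\overline{X}(x)$ is finite for all $x\in X$. If the complex Steinberg algebra $\mathbb{C}G$ is simple, then the reduced groupoid $C^*$-algebra $C^*_r(G)$ is simple.
   Context: Groupoids. A groupoid $G$ is a small category all of whose morphisms are invertible, identified with its set of morphisms; $G^{(0)}\subseteq G$ is its set of units, $r,s\colon G\to G^{(0)}$ are range and source, and $G_x=s^{-1}(x)$, $G_x^x=r^{-1}(x)\cap s^{-1}(x)$. Topological groupoids (continuous range, source, multiplication, inversion) are always assumed locally compact with $G^{(0)}$ Hausdorff in the subspace topology; $G$ itself need not be Hausdorff, and compact subsets need not be closed. $G$ is étale if $r$ is a local homeomorphism, and ample if in addition $G^{(0)}$ is totally disconnected. An open bisection is an open subset $U\subseteq G$ on which $r$ and $s$ are injective ($U$ is then locally compact Hausdorff). $\overline{X}$ is the closure of $X$ in $G$, and $\overline{X}(x)=\overline{X}\cap G_x^x$ for $x\in X$. $C^*$-algebra. For an open bisection $U$, $C_c(U)$ is the set of continuous functions $U\to\mathbb{C}$ with compact support in $U$, extended by zero to functions on $G$; $\mathcal{C}_c(G)$ is the linear span of all $C_c(U)$, a $*$-algebra under $f^*(g)=\overline{f(g^{-1})}$ and convolution $(f_1*f_2)(g)=\sum_{g_1g_2=g}f_1(g_1)f_2(g_2)$. For $x\in X$, $\pi_x\colon\mathcal{C}_c(G)\to\mathcal{L}(\ell^2(G_x))$ is $\pi_x(f)\xi=f*\xi$; $C^*_r(G)$ is the completion of $\mathcal{C}_c(G)$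 in the norm $\sup_{x}\|\pi_x(f)\|$. Steinberg algebra. $\mathbb{C}G$ is the span of the functions $c_U\colon G\to\mathbb{C}$ ($c\in\mathbb{C}$, $U\subseteq G$ compact open bisection), where $c_U$ equals $c$ on $U$ and $0$ elsewhere, with convolution product. *)

theory Defs
  imports "HOL-Analysis.Analysis" "HOL-Library.Function_Algebras"
begin

section \<open>Topological groupoids\<close>

text \<open>
  A groupoid is identified with its set of morphisms, which is the underlying set of the
  topology \<open>gtop\<close>.  The values of \<open>src\<close>, \<open>rng\<close>, \<open>ginv\<close> outside this set, and of \<open>mul\<close> on
  non-composable pairs, are irrelevant.
\<close>

record 'a topgroupoid =
  gtop :: "'a topology"
  src :: "'a \<Rightarrow> 'a"
  rng :: "'a \<Rightarrow> 'a"
  mul :: "'a \<Rightarrow> 'a \<Rightarrow> 'a"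
  ginv :: "'a \<Rightarrow> 'a"

abbreviation arrows :: "'a topgroupoid \<Rightarrow> 'a set" where
  "arrows G \<equiv> topspace (gtop G)"

definition units :: "'a topgroupoid \<Rightarrow> 'a set" where
  "units G = {x \<in> arrows G. src G x = x}"

definition composable :: "'a topgroupoid \<Rightarrow> ('a \<times> 'a) set" where
  "composable G = {(g, h). g \<in> arrows G \<and> h \<in> arrows G \<and> src G g = rng G h}"

definition src_fibre :: "'a topgroupoid \<Rightarrow> 'a \<Rightarrow> 'a set" where
  "src_fibre G x = {g \<in> arrows G. src G g = x}"

definition isotropy :: "'a topgroupoid \<Rightarrow> 'a \<Rightarrow> 'a set" where
  "isotropy G x = {g \<in> arrows G. src G g = x \<and> rng G g = x}"

locale groupoid =
  fixes G :: "'a topgroupoid"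
  assumes src_closed: "g \<in> arrows G \<Longrightarrow> src G g \<in> arrows G"
    and rng_closed: "g \<in> arrows G \<Longrightarrow> rng G g \<in> arrows G"
    and src_src: "g \<in> arrows G \<Longrightarrow> src G (src G g) = src G g"
    and rng_src: "g \<in> arrows G \<Longrightarrow> rng G (src G g) = src G g"
    and src_rng: "g \<in> arrows G \<Longrightarrow> src G (rng G g) = rng G g"
    and rng_rng: "g \<in> arrows G \<Longrightarrow> rng G (rng G g) = rng G g"
    and mul_closed: "(g, h) \<in> composable G \<Longrightarrow> mul G g h \<in> arrows G"
    and src_mul: "(g, h) \<in> composable G \<Longrightarrow> src G (mul G g h) = src G h"
    and rng_mul: "(g, h) \<in> composable G \<Longrightarrow> rng G (mul G g h) = rng G g"
    and mul_assoc: "\<lbrakk>(g, h) \<in> composable G; (h, k) \<in> composable G\<rbrakk>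
      \<Longrightarrow> mul G (mul G g h) k = mul G g (mul G h k)"
    and mul_src: "g \<in> arrows G \<Longrightarrow> mul G g (src G g) = g"
    and rng_mul_left: "g \<in> arrows G \<Longrightarrow> mul G (rng G g) g = g"
    and ginv_closed: "g \<in> arrows G \<Longrightarrow> ginv G g \<in> arrows G"
    and src_ginv: "g \<in> arrows G \<Longrightarrow> src G (ginv G g) = rng G g"
    and rng_ginv: "g \<in> arrows G \<Longrightarrow> rng G (ginv G g) = src G g"
    and mul_ginv: "g \<in> arrows G \<Longrightarrow> mul G g (ginv G g) = rng G g"
    and ginv_mul: "g \<in> arrows G \<Longrightarrow> mul G (ginv G g) g = src G g"

text \<open>The arrow space itself is not assumed to be Hausdorff.\<close>

locale topological_groupoid = groupoid +
  assumes continuous_src: "continuous_map (gtop G) (gtop G) (src G)"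
    and continuous_rng: "continuous_map (gtop G) (gtop G) (rng G)"
    and continuous_ginv: "continuous_map (gtop G) (gtop G) (ginv G)"
    and continuous_mul:
      "continuous_map (subtopology (prod_topology (gtop G) (gtop G)) (composable G)) (gtop G)
         (\<lambda>(g, h). mul G g h)"
    and locally_compact: "locally_compact_space (gtop G)"
    and Hausdorff_units: "Hausdorff_space (subtopology (gtop G) (units G))"

definition local_homeomorphism :: "'a topology \<Rightarrow> 'b topology \<Rightarrow> ('a \<Rightarrow> 'b) \<Rightarrow> bool" where
  "local_homeomorphism S T f \<longleftrightarrow>
     (\<forall>x\<in>topspace S. \<exists>U. openin S U \<and> x \<in> U \<and> openin T (f ` U) \<and>
        homeomorphic_map (subtopology S U) (subtopology T (f ` U)) f)"

definition totally_disconnected_space :: "'a topology \<Rightarrow> bool" where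
  "totally_disconnected_space S \<longleftrightarrow>
     (\<forall>x\<in>topspace S. connected_component_of_set S x = {x})"

locale etale_groupoid = topological_groupoid +
  assumes local_homeo_rng:
    "local_homeomorphism (gtop G) (subtopology (gtop G) (units G)) (rng G)"

locale ample_groupoid = etale_groupoid +
  assumes totally_disconnected_units:
    "totally_disconnected_space (subtopology (gtop G) (units G))"

definition open_bisection :: "'a topgroupoid \<Rightarrow> 'a set \<Rightarrow> bool" where
  "open_bisection G U \<longleftrightarrow>
     openin (gtop G) U \<and> inj_on (rng G) U \<and> inj_on (src G) U"

text \<open>The fibre over \<open>x\<close> of the closure of the unit space.\<close>

definition unit_closure_fibre :: "'a topgroupoid \<Rightarrow> 'a \<Rightarrow> 'a set" where
  "unit_closure_fibre G x = (gtop G closure_of units G) \<inter> isotropy G x"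


section \<open>Complex algebras without unit, ideals and simplicity\<close>

record 'b complex_algebra =
  elems :: "'b set"
  azero :: "'b"
  aplus :: "'b \<Rightarrow> 'b \<Rightarrow> 'b"
  ascale :: "complex \<Rightarrow> 'b \<Rightarrow> 'b"
  atimes :: "'b \<Rightarrow> 'b \<Rightarrow> 'b"

record 'b normed_star_algebra = "'b complex_algebra" +
  astar :: "'b \<Rightarrow> 'b"
  anorm :: "'b \<Rightarrow> real"

definition adist :: "('b, 'z) normed_star_algebra_scheme \<Rightarrow> 'b \<Rightarrow> 'b \<Rightarrow> real" where
  "adist A x y = anorm A (aplus A x (ascale A (-1) y))"

definition two_sided_ideal :: "('b, 'z) complex_algebra_scheme \<Rightarrow> 'b set \<Rightarrow> bool" where
  "two_sided_ideal A I \<longleftrightarrow>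
     I \<subseteq> elems A \<and> azero A \<in> I \<and>
     (\<forall>x\<in>I. \<forall>y\<in>I. aplus A x y \<in> I) \<and>
     (\<forall>c. \<forall>x\<in>I. ascale A c x \<in> I) \<and>
     (\<forall>a\<in>elems A. \<forall>x\<in>I. atimes A a x \<in> I \<and> atimes A x a \<in> I)"

definition norm_closed :: "('b, 'z) normed_star_algebra_scheme \<Rightarrow> 'b set \<Rightarrow> bool" where
  "norm_closed A I \<longleftrightarrow>
     (\<forall>x\<in>elems A. (\<forall>e>0. \<exists>y\<in>I. adist A x y < e) \<longrightarrow> x \<in> I)"

definition simple_algebra :: "('b, 'z) complex_algebra_scheme \<Rightarrow> bool" where
  "simple_algebra A \<longleftrightarrow>
     elems A \<noteq> {azero A} \<and>
     (\<forall>I. two_sided_ideal A I \<longrightarrow> I = {azero A} \<or> I = elems A)"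

text \<open>For C*-algebras, simplicity refers to closed ideals only.\<close>

definition simple_cstar_algebra :: "('b, 'z) normed_star_algebra_scheme \<Rightarrow> bool" where
  "simple_cstar_algebra A \<longleftrightarrow>
     elems A \<noteq> {azero A} \<and>
     (\<forall>I. two_sided_ideal A I \<and> norm_closed A I \<longrightarrow> I = {azero A} \<or> I = elems A)"


section \<open>Completion of a normed algebra\<close>

definition cauchy_seqs :: "('b, 'z) normed_star_algebra_scheme \<Rightarrow> (nat \<Rightarrow> 'b) set" where
  "cauchy_seqs A =
     {a. (\<forall>n. a n \<in> elems A) \<and>
         (\<forall>e>0. \<exists>N. \<forall>m\<ge>N. \<forall>n\<ge>N. adist A (a m) (a n) < e)}"

definition cauchy_rel ::
    "('b, 'z) normed_star_algebra_scheme \<Rightarrow> ((nat \<Rightarrow> 'b) \<times> (nat \<Rightarrow> 'b)) set" where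
  "cauchy_rel A =
     {(a, b). a \<in> cauchy_seqs A \<and> b \<in> cauchy_seqs A \<and>
        (\<lambda>n. adist A (a n) (b n)) \<longlonglongrightarrow> 0}"

definition completion ::
    "('b, 'z) normed_star_algebra_scheme \<Rightarrow> (nat \<Rightarrow> 'b) set normed_star_algebra" where
  "completion A =
     \<lparr> elems = cauchy_seqs A // cauchy_rel A,
       azero = cauchy_rel A `` {\<lambda>_. azero A},
       aplus = (\<lambda>P Q. \<Union>p\<in>P. \<Union>q\<in>Q. cauchy_rel A `` {\<lambda>n. aplus A (p n) (q n)}),
       ascale = (\<lambda>c P. \<Union>p\<in>P. cauchy_rel A `` {\<lambda>n. ascale A c (p n)}),
       atimes = (\<lambda>P Q. \<Union>p\<in>P. \<Union>q\<in>Q. cauchy_rel A `` {\<lambda>n. atimes A (p n) (q n)}),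
       astar = (\<lambda>P. \<Union>p\<in>P. cauchy_rel A `` {\<lambda>n. astar A (p n)}),
       anorm = (\<lambda>P. THE l. \<forall>p\<in>P. (\<lambda>n. anorm A (p n)) \<longlonglongrightarrow> l) \<rparr>"


section \<open>Function algebras of a groupoid\<close>

text \<open>
  All functions on a groupoid are total functions vanishing off the set of arrows.  Sums and the
  zero of functions are the pointwise ones of \<^theory>\<open>HOL-Library.Function_Algebras\<close>; the
  pointwise product of that theory is not used.
\<close>

definition fscale :: "complex \<Rightarrow> ('a \<Rightarrow> complex) \<Rightarrow> 'a \<Rightarrow> complex" where
  "fscale c f = (\<lambda>g. c * f g)"

interpretation fun_space: vector_space "fscale :: complex \<Rightarrow> ('a \<Rightarrow> complex) \<Rightarrow> 'a \<Rightarrow> complex"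
  by unfold_locales (auto simp: fscale_def algebra_simps)

text \<open>
  If \<open>f1\<close> lies in the linear span of the spaces \<open>Cc G U\<close> below, only finitely many terms of the
  sum are nonzero, for every function \<open>f2\<close>.
\<close>

definition convolution ::
    "'a topgroupoid \<Rightarrow> ('a \<Rightarrow> complex) \<Rightarrow> ('a \<Rightarrow> complex) \<Rightarrow> 'a \<Rightarrow> complex" where
  "convolution G f1 f2 =
     (\<lambda>g. \<Sum>\<^sub>\<infinity>(g1, g2)\<in>{(g1, g2) \<in> composable G. mul G g1 g2 = g}. f1 g1 * f2 g2)"

definition involution :: "'a topgroupoid \<Rightarrow> ('a \<Rightarrow> complex) \<Rightarrow> 'a \<Rightarrow> complex" where
  "involution G f = (\<lambda>g. if g \<in> arrows G then cnj (f (ginv G g)) else 0)"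


subsection \<open>The Steinberg algebra\<close>

definition const_on :: "complex \<Rightarrow> 'a set \<Rightarrow> 'a \<Rightarrow> complex" where
  "const_on c U = (\<lambda>g. if g \<in> U then c else 0)"

definition steinberg_algebra :: "'a topgroupoid \<Rightarrow> ('a \<Rightarrow> complex) complex_algebra" where
  "steinberg_algebra G =
     \<lparr> elems = fun_space.span {const_on c U |c U. open_bisection G U \<and> compactin (gtop G) U},
       azero = 0,
       aplus = (+),
       ascale = fscale,
       atimes = convolution G \<rparr>"


subsection \<open>The reduced C*-algebra\<close>

text \<open>
  The support of \<open>f\<close> is the closure taken in \<open>U\<close>, not in the possibly non-Hausdorff space of
  all arrows.
\<close>

definition Cc :: "'a topgroupoid \<Rightarrow> 'a set \<Rightarrow> ('a \<Rightarrow> complex) set" where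
  "Cc G U =
     {f. continuous_map (subtopology (gtop G) U) euclidean f \<and>
         compactin (subtopology (gtop G) U)
           (subtopology (gtop G) U closure_of {g \<in> U. f g \<noteq> 0}) \<and>
         (\<forall>g. g \<notin> U \<longrightarrow> f g = 0)}"

definition Cc_span :: "'a topgroupoid \<Rightarrow> ('a \<Rightarrow> complex) set" where
  "Cc_span G = fun_space.span (\<Union>U\<in>{U. open_bisection G U}. Cc G U)"

definition ell2 :: "'a set \<Rightarrow> ('a \<Rightarrow> complex) set" where
  "ell2 S = {\<xi>. (\<forall>g. g \<notin> S \<longrightarrow> \<xi> g = 0) \<and> (\<lambda>g. (cmod (\<xi> g))\<^sup>2) summable_on S}"

definition ell2_norm :: "'a set \<Rightarrow> ('a \<Rightarrow> complex) \<Rightarrow> real" where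
  "ell2_norm S \<xi> = sqrt (\<Sum>\<^sub>\<infinity>g\<in>S. (cmod (\<xi> g))\<^sup>2)"

definition ell2_onorm :: "'a set \<Rightarrow> (('a \<Rightarrow> complex) \<Rightarrow> 'a \<Rightarrow> complex) \<Rightarrow> real" where
  "ell2_onorm S T = (SUP \<xi>\<in>{\<xi> \<in> ell2 S. ell2_norm S \<xi> \<le> 1}. ell2_norm S (T \<xi>))"

text \<open>The representation \<open>\<pi>\<^sub>x\<close> on \<open>ell2 (src_fibre G x)\<close> is \<open>f \<mapsto> convolution G f\<close>.\<close>

definition reduced_norm :: "'a topgroupoid \<Rightarrow> ('a \<Rightarrow> complex) \<Rightarrow> real" where
  "reduced_norm G f = (SUP x\<in>units G. ell2_onorm (src_fibre G x) (convolution G f))"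

definition Cc_algebra :: "'a topgroupoid \<Rightarrow> ('a \<Rightarrow> complex) normed_star_algebra" where
  "Cc_algebra G =
     \<lparr> elems = Cc_span G,
       azero = 0,
       aplus = (+),
       ascale = fscale,
       atimes = convolution G,
       astar = involution G,
       anorm = reduced_norm G \<rparr>"

definition reduced_cstar_algebra ::
    "'a topgroupoid \<Rightarrow> (nat \<Rightarrow> 'a \<Rightarrow> complex) set normed_star_algebra" where
  "reduced_cstar_algebra G = completion (Cc_algebra G)"

end

theory Submission
  imports Defs "HOL-Algebra.Group"
begin

text \<open>
  Let \<open>I\<close> be a proper closed ideal of the reduced algebra. Its intersection with the Steinberg algebra
  is an ideal there, and it is proper because the Steinberg algebra is dense; hence it is zero.

  Simplicity of the Steinberg algebra has two further consequences. It forces the groupoid to be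
  effective, so every \<open>f\<close> in the Steinberg algebra can be compressed to a multiple \<open>c\<close> of the unit on
  some compact open set \<open>V\<close> inside any given open set of units. If \<open>f\<close> has distance less than \<open>\<bar>c\<bar>\<close>
  from \<open>I\<close>, then the projection \<open>1\<^sub>V\<close> has distance less than 1 from \<open>I\<close> and so lies in \<open>I\<close>, which is
  impossible. Hence the distance of \<open>f\<close> from \<open>I\<close> dominates \<open>\<bar>f\<bar>\<close> on a dense open set. Moreover, the
  functions in the Steinberg algebra vanishing on a dense open set form an ideal, so they are zero.

  Suppose \<open>I\<close> is nonzero. After a translation it contains some \<open>a\<close> whose coefficient function satisfies
  \<open>a(x) \<noteq> 0\<close> at a unit \<open>x\<close>. The finite set \<open>F\<close> of points of the closure of the unit space in the
  isotropy group at \<open>x\<close> is closed under conjugation and squares, so it generates a finite group \<open>H\<close>.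
  For compact open bisections \<open>U\<^sub>h\<close> around the points \<open>h\<close> of \<open>H\<close>, the finite sum of the
  indicator functions of the \<open>U\<^sub>h\<close> with coefficients \<open>a(h)\<close> approximates \<open>a\<close> uniformly near \<open>x\<close>.
  Since it has finitely many values, its restriction to a small neighbourhood of \<open>x\<close> vanishes on a
  dense open set, but not at \<open>x\<close>: a contradiction.
\<close>

section \<open>Zero-dimensional spaces\<close>

text \<open>Functions in the Steinberg algebra of a non-Hausdorff groupoid need not be continuous,
  so an estimate on a dense open set says nothing about the value at \<open>x\<close>. Nor does the
  vanishing of singular functions pass to norm limits by itself: an approximant of \<open>a\<close>
  is only small, not zero, on a dense open set, and it changes with the precision. The finite set
  \<open>H\<close> breaks this circle. The values of the comparison function are partial sums of the
  numbers \<open>a(h)\<close>, so the gap between 0 and its nonzero values is known before the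
  precision is chosen; below that gap, small means zero.

  The set \<open>F\<close> alone would be too small. Over a neighbourhood of \<open>x\<close>, a
  bisection through an arrow \<open>w\<close> is disjoint from a bisection through \<open>k\<close>
  as soon as \<open>w k^{-1}\<close> lies outside the closure of the units. So the arrows to be
  tracked must be stable under left multiplication by \<open>F\<close>, which need not be closed
  under products; closure under conjugation and squares is what remains to make the generated group
  finite.\<close>

lemma locally_compact_totally_disconnected_base:
  assumes lc: "locally_compact_space X" and hd: "Hausdorff_space X"
    and td: "totally_disconnected_space X"
    and W: "openin X W" "x \<in> W"
  obtains K where "openin X K" "compactin X K" "x \<in> K" "K \<subseteq> W"
proof -
  have "neighbourhood_base_of (compactin X) X"
    using lc hd locally_compact_space_neighbourhood_base by blast
  then obtain V L where VL: "openin X V" "compactin X L" "x \<in> V" "V \<subseteq> L" "L \<subseteq> W"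
    using W unfolding neighbourhood_base_of by meson
  have LX: "L \<subseteq> topspace X" by (simp add: VL compactin_subset_topspace)
  let ?L = "subtopology X L"
  have tL: "topspace ?L = L" using LX by auto
  have cL: "compact_space ?L" using VL compact_space_subtopology by blast
  have hL: "Hausdorff_space ?L" using hd Hausdorff_space_subtopology by blast
  have xL: "x \<in> topspace ?L" using VL tL by blast
  have "connected_component_of_set ?L x \<subseteq> connected_component_of_set X x"
    by (auto simp: connected_component_of_def connectedin_subtopology)
  also have "\<dots> = {x}" using td VL LX unfolding totally_disconnected_space_def by blast
  finally have "connected_component_of_set ?L x = {x}"
    using xL connected_component_of_refl by fastforce
  \<comment> \<open>In the compact Hausdorff set \<open>L\<close> quasi-components are components,
    so a clopen subset of \<open>L\<close> separates \<open>x\<close> from the compact remainder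
    \<open>L - V\<close>.\<close>
  moreover have "quasi_component_of ?L x = connected_component_of ?L x"
    by (rule quasi_eq_connected_component_of) (simp add: cL hL)
  ultimately have "{x} \<in> quasi_components_of ?L"
    unfolding quasi_components_of_def using xL by (intro image_eqI[of _ _ x]) auto
  moreover have "compactin ?L (L - V)"
  proof -
    have "closedin ?L (L - V)"
      unfolding closedin_subtopology
      by (rule exI[of _ "topspace X - V"]) (use VL LX in auto)
    then show ?thesis by (rule closedin_compact_space[OF cL])
  qed
  ultimately have "separated_between ?L {x} (L - V)"
    by (simp add: separated_between_quasi_component_compact VL(3))
  then obtain T where T: "closedin ?L T" "openin ?L T" "x \<in> T" "L - V \<subseteq> topspace ?L - T"
    unfolding separated_between by blast
  have TV: "T \<subseteq> V" using closedin_subset[OF T(1)] T(4) tL by auto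
  \<comment> \<open>\<open>T\<close> is open only relative to \<open>L\<close>, but it lies in
    \<open>V\<close>, which is open in \<open>X\<close> and contained in \<open>L\<close>.\<close>
  obtain T' where T': "openin X T'" "T = T' \<inter> L" using T(2) openin_subtopology by metis
  then have "T = T' \<inter> V" using TV VL by blast
  then have "openin X T" using T' VL by blast
  moreover have "compactin X T"
    using closedin_compact_space[OF cL T(1)] by (simp add: compactin_subtopology)
  ultimately show ?thesis using that TV T(3) VL by blast
qed

section \<open>Groupoids\<close>

context groupoid
begin

abbreviation gmul :: "'a \<Rightarrow> 'a \<Rightarrow> 'a" (infixl "\<cdot>" 70) where
  "g \<cdot> h \<equiv> mul G g h"

abbreviation conv :: "('a \<Rightarrow> complex) \<Rightarrow> ('a \<Rightarrow> complex) \<Rightarrow> 'a \<Rightarrow> complex" where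
  "conv \<equiv> convolution G"

abbreviation rnorm :: "('a \<Rightarrow> complex) \<Rightarrow> real" where
  "rnorm \<equiv> reduced_norm G"

abbreviation gopen :: "'a set \<Rightarrow> bool" where
  "gopen \<equiv> openin (gtop G)"

abbreviation unit_space :: "'a topology" where
  "unit_space \<equiv> subtopology (gtop G) (units G)"

lemma composableI [intro]:
  "g \<in> arrows G \<Longrightarrow> h \<in> arrows G \<Longrightarrow> src G g = rng G h \<Longrightarrow> (g, h) \<in> composable G"
  by (auto simp: composable_def)

lemma units_arrows: "x \<in> units G \<Longrightarrow> x \<in> arrows G"
  and src_unit: "x \<in> units G \<Longrightarrow> src G x = x"
  and rng_unit: "x \<in> units G \<Longrightarrow> rng G x = x"
proof -
  assume x: "x \<in> units G"
  then show a: "x \<in> arrows G" "src G x = x" by (auto simp: units_def)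
  show "rng G x = x" using rng_src[OF a(1)] a(2) by simp
qed

lemma src_units: "g \<in> arrows G \<Longrightarrow> src G g \<in> units G"
  and rng_units: "g \<in> arrows G \<Longrightarrow> rng G g \<in> units G"
  by (auto simp: units_def src_closed rng_closed src_src src_rng)

lemma mul_arrows [simp]:
  "g \<in> arrows G \<Longrightarrow> h \<in> arrows G \<Longrightarrow> src G g = rng G h \<Longrightarrow> g \<cdot> h \<in> arrows G"
  by (simp add: composableI mul_closed)

lemma src_mul' [simp]:
  "g \<in> arrows G \<Longrightarrow> h \<in> arrows G \<Longrightarrow> src G g = rng G h \<Longrightarrow> src G (g \<cdot> h) = src G h"
  by (simp add: composableI src_mul)

lemma rng_mul' [simp]:
  "g \<in> arrows G \<Longrightarrow> h \<in> arrows G \<Longrightarrow> src G g = rng G h \<Longrightarrow> rng G (g \<cdot> h) = rng G g"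
  by (simp add: composableI rng_mul)

lemma mul_assoc':
  "\<lbrakk>g \<in> arrows G; h \<in> arrows G; k \<in> arrows G; src G g = rng G h; src G h = rng G k\<rbrakk>
   \<Longrightarrow> g \<cdot> h \<cdot> k = g \<cdot> (h \<cdot> k)"
  by (simp add: composableI mul_assoc)

lemma inv_mul_cancel:
  assumes "u \<in> arrows G" "g \<in> arrows G"
  shows "src G u = rng G g \<Longrightarrow> ginv G u \<cdot> (u \<cdot> g) = g"
    and "rng G u = rng G g \<Longrightarrow> u \<cdot> (ginv G u \<cdot> g) = g"
  using assms mul_assoc'[of "ginv G u" u g] mul_assoc'[of u "ginv G u" g] rng_mul_left[of g]
  by (auto simp: ginv_closed src_ginv rng_ginv mul_ginv ginv_mul)

lemma mul_inv_cancel: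
  assumes v: "v \<in> arrows G" and g: "g \<in> arrows G"
  shows "src G g = rng G v \<Longrightarrow> (g \<cdot> v) \<cdot> ginv G v = g"
    and "src G g = src G v \<Longrightarrow> (g \<cdot> ginv G v) \<cdot> v = g"
proof -
  assume h: "src G g = rng G v"
  have "(g \<cdot> v) \<cdot> ginv G v = g \<cdot> (v \<cdot> ginv G v)"
    by (rule mul_assoc') (simp_all add: v g h ginv_closed rng_ginv)
  also have "\<dots> = g \<cdot> src G g" by (simp only: mul_ginv[OF v] h)
  also have "\<dots> = g" by (rule mul_src[OF g])
  finally show "(g \<cdot> v) \<cdot> ginv G v = g" .
next
  assume h: "src G g = src G v"
  have "(g \<cdot> ginv G v) \<cdot> v = g \<cdot> (ginv G v \<cdot> v)"
    by (rule mul_assoc') (simp_all add: v g h ginv_closed rng_ginv src_ginv)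
  also have "\<dots> = g \<cdot> src G g" by (simp only: ginv_mul[OF v] h)
  also have "\<dots> = g" by (rule mul_src[OF g])
  finally show "(g \<cdot> ginv G v) \<cdot> v = g" .
qed

lemma ginv_ginv: "g \<in> arrows G \<Longrightarrow> ginv G (ginv G g) = g"
  using inv_mul_cancel(1)[of "ginv G g" g]
  by (metis ginv_closed ginv_mul mul_src rng_ginv src_ginv)

lemma ginv_unit: "x \<in> units G \<Longrightarrow> ginv G x = x"
  by (metis ginv_closed ginv_mul mul_src rng_ginv rng_unit src_ginv src_unit units_arrows)

lemma mul_unit_left: "x \<in> units G \<Longrightarrow> g \<in> arrows G \<Longrightarrow> rng G g = x \<Longrightarrow> x \<cdot> g = g"
  using rng_mul_left by blast



section \<open>Isotropy groups and bisections\<close>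

definition isotropy_group :: "'a \<Rightarrow> 'a monoid" where
  "isotropy_group x = \<lparr>carrier = isotropy G x, monoid.mult = mul G, one = x\<rparr>"

lemma group_isotropy_group:
  assumes "x \<in> units G"
  shows "group (isotropy_group x)"
proof (rule groupI, goal_cases)
  case (5 g)
  then show ?case
    by (intro bexI[of _ "ginv G g"])
      (auto simp: isotropy_group_def isotropy_def ginv_closed src_ginv rng_ginv ginv_mul)
qed (use assms in \<open>auto simp: isotropy_group_def isotropy_def mul_assoc' units_arrows src_unit
      rng_unit mul_unit_left\<close>)

lemma inv_isotropy_group:
  assumes "x \<in> units G" "g \<in> isotropy G x"
  shows "inv\<^bsub>isotropy_group x\<^esub> g = ginv G g"
  by (rule group.inv_equality[OF group_isotropy_group[OF assms(1)]])
    (use assms in \<open>auto simp: isotropy_group_def isotropy_def ginv_closed src_ginv rng_ginv ginv_mul\<close>)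

text \<open>Openness is left out, since the convolution formulas use injectivity only. In this sense
  singletons are bisections, which covers convolution with point masses.\<close>

definition bisection :: "'a set \<Rightarrow> bool" where
  "bisection U \<longleftrightarrow> U \<subseteq> arrows G \<and> inj_on (rng G) U \<and> inj_on (src G) U"

definition set_mul :: "'a set \<Rightarrow> 'a set \<Rightarrow> 'a set" where
  "set_mul U V = {u \<cdot> v |u v. u \<in> U \<and> v \<in> V \<and> src G u = rng G v}"

lemma bisectionD:
  assumes "bisection U"
  shows "u \<in> U \<Longrightarrow> u \<in> arrows G"
    and "u \<in> U \<Longrightarrow> u' \<in> U \<Longrightarrow> rng G u = rng G u' \<Longrightarrow> u = u'"
    and "u \<in> U \<Longrightarrow> u' \<in> U \<Longrightarrow> src G u = src G u' \<Longrightarrow> u = u'"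
  using assms by (auto simp: bisection_def inj_on_def)

lemma bisection_subset: "bisection U \<Longrightarrow> V \<subseteq> U \<Longrightarrow> bisection V"
  unfolding bisection_def by (meson inj_on_subset order_trans)

lemma bisection_units: "V \<subseteq> units G \<Longrightarrow> bisection V"
  unfolding bisection_def inj_on_def using units_arrows src_unit rng_unit
  by (metis subset_eq)

lemma bisection_set_mul:
  assumes U: "bisection U" and V: "bisection V"
  shows "bisection (set_mul U V)"
proof -
  have *: "u \<in> arrows G" if "u \<in> U \<or> u \<in> V" for u
    using that U V bisectionD(1) by blast
  have "u \<cdot> v = u' \<cdot> v'"
    if h: "u \<in> U" "v \<in> V" "src G u = rng G v" "u' \<in> U" "v' \<in> V" "src G u' = rng G v'"
      and e: "rng G (u \<cdot> v) = rng G (u' \<cdot> v') \<or> src G (u \<cdot> v) = src G (u' \<cdot> v')" for u v u' v'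
  proof -
    have "rng G u = rng G u' \<or> src G v = src G v'" using e h * by simp
    then have "u = u' \<or> v = v'" using bisectionD(2)[OF U] bisectionD(3)[OF V] h by blast
    then have "u = u' \<and> v = v'" using bisectionD(3)[OF U] bisectionD(2)[OF V] h by auto
    then show ?thesis by simp
  qed
  then have "p = q" if "p \<in> set_mul U V" "q \<in> set_mul U V" "rng G p = rng G q \<or> src G p = src G q" for p q
    using that unfolding set_mul_def by blast
  moreover have "set_mul U V \<subseteq> arrows G"
    using * unfolding set_mul_def by auto
  ultimately show ?thesis unfolding bisection_def inj_on_def by blast
qed

lemma bisection_ginv:
  assumes "bisection U"
  shows "bisection (ginv G ` U)"
  using bisectionD[OF assms] by (fastforce simp: bisection_def inj_on_def ginv_closed src_ginv rng_ginv)

end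

section \<open>Topology of ample groupoids\<close>

lemma local_homeomorphism_open_map:
  assumes "local_homeomorphism S T f"
  shows "open_map S T f"
  unfolding open_map_def
proof (intro allI impI)
  fix O' assume O: "openin S O'"
  show "openin T (f ` O')"
  proof (subst openin_subopen, intro ballI)
    fix y assume "y \<in> f ` O'"
    then obtain x where x: "x \<in> O'" "y = f x" by blast
    then have "x \<in> topspace S" using O openin_subset by blast
    then obtain U where U: "openin S U" "x \<in> U" "openin T (f ` U)"
      "homeomorphic_map (subtopology S U) (subtopology T (f ` U)) f"
      using assms unfolding local_homeomorphism_def by blast
    have "openin (subtopology S U) (U \<inter> O')"
      using O by (simp add: openin_subtopology_Int2)
    then have "openin (subtopology T (f ` U)) (f ` (U \<inter> O'))"
      using U(4) homeomorphic_imp_open_map open_map_def by blast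
    then have "openin T (f ` (U \<inter> O'))"
      using U(3) openin_trans_full by blast
    then show "\<exists>T'. openin T T' \<and> y \<in> T' \<and> T' \<subseteq> f ` O'"
      using x U(2) by blast
  qed
qed

context topological_groupoid
begin

lemma open_src_vimage: "gopen V \<Longrightarrow> gopen {g \<in> arrows G. src G g \<in> V}"
  using continuous_src openin_continuous_map_preimage by blast

lemma open_rng_vimage: "gopen V \<Longrightarrow> gopen {g \<in> arrows G. rng G g \<in> V}"
  using continuous_rng openin_continuous_map_preimage by blast

lemma ginv_image_eq:
  assumes "U \<subseteq> arrows G"
  shows "ginv G ` U = {g \<in> arrows G. ginv G g \<in> U}"
proof (intro equalityI subsetI)
  fix g assume "g \<in> {g \<in> arrows G. ginv G g \<in> U}"
  then show "g \<in> ginv G ` U" using ginv_ginv[of g] by (intro image_eqI[of _ _ "ginv G g"]) auto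
qed (use assms in \<open>auto simp: ginv_closed ginv_ginv subset_iff\<close>)

lemma open_ginv: "gopen U \<Longrightarrow> gopen (ginv G ` U)"
  using openin_continuous_map_preimage[OF continuous_ginv] by (simp add: ginv_image_eq openin_subset)

lemma compact_ginv: "compactin (gtop G) U \<Longrightarrow> compactin (gtop G) (ginv G ` U)"
  using continuous_ginv image_compactin by blast

lemma mul_open_neighbourhoods:
  assumes "g \<in> arrows G" "h \<in> arrows G" "src G g = rng G h" "gopen W" "g \<cdot> h \<in> W"
  obtains A B where "gopen A" "gopen B" "g \<in> A" "h \<in> B"
    "\<And>a b. a \<in> A \<Longrightarrow> b \<in> B \<Longrightarrow> src G a = rng G b \<Longrightarrow> a \<cdot> b \<in> W"
proof -
  let ?P = "prod_topology (gtop G) (gtop G)"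
  let ?S = "{p \<in> topspace (subtopology ?P (composable G)). (\<lambda>(g, h). g \<cdot> h) p \<in> W}"
  have "openin (subtopology ?P (composable G)) ?S"
    using continuous_mul assms(4) openin_continuous_map_preimage by blast
  then obtain T where T: "openin ?P T" "?S = T \<inter> composable G"
    unfolding openin_subtopology by blast
  have "(g, h) \<in> ?S" using assms by (auto simp: composable_def)
  then have "(g, h) \<in> T" using T by blast
  then obtain A B where AB: "gopen A" "gopen B" "g \<in> A" "h \<in> B" "A \<times> B \<subseteq> T"
    using T(1) unfolding openin_prod_topology_alt by metis
  show ?thesis
  proof (rule that[OF AB(1-4)])
    fix a b assume ab: "a \<in> A" "b \<in> B" "src G a = rng G b"
    then have "a \<in> arrows G" "b \<in> arrows G" using AB openin_subset by blast+
    then have "(a, b) \<in> T \<inter> composable G" using ab AB by blast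
    then show "a \<cdot> b \<in> W" using T by auto
  qed
qed

text \<open>Quotients of arrows with a common source are what compares two bisections near a point:
  the quotient of an arrow by itself is a unit.\<close>

lemma div_open_neighbourhoods:
  assumes "g \<in> arrows G" "h \<in> arrows G" "src G g = src G h" "gopen W" "g \<cdot> ginv G h \<in> W"
  obtains A B where "gopen A" "gopen B" "g \<in> A" "h \<in> B"
    "\<And>a b. a \<in> A \<Longrightarrow> b \<in> B \<Longrightarrow> src G a = src G b \<Longrightarrow> a \<cdot> ginv G b \<in> W"
proof -
  obtain A B where AB: "gopen A" "gopen B" "g \<in> A" "ginv G h \<in> B"
    "\<And>a b. a \<in> A \<Longrightarrow> b \<in> B \<Longrightarrow> src G a = rng G b \<Longrightarrow> a \<cdot> b \<in> W"
    using mul_open_neighbourhoods[of g "ginv G h" W] assms by (metis ginv_closed rng_ginv)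
  have B: "B \<subseteq> arrows G" using AB openin_subset by blast
  show ?thesis
  proof (rule that[of A "ginv G ` B"])
    show "h \<in> ginv G ` B" using AB(4) assms(2) ginv_ginv by (metis imageI)
    fix a b assume ab: "a \<in> A" "b \<in> ginv G ` B" "src G a = src G b"
    then obtain b' where b': "b' \<in> B" "b = ginv G b'" by blast
    then have "b' \<in> arrows G" using B by blast
    then show "a \<cdot> ginv G b \<in> W" using AB(5)[OF ab(1) b'(1)] ab(3) b'(2) by (simp add: ginv_ginv src_ginv)
  qed (use AB open_ginv in auto)
qed

text \<open>Source and range map into the Hausdorff unit space, so the composable pairs form a
  closed subset of the product even though the arrow space need not be Hausdorff. The product set is
  therefore a continuous image of a compact set.\<close>

lemma compact_set_mul:
  assumes "compactin (gtop G) U" "compactin (gtop G) V"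
  shows "compactin (gtop G) (set_mul U V)"
proof -
  let ?P = "prod_topology (gtop G) (gtop G)"
  let ?X = "unit_space"
  have "continuous_map (gtop G) ?X (src G)" "continuous_map (gtop G) ?X (rng G)"
    using continuous_src continuous_rng src_units rng_units
    by (auto simp: continuous_map_in_subtopology)
  then have "continuous_map ?P ?X (src G \<circ> fst)" "continuous_map ?P ?X (rng G \<circ> snd)"
    by (auto intro: continuous_map_compose continuous_map_fst continuous_map_snd)
  then have "closedin ?P {p \<in> topspace ?P. (src G \<circ> fst) p = (rng G \<circ> snd) p}"
    using closedin_continuous_maps_eq Hausdorff_units by blast
  moreover have "{p \<in> topspace ?P. (src G \<circ> fst) p = (rng G \<circ> snd) p} = composable G"
    by (auto simp: composable_def)
  ultimately have "closedin ?P (composable G)" by simp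
  moreover have "compactin ?P (U \<times> V)"
    using assms by (simp add: compactin_Times)
  ultimately have "compactin ?P (composable G \<inter> U \<times> V)"
    by (rule closed_Int_compactin)
  then have "compactin (subtopology ?P (composable G)) (composable G \<inter> U \<times> V)"
    by (simp add: compactin_subtopology)
  then have "compactin (gtop G) ((\<lambda>(g, h). g \<cdot> h) ` (composable G \<inter> U \<times> V))"
    using continuous_mul image_compactin by blast
  moreover have "(\<lambda>(g, h). g \<cdot> h) ` (composable G \<inter> U \<times> V) = set_mul U V"
  proof -
    have "U \<subseteq> arrows G" "V \<subseteq> arrows G" using assms compactin_subset_topspace by blast+
    then show ?thesis by (force simp: set_mul_def composable_def image_iff)
  qed
  ultimately show ?thesis by simp
qed

text \<open>Source and range are continuous maps into the Hausdorff unit space and agree on the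
  units, hence on their closure.\<close>

lemma closure_units_isotropic:
  assumes "g \<in> gtop G closure_of units G"
  shows "g \<in> arrows G" "src G g = rng G g"
proof -
  show "g \<in> arrows G" using assms by (simp add: in_closure_of)
  let ?X = "unit_space"
  have "continuous_map (gtop G) ?X (src G)" "continuous_map (gtop G) ?X (rng G)"
    using continuous_src continuous_rng src_units rng_units
    by (auto simp: continuous_map_in_subtopology)
  then show "src G g = rng G g"
    using forall_in_closure_of_eq[OF assms Hausdorff_units] src_unit rng_unit by metis
qed

end

context etale_groupoid
begin

lemma open_units: "gopen (units G)"
proof (subst openin_subopen, intro ballI)
  fix x assume x: "x \<in> units G"
  then have xa: "x \<in> arrows G" by (rule units_arrows)
  then obtain U where U: "gopen U" "x \<in> U"
    "homeomorphic_map (subtopology (gtop G) U)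
       (subtopology unit_space (rng G ` U)) (rng G)"
    using local_homeo_rng unfolding local_homeomorphism_def by blast
  have UA: "U \<subseteq> arrows G" using U openin_subset by blast
  have inj: "inj_on (rng G) U"
    using homeomorphic_imp_injective_map[OF U(3)] UA by (simp add: Int_absorb1)
  let ?T = "U \<inter> {g \<in> arrows G. rng G g \<in> U}"
  have "gopen ?T" using U(1) open_rng_vimage by blast
  moreover have "x \<in> ?T" using U(2) x xa rng_unit by simp
  \<comment> \<open>Both \<open>g\<close> and \<open>rng G g\<close> lie in \<open>U\<close> and
    they have the same range, so injectivity of the range map on \<open>U\<close> identifies
    them.\<close>
  moreover have "?T \<subseteq> units G"
  proof
    fix g assume g: "g \<in> ?T"
    then have "rng G (rng G g) = rng G g" by (simp add: rng_rng)
    then have "rng G g = g" using g inj by (simp add: inj_on_def)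
    then show "g \<in> units G" using g rng_units by fastforce
  qed
  ultimately show "\<exists>T. gopen T \<and> x \<in> T \<and> T \<subseteq> units G" by blast
qed

lemma open_units_iff: "openin unit_space V \<longleftrightarrow> gopen V \<and> V \<subseteq> units G"
  using open_units openin_open_subtopology by blast

lemma open_rng: "gopen U \<Longrightarrow> gopen (rng G ` U)"
  using local_homeomorphism_open_map[OF local_homeo_rng] open_units_iff unfolding open_map_def by blast

lemma src_image_eq: "U \<subseteq> arrows G \<Longrightarrow> src G ` U = rng G ` (ginv G ` U)"
  by (force simp: image_iff rng_ginv subset_iff)

lemma open_src: "gopen U \<Longrightarrow> gopen (src G ` U)"
  using open_rng open_ginv src_image_eq openin_subset by metis

text \<open>Near a product of \<open>u\<close> and \<open>v\<close>, an arrow \<open>a\<close> can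
  be divided by the arrow \<open>b\<close> of \<open>V\<close> close to \<open>v\<close> with the
  same source, and by continuity the quotient stays in \<open>U\<close>. Such a \<open>b\<close>
  exists for all \<open>a\<close> near the product because the source map is open.\<close>

lemma open_set_mul:
  assumes U: "gopen U" and V: "gopen V"
  shows "gopen (set_mul U V)"
proof (subst openin_subopen, intro ballI)
  fix g assume "g \<in> set_mul U V"
  then obtain u v where uv: "u \<in> U" "v \<in> V" "src G u = rng G v" "g = u \<cdot> v"
    by (auto simp: set_mul_def)
  have ar: "u \<in> arrows G" "v \<in> arrows G" using uv U V openin_subset by blast+
  have "g \<cdot> ginv G v = u" using uv ar by (simp add: mul_inv_cancel)
  then obtain A B where AB: "gopen A" "gopen B" "g \<in> A" "v \<in> B"
    "\<And>a b. a \<in> A \<Longrightarrow> b \<in> B \<Longrightarrow> src G a = src G b \<Longrightarrow> a \<cdot> ginv G b \<in> U"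
    using div_open_neighbourhoods[of g v U] uv ar U by (metis mul_arrows src_mul')
  let ?T = "A \<inter> {h \<in> arrows G. src G h \<in> src G ` (B \<inter> V)}"
  have "gopen ?T"
    using AB V open_src open_src_vimage by blast
  moreover have "g \<in> ?T" using AB uv ar by auto
  moreover have "?T \<subseteq> set_mul U V"
  proof
    fix a assume a: "a \<in> ?T"
    then obtain b where b: "b \<in> B" "b \<in> V" "src G a = src G b" by auto
    have ar: "a \<in> arrows G" "b \<in> arrows G" using a b V openin_subset by blast+
    have "a \<cdot> ginv G b \<in> U" using AB a b by blast
    moreover have "a = (a \<cdot> ginv G b) \<cdot> b" "src G (a \<cdot> ginv G b) = rng G b"
      using ar b by (auto simp: mul_inv_cancel ginv_closed rng_ginv src_ginv)
    ultimately show "a \<in> set_mul U V" using b(2) unfolding set_mul_def by blast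
  qed
  ultimately show "\<exists>T. gopen T \<and> g \<in> T \<and> T \<subseteq> set_mul U V" by blast
qed

definition compact_bisection :: "'a set \<Rightarrow> bool" where
  "compact_bisection U \<longleftrightarrow> open_bisection G U \<and> compactin (gtop G) U"

lemma open_bisection_iff: "open_bisection G U \<longleftrightarrow> gopen U \<and> bisection U"
  using openin_subset by (auto simp: open_bisection_def bisection_def)

lemma compact_bisection_iff:
  "compact_bisection U \<longleftrightarrow> gopen U \<and> compactin (gtop G) U \<and> bisection U"
  by (auto simp: compact_bisection_def open_bisection_iff)

lemma compact_bisection_set_mul:
  "compact_bisection U \<Longrightarrow> compact_bisection V \<Longrightarrow> compact_bisection (set_mul U V)"
  by (simp add: compact_bisection_iff open_set_mul compact_set_mul bisection_set_mul)

lemma compact_bisection_ginv: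
  "compact_bisection U \<Longrightarrow> compact_bisection (ginv G ` U)"
  by (simp add: compact_bisection_iff open_ginv compact_ginv bisection_ginv)

lemma compact_bisection_rng:
  "compact_bisection U \<Longrightarrow> compact_bisection (rng G ` U)"
  using continuous_rng image_compactin rng_units bisectionD(1)
  by (fastforce simp: compact_bisection_iff open_rng intro!: bisection_units)

lemma Hausdorff_open_bisection:
  assumes "open_bisection G U"
  shows "Hausdorff_space (subtopology (gtop G) U)"
proof (rule Hausdorff_space_injective_preimage[OF Hausdorff_units])
  show "continuous_map (subtopology (gtop G) U) unit_space (rng G)"
    using continuous_rng rng_units by (auto simp: continuous_map_in_subtopology continuous_map_from_subtopology)
  show "inj_on (rng G) (topspace (subtopology (gtop G) U))"
    using assms by (auto simp: open_bisection_def inj_on_def)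
qed

text \<open>Local compactness supplies one compact neighbourhood of each point, and without the
  Hausdorff property this does not pass to an open subspace. The range map carries the compact
  neighbourhood into the unit space instead.\<close>

lemma locally_compact_units: "locally_compact_space unit_space"
  unfolding locally_compact_space_def
proof
  fix x assume "x \<in> topspace unit_space"
  then have x: "x \<in> units G" "x \<in> arrows G" by auto
  then obtain U K where UK: "gopen U" "compactin (gtop G) K" "x \<in> U" "U \<subseteq> K"
    using locally_compact unfolding locally_compact_space_def by blast
  have "compactin (gtop G) (rng G ` K)" using UK continuous_rng image_compactin by blast
  moreover have "K \<subseteq> arrows G" using UK compactin_subset_topspace by blast
  then have "rng G ` K \<subseteq> units G" using rng_units by blast
  ultimately have "compactin unit_space (rng G ` K)"
    by (simp add: compactin_subtopology)
  moreover have "rng G ` U \<subseteq> rng G ` K" using UK by blast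
  moreover have "openin unit_space (rng G ` U)"
    using UK(1,4) \<open>rng G ` K \<subseteq> units G\<close> open_rng open_units_iff by blast
  moreover have "x \<in> rng G ` U" using x UK(3) rng_unit by force
  ultimately show "\<exists>U K. openin unit_space U \<and>
      compactin unit_space K \<and> x \<in> U \<and> U \<subseteq> K" by blast
qed

lemma open_bisection_neighbourhood:
  assumes "gopen W" "g \<in> W"
  obtains U where "gopen U" "bisection U" "g \<in> U" "U \<subseteq> W"
    "gopen (rng G ` U)"
    "homeomorphic_map (subtopology (gtop G) U) (subtopology (gtop G) (rng G ` U)) (rng G)"
proof -
  have gW: "g \<in> arrows G" using assms openin_subset by blast
  have loc: "\<exists>U. gopen U \<and> h \<in> U \<and>
     homeomorphic_map (subtopology (gtop G) U) (subtopology (gtop G) (rng G ` U)) (rng G)"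
    if h: "h \<in> arrows G" for h
  proof -
    obtain U where U: "gopen U" "h \<in> U"
      "homeomorphic_map (subtopology (gtop G) U)
       (subtopology unit_space (rng G ` U)) (rng G)"
      using local_homeo_rng h unfolding local_homeomorphism_def by blast
    moreover have "rng G ` U \<subseteq> units G" using U(1) openin_subset rng_units by blast
    ultimately show ?thesis by (auto simp: subtopology_subtopology Int_absorb1)
  qed
  obtain U where U: "gopen U" "g \<in> U"
    "homeomorphic_map (subtopology (gtop G) U) (subtopology (gtop G) (rng G ` U)) (rng G)"
    using loc gW by blast
  \<comment> \<open>A neighbourhood of the inverse arrow on which the range map is injective is
    turned by inversion into one of \<open>g\<close> on which the source map is injective.\<close>
  obtain V where V: "gopen V" "ginv G g \<in> V"
    "homeomorphic_map (subtopology (gtop G) V) (subtopology (gtop G) (rng G ` V)) (rng G)"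
    using loc[of "ginv G g"] gW ginv_closed by blast
  have sub: "U \<subseteq> arrows G" "V \<subseteq> arrows G" using U V openin_subset by blast+
  have injU: "inj_on (rng G) U"
    using homeomorphic_imp_injective_map[OF U(3)] sub by (simp add: Int_absorb1)
  have injV: "inj_on (rng G) V"
    using homeomorphic_imp_injective_map[OF V(3)] sub by (simp add: Int_absorb1)
  let ?B = "U \<inter> ginv G ` V \<inter> W"
  have B: "gopen ?B" using U V assms open_ginv by blast
  have gB: "g \<in> ?B" using U V assms gW ginv_ginv by (metis IntI imageI)
  have injs: "inj_on (src G) (ginv G ` V)"
  proof (rule inj_onI)
    fix a b assume "a \<in> ginv G ` V" "b \<in> ginv G ` V" "src G a = src G b"
    then obtain a' b' where "a = ginv G a'" "b = ginv G b'" "a' \<in> V" "b' \<in> V" by blast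
    then show "a = b" using \<open>src G a = src G b\<close> sub injV
      by (metis inj_onD src_ginv subsetD)
  qed
  have bis: "bisection ?B"
    unfolding bisection_def using sub injU injs by (auto intro: inj_on_subset)
  have op: "gopen (rng G ` ?B)" using B open_rng by blast
  have "homeomorphic_map (subtopology (subtopology (gtop G) U) ?B)
          (subtopology (subtopology (gtop G) (rng G ` U)) (rng G ` ?B)) (rng G)"
  proof (rule homeomorphic_map_subtopologies[OF U(3)])
    have "rng G ` U \<subseteq> arrows G" using sub rng_closed by blast
    then have "arrows G \<inter> U \<inter> ?B = ?B" "arrows G \<inter> rng G ` U \<inter> rng G ` ?B = rng G ` ?B"
      using sub by auto
    then show "rng G ` (topspace (subtopology (gtop G) U) \<inter> ?B)
        = topspace (subtopology (gtop G) (rng G ` U)) \<inter> rng G ` ?B"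
      by (simp only: topspace_subtopology)
  qed
  moreover have "subtopology (subtopology (gtop G) U) ?B = subtopology (gtop G) ?B"
    by (simp add: subtopology_subtopology Int_assoc[symmetric])
  moreover have "subtopology (subtopology (gtop G) (rng G ` U)) (rng G ` ?B) = subtopology (gtop G) (rng G ` ?B)"
  proof -
    have "rng G ` U \<inter> rng G ` ?B = rng G ` ?B" by auto
    then show ?thesis by (simp only: subtopology_subtopology)
  qed
  ultimately show ?thesis using that[of ?B] B gB bis op by auto
qed

end

context ample_groupoid
begin

text \<open>The unit space has a base of compact open sets; one inside the range of a small open
  bisection is pulled back along the range map, which is a homeomorphism there.\<close>

lemma compact_bisection_base:
  assumes "gopen W" "g \<in> W"
  obtains U where "compact_bisection U" "g \<in> U" "U \<subseteq> W"
proof -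
  obtain U where U: "gopen U" "bisection U" "g \<in> U" "U \<subseteq> W"
    "gopen (rng G ` U)"
    "homeomorphic_map (subtopology (gtop G) U) (subtopology (gtop G) (rng G ` U)) (rng G)"
    using open_bisection_neighbourhood assms by blast
  have sub: "U \<subseteq> arrows G" using U openin_subset by blast
  then have "rng G ` U \<subseteq> units G" using rng_units by blast
  then have "openin unit_space (rng G ` U)"
    using U(5) open_units_iff by blast
  then obtain K where K: "openin unit_space K"
    "compactin unit_space K" "rng G g \<in> K" "K \<subseteq> rng G ` U"
    using locally_compact_totally_disconnected_base[OF locally_compact_units Hausdorff_units
        totally_disconnected_units] U(3) by (metis imageI)
  let ?W = "U \<inter> {h \<in> arrows G. rng G h \<in> K}"
  have op: "gopen ?W" using K(1) open_units_iff U(1) open_rng_vimage by blast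
  have im: "rng G ` ?W = K" using K(4) sub by blast
  have "compactin (gtop G) K" using K(2) compactin_subtopology by blast
  then have "compactin (subtopology (gtop G) (rng G ` U)) (rng G ` ?W)"
    using K(4) im by (simp add: compactin_subtopology)
  then have "compactin (subtopology (gtop G) U) ?W"
    using homeomorphic_map_compactness[OF U(6), of ?W] sub by auto
  then have "compactin (gtop G) ?W" using compactin_subtopology by blast
  moreover have "bisection ?W" using U(2) bisection_subset by blast
  ultimately show ?thesis
    using that[of ?W] op U(3,4) K(3) sub by (auto simp: compact_bisection_iff)
qed

end

section \<open>Convolution\<close>

lemma zero_fun_eq: "0 = (\<lambda>x. 0)"
  by (auto simp: fun_eq_iff)

lemma diff_eq_add_fscale: "f - g = f + fscale (- 1) g"
  by (auto simp: fscale_def fun_eq_iff)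

lemma fscale_zero: "fscale c 0 = 0"
  by (auto simp: fscale_def fun_eq_iff)

context groupoid
begin

text \<open>For such a first factor the convolution is a finite sum at every arrow, whatever the
  second factor is. This admits square-summable vectors and functions of the range as second
  factors.\<close>

definition rfinite :: "('a \<Rightarrow> complex) \<Rightarrow> bool" where
  "rfinite f \<longleftrightarrow> (\<forall>x. finite {u \<in> arrows G. rng G u = x \<and> f u \<noteq> 0})"

lemma conv_outside: "g \<notin> arrows G \<Longrightarrow> conv f \<xi> g = 0"
proof -
  assume "g \<notin> arrows G"
  then have "{(g1, g2) \<in> composable G. g1 \<cdot> g2 = g} = {}" using mul_closed by auto
  then show ?thesis unfolding convolution_def by (simp only: infsum_empty)
qed

lemma conv_eq_infsum:
  assumes g: "g \<in> arrows G"
  shows "conv f \<xi> g =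
    (\<Sum>\<^sub>\<infinity>u\<in>{u \<in> arrows G. rng G u = rng G g}. f u * \<xi> (ginv G u \<cdot> g))"
proof -
  let ?A = "{u \<in> arrows G. rng G u = rng G g}"
  let ?B = "{(g1, g2) \<in> composable G. g1 \<cdot> g2 = g}"
  have "bij_betw (\<lambda>u. (u, ginv G u \<cdot> g)) ?A ?B"
  proof (rule bij_betwI[where g = fst], goal_cases)
    case 1
    then show ?case using g by (auto simp: composable_def ginv_closed src_ginv rng_ginv inv_mul_cancel)
  next
    case 2
    then show ?case by (auto simp: composable_def)
  next
    case (4 p)
    then show ?case by (auto simp: composable_def inv_mul_cancel)
  qed auto
  from infsum_reindex_bij_betw[OF this, of "\<lambda>(g1, g2). f g1 * \<xi> g2"]
  show ?thesis by (simp add: convolution_def)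
qed

lemma conv_eq_sum:
  assumes "g \<in> arrows G" "finite T" "T \<subseteq> {u \<in> arrows G. rng G u = rng G g}"
    and "\<And>u. u \<in> arrows G \<Longrightarrow> rng G u = rng G g \<Longrightarrow> f u \<noteq> 0 \<Longrightarrow> u \<in> T"
  shows "conv f \<xi> g = (\<Sum>u\<in>T. f u * \<xi> (ginv G u \<cdot> g))"
proof -
  have "conv f \<xi> g = (\<Sum>\<^sub>\<infinity>u\<in>T. f u * \<xi> (ginv G u \<cdot> g))"
    unfolding conv_eq_infsum[OF assms(1)]
    by (rule infsum_cong_neutral) (use assms in auto)
  then show ?thesis using assms(2) by simp
qed

lemma conv_rfinite:
  assumes "rfinite f" "g \<in> arrows G"
  shows "conv f \<xi> g =
    (\<Sum>u\<in>{u \<in> arrows G. rng G u = rng G g \<and> f u \<noteq> 0}. f u * \<xi> (ginv G u \<cdot> g))"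
  by (rule conv_eq_sum) (use assms in \<open>auto simp: rfinite_def\<close>)

lemma rfinite_add:
  assumes "rfinite f" "rfinite h"
  shows "rfinite (f + h)"
  unfolding rfinite_def
proof
  fix x
  have "{u \<in> arrows G. rng G u = x \<and> (f + h) u \<noteq> 0}
    \<subseteq> {u \<in> arrows G. rng G u = x \<and> f u \<noteq> 0} \<union> {u \<in> arrows G. rng G u = x \<and> h u \<noteq> 0}"
    by auto
  then show "finite {u \<in> arrows G. rng G u = x \<and> (f + h) u \<noteq> 0}"
    using assms unfolding rfinite_def by (meson finite_UnI finite_subset)
qed

lemma rfinite_scale: "rfinite f \<Longrightarrow> rfinite (fscale c f)"
  unfolding rfinite_def fscale_def
  by (intro allI, erule allE, erule rev_finite_subset) auto

lemma rfinite_zero: "rfinite 0"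
  by (simp add: rfinite_def)

lemma conv_add_left:
  assumes f: "rfinite f" and h: "rfinite h"
  shows "conv (f + h) \<xi> = conv f \<xi> + conv h \<xi>"
proof
  fix g
  show "conv (f + h) \<xi> g = (conv f \<xi> + conv h \<xi>) g"
  proof (cases "g \<in> arrows G")
    case True
    let ?T = "{u \<in> arrows G. rng G u = rng G g \<and> f u \<noteq> 0} \<union>
              {u \<in> arrows G. rng G u = rng G g \<and> h u \<noteq> 0}"
    have T: "finite ?T" "?T \<subseteq> {u \<in> arrows G. rng G u = rng G g}"
      using f h by (auto simp: rfinite_def)
    have "conv (f + h) \<xi> g = (\<Sum>u\<in>?T. (f + h) u * \<xi> (ginv G u \<cdot> g))"
      "conv f \<xi> g = (\<Sum>u\<in>?T. f u * \<xi> (ginv G u \<cdot> g))"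
      "conv h \<xi> g = (\<Sum>u\<in>?T. h u * \<xi> (ginv G u \<cdot> g))"
      by (rule conv_eq_sum[OF True T]; auto)+
    then show ?thesis by (simp add: sum.distrib[symmetric] algebra_simps)
  qed (simp add: conv_outside)
qed

lemma conv_add_right:
  assumes f: "rfinite f"
  shows "conv f (\<xi> + \<eta>) = conv f \<xi> + conv f \<eta>"
proof
  fix g
  show "conv f (\<xi> + \<eta>) g = (conv f \<xi> + conv f \<eta>) g"
    by (cases "g \<in> arrows G")
      (simp_all add: conv_rfinite[OF f] conv_outside sum.distrib[symmetric] algebra_simps)
qed

lemma conv_scale_left:
  assumes f: "rfinite f"
  shows "conv (fscale c f) \<xi> = fscale c (conv f \<xi>)"
proof
  fix g
  show "conv (fscale c f) \<xi> g = fscale c (conv f \<xi>) g"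
  proof (cases "g \<in> arrows G")
    case True
    have "conv (fscale c f) \<xi> g =
       (\<Sum>u\<in>{u \<in> arrows G. rng G u = rng G g \<and> f u \<noteq> 0}. fscale c f u * \<xi> (ginv G u \<cdot> g))"
      by (rule conv_eq_sum[OF True]) (use f in \<open>auto simp: rfinite_def fscale_def\<close>)
    then show ?thesis
      by (simp add: conv_rfinite[OF f True] fscale_def sum_distrib_left mult.assoc)
  qed (simp add: conv_outside fscale_def)
qed

lemma conv_scale_right:
  assumes f: "rfinite f"
  shows "conv f (fscale c \<xi>) = fscale c (conv f \<xi>)"
proof
  fix g
  show "conv f (fscale c \<xi>) g = fscale c (conv f \<xi>) g"
    by (cases "g \<in> arrows G")
      (simp_all add: conv_rfinite[OF f] conv_outside fscale_def sum_distrib_left algebra_simps)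
qed

lemma conv_zero_left: "conv 0 \<xi> = 0"
  and conv_zero_right: "conv f 0 = 0"
  by (auto simp: convolution_def fun_eq_iff case_prod_unfold)

lemma conv_diff_left:
  assumes "rfinite f" "rfinite h"
  shows "conv (f - h) \<xi> = conv f \<xi> - conv h \<xi>"
  by (simp only: diff_eq_add_fscale conv_add_left conv_scale_left rfinite_scale assms)

lemma conv_diff_right:
  assumes "rfinite f"
  shows "conv f (\<xi> - \<eta>) = conv f \<xi> - conv f \<eta>"
  by (simp only: diff_eq_add_fscale conv_add_right conv_scale_right assms)

lemma rfinite_conv:
  assumes "rfinite f" "rfinite h"
  shows "rfinite (conv f h)"
  unfolding rfinite_def
proof
  fix x
  let ?A = "{u \<in> arrows G. rng G u = x \<and> f u \<noteq> 0}"
  let ?B = "\<lambda>u. {v \<in> arrows G. rng G v = src G u \<and> h v \<noteq> 0}"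
  have "{w \<in> arrows G. rng G w = x \<and> conv f h w \<noteq> 0} \<subseteq> (\<lambda>(u, v). u \<cdot> v) ` Sigma ?A ?B"
  proof
    fix w assume w: "w \<in> {w \<in> arrows G. rng G w = x \<and> conv f h w \<noteq> 0}"
    then have "(\<Sum>u\<in>?A. f u * h (ginv G u \<cdot> w)) \<noteq> 0"
      using conv_rfinite[OF assms(1), of w h] by simp
    then obtain u where u: "u \<in> ?A" "h (ginv G u \<cdot> w) \<noteq> 0"
      using sum.not_neutral_contains_not_neutral by force
    then have "ginv G u \<cdot> w \<in> ?B u" "u \<cdot> (ginv G u \<cdot> w) = w"
      using w by (auto simp: ginv_closed src_ginv rng_ginv inv_mul_cancel)
    then show "w \<in> (\<lambda>(u, v). u \<cdot> v) ` Sigma ?A ?B"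
      using u(1) by (intro image_eqI[of _ _ "(u, ginv G u \<cdot> w)"]) auto
  qed
  moreover have "finite (Sigma ?A ?B)"
    using assms by (auto simp: rfinite_def)
  ultimately show "finite {w \<in> arrows G. rng G w = x \<and> conv f h w \<noteq> 0}"
    by (meson finite_imageI finite_subset)
qed

text \<open>Left translation by \<open>ginv G u\<close> does not change the quotient of two arrows;
  this carries the change of the summation variable in the proof of associativity.\<close>

lemma inv_mul_inv_mul:
  assumes "u \<in> arrows G" "w \<in> arrows G" "g \<in> arrows G" "rng G u = rng G g" "rng G w = rng G g"
  shows "ginv G (ginv G u \<cdot> w) \<cdot> (ginv G u \<cdot> g) = ginv G w \<cdot> g"
proof -
  let ?k = "ginv G w \<cdot> g"
  have k: "?k \<in> arrows G" "rng G ?k = src G w" "w \<cdot> ?k = g"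
    using assms by (auto simp: ginv_closed src_ginv rng_ginv inv_mul_cancel)
  have uw: "ginv G u \<cdot> w \<in> arrows G" "src G (ginv G u \<cdot> w) = src G w"
    using assms by (auto simp: ginv_closed src_ginv rng_ginv)
  have "ginv G u \<cdot> g = ginv G u \<cdot> (w \<cdot> ?k)" by (simp only: k(3))
  also have "\<dots> = (ginv G u \<cdot> w) \<cdot> ?k"
    using mul_assoc'[of "ginv G u" w ?k] assms k(1,2) by (simp add: ginv_closed src_ginv rng_ginv)
  finally have "ginv G u \<cdot> g = (ginv G u \<cdot> w) \<cdot> ?k" .
  then show ?thesis using inv_mul_cancel(1)[OF uw(1) k(1)] uw(2) k(2) by simp
qed

text \<open>Both sides are double sums over the first factor \<open>u\<close> and the product
  \<open>w\<close> of the first two factors, the second factor being recovered as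
  \<open>ginv G u \<cdot> w\<close>. As the last argument is an arbitrary function, this covers
  associativity of the algebra and multiplicativity of its action on square-summable
  vectors.\<close>

lemma conv_assoc:
  assumes f: "rfinite f" and h: "rfinite h"
  shows "conv (conv f h) \<xi> = conv f (conv h \<xi>)"
proof
  fix g
  show "conv (conv f h) \<xi> g = conv f (conv h \<xi>) g"
  proof (cases "g \<in> arrows G")
    case True
    let ?A = "{u \<in> arrows G. rng G u = rng G g \<and> f u \<noteq> 0}"
    let ?B = "\<lambda>u. {v \<in> arrows G. rng G v = src G u \<and> h v \<noteq> 0}"
    let ?S = "{w \<in> arrows G. rng G w = rng G g \<and> conv f h w \<noteq> 0}"
    \<comment> \<open>One finite index set for all sums: it holds every \<open>w\<close> where
      \<open>conv f h\<close> is nonzero and every product of supporting arrows, so translating it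
      back by any \<open>u\<close> covers the relevant support of \<open>h\<close>.\<close>
    define T where "T = ?S \<union> (\<lambda>(u, v). u \<cdot> v) ` Sigma ?A ?B"
    have finA: "finite ?A" using f by (simp add: rfinite_def)
    have "finite ?S" using rfinite_conv[OF f h] by (simp add: rfinite_def)
    moreover have "finite (Sigma ?A ?B)" using f h by (auto simp: rfinite_def)
    ultimately have finT: "finite T" by (simp add: T_def)
    have subT: "T \<subseteq> {w \<in> arrows G. rng G w = rng G g}" by (auto simp: T_def)
    have 1: "conv (conv f h) \<xi> g
        = (\<Sum>w\<in>T. conv f h w * \<xi> (ginv G w \<cdot> g))"
      by (rule conv_eq_sum[OF True finT subT]) (auto simp: T_def)
    have 2: "conv f h w = (\<Sum>u\<in>?A. f u * h (ginv G u \<cdot> w))" if "w \<in> T" for w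
      using conv_rfinite[OF f, of w h] subT that by auto
    have 3: "conv h \<xi> (ginv G u \<cdot> g) = (\<Sum>w\<in>T. h (ginv G u \<cdot> w) * \<xi> (ginv G w \<cdot> g))"
      if u: "u \<in> ?A" for u
    proof -
      let ?T = "(\<lambda>w. ginv G u \<cdot> w) ` T"
      have inj: "inj_on (\<lambda>w. ginv G u \<cdot> w) T"
      proof (rule inj_onI)
        fix w w' assume "w \<in> T" "w' \<in> T" and e: "ginv G u \<cdot> w = ginv G u \<cdot> w'"
        then have w: "w \<in> arrows G" "rng G u = rng G w" "w' \<in> arrows G" "rng G u = rng G w'"
          using subT u by auto
        have "w = u \<cdot> (ginv G u \<cdot> w)" using inv_mul_cancel(2)[OF _ w(1)] w(2) u by simp
        also have "\<dots> = u \<cdot> (ginv G u \<cdot> w')" by (simp only: e)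
        also have "\<dots> = w'" using inv_mul_cancel(2)[OF _ w(3)] w(4) u by simp
        finally show "w = w'" .
      qed
      have "conv h \<xi> (ginv G u \<cdot> g) = (\<Sum>v\<in>?T. h v * \<xi> (ginv G v \<cdot> (ginv G u \<cdot> g)))"
      proof (rule conv_eq_sum)
        show "ginv G u \<cdot> g \<in> arrows G" using u True by (simp add: ginv_closed src_ginv)
        show "finite ?T" using finT by simp
        show "?T \<subseteq> {v \<in> arrows G. rng G v = rng G (ginv G u \<cdot> g)}"
          using subT u True by (auto simp: ginv_closed src_ginv rng_ginv)
        fix v assume v: "v \<in> arrows G" "rng G v = rng G (ginv G u \<cdot> g)" "h v \<noteq> 0"
        then have "rng G v = src G u" using u True by (simp add: ginv_closed src_ginv rng_ginv)
        then have "(u, v) \<in> Sigma ?A ?B" "v = ginv G u \<cdot> (u \<cdot> v)"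
          using u v by (auto simp: inv_mul_cancel)
        then show "v \<in> ?T" unfolding T_def by (metis (no_types, lifting) UnI2 case_prod_conv imageI)
      qed
      also have "\<dots> = (\<Sum>w\<in>T. h (ginv G u \<cdot> w) * \<xi> (ginv G (ginv G u \<cdot> w) \<cdot> (ginv G u \<cdot> g)))"
        using inj by (simp add: sum.reindex)
      also have "\<dots> = (\<Sum>w\<in>T. h (ginv G u \<cdot> w) * \<xi> (ginv G w \<cdot> g))"
        by (rule sum.cong) (use inv_mul_inv_mul u True subT in auto)
      finally show ?thesis .
    qed
    have "conv (conv f h) \<xi> g
        = (\<Sum>w\<in>T. \<Sum>u\<in>?A. f u * h (ginv G u \<cdot> w) * \<xi> (ginv G w \<cdot> g))"
      unfolding 1 by (rule sum.cong) (simp_all add: 2 sum_distrib_right)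
    also have "\<dots> = (\<Sum>u\<in>?A. \<Sum>w\<in>T. f u * h (ginv G u \<cdot> w) * \<xi> (ginv G w \<cdot> g))"
      by (rule sum.swap)
    also have "\<dots> = (\<Sum>u\<in>?A. f u * conv h \<xi> (ginv G u \<cdot> g))"
      by (rule sum.cong) (simp_all add: 3 sum_distrib_left mult.assoc)
    also have "\<dots> = conv f (conv h \<xi>) g"
      by (simp add: conv_rfinite[OF f True])
    finally show ?thesis .
  qed (simp add: conv_outside)
qed

lemma rfinite_bisection:
  assumes "bisection U" "\<And>u. u \<notin> U \<Longrightarrow> f u = 0"
  shows "rfinite f"
  unfolding rfinite_def
proof
  fix x
  show "finite {u \<in> arrows G. rng G u = x \<and> f u \<noteq> 0}"
  proof (cases "\<exists>u\<in>U. rng G u = x")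
    case True
    then obtain u where u: "u \<in> U" "rng G u = x" by blast
    have "{u \<in> arrows G. rng G u = x \<and> f u \<noteq> 0} \<subseteq> {u}"
      using u assms(2) bisectionD(2)[OF assms(1)] by blast
    then show ?thesis using finite_subset by blast
  next
    case False
    then have "{u \<in> arrows G. rng G u = x \<and> f u \<noteq> 0} = {}" using assms(2) by blast
    then show ?thesis by (simp only: finite.emptyI)
  qed
qed

lemma conv_bisection:
  assumes "bisection U" "\<And>u. u \<notin> U \<Longrightarrow> f u = 0" "u \<in> U" "g \<in> arrows G" "rng G u = rng G g"
  shows "conv f \<xi> g = f u * \<xi> (ginv G u \<cdot> g)"
proof -
  have "conv f \<xi> g = (\<Sum>u\<in>{u}. f u * \<xi> (ginv G u \<cdot> g))"
  proof (rule conv_eq_sum)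
    show "{u} \<subseteq> {u \<in> arrows G. rng G u = rng G g}" using assms bisectionD(1) by auto
    show "v \<in> {u}" if "rng G v = rng G g" "f v \<noteq> 0" for v
      using assms bisectionD(2)[OF assms(1)] that by (metis singletonI)
  qed (use assms in auto)
  then show ?thesis by simp
qed

lemma conv_bisection_eq_0:
  assumes "\<And>u. u \<notin> U \<Longrightarrow> f u = 0" "\<And>u. u \<in> U \<Longrightarrow> rng G u \<noteq> rng G g"
  shows "conv f \<xi> g = 0"
proof (cases "g \<in> arrows G")
  case True
  have "conv f \<xi> g = (\<Sum>u\<in>{}. f u * \<xi> (ginv G u \<cdot> g))"
    by (rule conv_eq_sum[OF True]) (use assms in auto)
  then show ?thesis by simp
qed (simp add: conv_outside)

text \<open>In a factorisation of \<open>g\<close> whose second factor lies in \<open>V\<close>,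
  that factor has the source of \<open>g\<close> and so equals \<open>v\<close>; the first factor is
  then forced.\<close>

lemma conv_const_on_right:
  assumes f: "rfinite f" and V: "bisection V" and v: "v \<in> V" "src G v = src G g" and g: "g \<in> arrows G"
  shows "conv f (const_on c V) g = c * f (g \<cdot> ginv G v)"
proof -
  have va: "v \<in> arrows G" using V v bisectionD(1) by blast
  let ?w = "g \<cdot> ginv G v"
  let ?T = "insert ?w {u \<in> arrows G. rng G u = rng G g \<and> f u \<noteq> 0}"
  have w: "?w \<in> arrows G" "rng G ?w = rng G g" "src G ?w = rng G v"
    using va v g by (auto simp: ginv_closed rng_ginv src_ginv)
  have fin: "finite ?T" using f by (simp add: rfinite_def)
  have "conv f (const_on c V) g = (\<Sum>u\<in>?T. f u * const_on c V (ginv G u \<cdot> g))"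
    by (rule conv_eq_sum[OF g fin]) (use w in auto)
  also have "\<dots> = f ?w * const_on c V (ginv G ?w \<cdot> g) + (\<Sum>u\<in>?T - {?w}. f u * const_on c V (ginv G u \<cdot> g))"
    using fin by (subst sum.remove[of _ ?w]) auto
  also have "ginv G ?w \<cdot> g = v"
  proof -
    have "?w \<cdot> v = g" using mul_inv_cancel(2)[OF va g] v by simp
    then show ?thesis using inv_mul_cancel(1)[OF w(1) va w(3)] by simp
  qed
  also have "(\<Sum>u\<in>?T - {?w}. f u * const_on c V (ginv G u \<cdot> g)) = 0"
  proof (rule sum.neutral, rule ballI)
    fix u assume u: "u \<in> ?T - {?w}"
    then have ua: "u \<in> arrows G" "rng G u = rng G g" using w by auto
    have "ginv G u \<cdot> g \<notin> V"
    proof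
      assume "ginv G u \<cdot> g \<in> V"
      moreover have "src G (ginv G u \<cdot> g) = src G v" using ua g v by (simp add: ginv_closed src_ginv)
      ultimately have "ginv G u \<cdot> g = v" using bisectionD(3)[OF V] v by blast
      then have "u \<cdot> v = g" "src G u = rng G v"
        using inv_mul_cancel(2)[OF ua(1) g] ua g by (auto simp: ginv_closed src_ginv rng_ginv)
      then have "u = ?w" using mul_inv_cancel(1)[OF va ua(1)] by simp
      then show False using u by blast
    qed
    then show "f u * const_on c V (ginv G u \<cdot> g) = 0" by (simp add: const_on_def)
  qed
  finally show ?thesis using v by (simp add: const_on_def)
qed

lemma conv_const_on_right_eq_0:
  assumes f: "rfinite f" and "\<And>v. v \<in> V \<Longrightarrow> src G v \<noteq> src G g"
  shows "conv f (const_on c V) g = 0"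
proof (cases "g \<in> arrows G")
  case True
  have "const_on c V (ginv G u \<cdot> g) = 0" if "u \<in> arrows G" "rng G u = rng G g" for u
    using assms(2)[of "ginv G u \<cdot> g"] that True by (auto simp: const_on_def ginv_closed src_ginv)
  then show ?thesis by (simp add: conv_rfinite[OF f True])
qed (simp add: conv_outside)

lemma conv_const_on_units_left:
  assumes "V \<subseteq> units G" "g \<in> arrows G"
  shows "conv (const_on c V) f g = (if rng G g \<in> V then c * f g else 0)"
proof (cases "rng G g \<in> V")
  case True
  then have "conv (const_on c V) f g = const_on c V (rng G g) * f (ginv G (rng G g) \<cdot> g)"
    using assms by (intro conv_bisection[OF bisection_units[OF assms(1)]])
      (auto simp: const_on_def rng_rng)
  then show ?thesis using True assms by (simp add: const_on_def ginv_unit rng_mul_left rng_units)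
next
  case False
  have "conv (const_on c V) f g = 0"
    by (rule conv_bisection_eq_0[of V]) (use False assms rng_unit in \<open>auto simp: const_on_def\<close>)
  then show ?thesis using False by simp
qed

lemma conv_const_on_units_right:
  assumes "rfinite f" "V \<subseteq> units G" "g \<in> arrows G"
  shows "conv f (const_on c V) g = (if src G g \<in> V then c * f g else 0)"
proof (cases "src G g \<in> V")
  case True
  then show ?thesis
    using conv_const_on_right[OF assms(1) bisection_units[OF assms(2)] True _ assms(3)] assms
    by (simp add: src_src ginv_unit src_units mul_src)
next
  case False
  have "conv f (const_on c V) g = 0"
    by (rule conv_const_on_right_eq_0[OF assms(1)]) (use False assms src_unit in auto)
  then show ?thesis using False by simp
qed

lemma conv_const_on_const_on:
  assumes U: "bisection U" and V: "bisection V"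
  shows "conv (const_on c U) (const_on d V) = const_on (c * d) (set_mul U V)"
proof
  fix g
  have r: "rfinite (const_on c U)" by (rule rfinite_bisection[OF U]) (simp add: const_on_def)
  show "conv (const_on c U) (const_on d V) g = const_on (c * d) (set_mul U V) g"
  proof (cases "g \<in> arrows G \<and> (\<exists>v\<in>V. src G v = src G g)")
    case True
    then obtain v where v: "v \<in> V" "src G v = src G g" and g: "g \<in> arrows G" by blast
    have va: "v \<in> arrows G" using V v bisectionD(1) by blast
    have "g \<cdot> ginv G v \<in> U \<longleftrightarrow> g \<in> set_mul U V"
    proof
      assume "g \<cdot> ginv G v \<in> U"
      moreover have "g = (g \<cdot> ginv G v) \<cdot> v" "src G (g \<cdot> ginv G v) = rng G v"
        using va v g by (auto simp: mul_inv_cancel ginv_closed rng_ginv src_ginv)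
      ultimately show "g \<in> set_mul U V" using v(1) unfolding set_mul_def by blast
    next
      assume "g \<in> set_mul U V"
      then obtain u v' where uv: "u \<in> U" "v' \<in> V" "src G u = rng G v'" "g = u \<cdot> v'"
        unfolding set_mul_def by blast
      have a: "u \<in> arrows G" "v' \<in> arrows G" using uv U V bisectionD(1) by blast+
      have "src G v' = src G v" using uv a v by simp
      then have "v' = v" using bisectionD(3)[OF V] uv v by blast
      then have "g \<cdot> ginv G v = u" using mul_inv_cancel(1)[OF va a(1)] uv by simp
      then show "g \<cdot> ginv G v \<in> U" using uv by simp
    qed
    then show ?thesis using conv_const_on_right[OF r V v g] by (simp add: const_on_def)
  next
    case False
    then have "conv (const_on c U) (const_on d V) g = 0"
      using conv_outside conv_const_on_right_eq_0[OF r] by metis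
    moreover have "g \<notin> set_mul U V"
      using False bisection_set_mul[OF U V] bisectionD(1) U V unfolding set_mul_def by fastforce
    ultimately show ?thesis by (simp add: const_on_def)
  qed
qed

end

section \<open>The reduced norm\<close>

lemma sum_fun_apply: "(\<Sum>h\<in>F. f h) k = (\<Sum>h\<in>F. f h k)"
  by (induction F rule: infinite_finite_induct) auto

text \<open>All estimates are made over finite sets, where the inequalities for
  \<open>L2_set\<close> apply; summability and the bound on the norm then come out together.\<close>

lemma ell2_boundI:
  assumes "\<And>g. g \<notin> S \<Longrightarrow> \<xi> g = 0"
    and bd: "\<And>F. finite F \<Longrightarrow> F \<subseteq> S \<Longrightarrow> L2_set (\<lambda>g. cmod (\<xi> g)) F \<le> C"
  shows "\<xi> \<in> ell2 S" "ell2_norm S \<xi> \<le> C"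
proof -
  have C: "C \<ge> 0" using bd[of "{}"] by simp
  have le: "(\<Sum>g\<in>F. (cmod (\<xi> g))\<^sup>2) \<le> C\<^sup>2" if "finite F" "F \<subseteq> S" for F
    using bd[OF that] C unfolding L2_set_def by (simp add: sqrt_le_D)
  have s: "(\<lambda>g. (cmod (\<xi> g))\<^sup>2) summable_on S"
    by (rule nonneg_bdd_above_summable_on) (use le in \<open>auto intro!: bdd_aboveI[of _ "C\<^sup>2"]\<close>)
  then show "\<xi> \<in> ell2 S" using assms(1) by (simp add: ell2_def)
  have "(\<Sum>\<^sub>\<infinity>g\<in>S. (cmod (\<xi> g))\<^sup>2) \<le> C\<^sup>2"
    by (rule infsum_le_finite_sums[OF s le])
  then show "ell2_norm S \<xi> \<le> C" unfolding ell2_norm_def using C by (simp add: real_le_lsqrt)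
qed

lemma ell2_outside: "\<xi> \<in> ell2 S \<Longrightarrow> g \<notin> S \<Longrightarrow> \<xi> g = 0"
  by (simp add: ell2_def)

lemma L2_set_le_ell2_norm:
  assumes "\<xi> \<in> ell2 S" "finite F" "F \<subseteq> S"
  shows "L2_set (\<lambda>g. cmod (\<xi> g)) F \<le> ell2_norm S \<xi>"
  unfolding L2_set_def ell2_norm_def
  by (intro real_sqrt_le_mono finite_sum_le_infsum) (use assms in \<open>auto simp: ell2_def\<close>)

lemma ell2_norm_nonneg: "ell2_norm S \<xi> \<ge> 0"
  by (simp add: ell2_norm_def infsum_nonneg)

lemma norm_le_ell2_norm:
  assumes "\<xi> \<in> ell2 S"
  shows "cmod (\<xi> g) \<le> ell2_norm S \<xi>"
proof (cases "g \<in> S")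
  case True
  then show ?thesis using L2_set_le_ell2_norm[OF assms, of "{g}"] by simp
qed (simp add: ell2_outside[OF assms] ell2_norm_nonneg)

lemma ell2_add:
  assumes "\<xi> \<in> ell2 S" "\<eta> \<in> ell2 S"
  shows "\<xi> + \<eta> \<in> ell2 S" "ell2_norm S (\<xi> + \<eta>) \<le> ell2_norm S \<xi> + ell2_norm S \<eta>"
proof -
  have "L2_set (\<lambda>g. cmod ((\<xi> + \<eta>) g)) F \<le> ell2_norm S \<xi> + ell2_norm S \<eta>"
    if F: "finite F" "F \<subseteq> S" for F
  proof -
    have "L2_set (\<lambda>g. cmod ((\<xi> + \<eta>) g)) F \<le> L2_set (\<lambda>g. cmod (\<xi> g) + cmod (\<eta> g)) F"
      by (rule L2_set_mono) (auto simp: norm_triangle_ineq)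
    also have "\<dots> \<le> L2_set (\<lambda>g. cmod (\<xi> g)) F + L2_set (\<lambda>g. cmod (\<eta> g)) F"
      by (rule L2_set_triangle_ineq)
    also have "\<dots> \<le> ell2_norm S \<xi> + ell2_norm S \<eta>"
      using L2_set_le_ell2_norm assms F by (intro add_mono) auto
    finally show ?thesis .
  qed
  from ell2_boundI[of S "\<xi> + \<eta>", OF _ this]
  show "\<xi> + \<eta> \<in> ell2 S" "ell2_norm S (\<xi> + \<eta>) \<le> ell2_norm S \<xi> + ell2_norm S \<eta>"
    using assms[THEN ell2_outside] by auto
qed

lemma ell2_scale:
  assumes "\<xi> \<in> ell2 S"
  shows "fscale c \<xi> \<in> ell2 S" "ell2_norm S (fscale c \<xi>) \<le> cmod c * ell2_norm S \<xi>"
proof -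
  have "L2_set (\<lambda>g. cmod (fscale c \<xi> g)) F \<le> cmod c * ell2_norm S \<xi>" if F: "finite F" "F \<subseteq> S" for F
    using L2_set_le_ell2_norm[OF assms F]
    by (simp add: fscale_def norm_mult flip: L2_set_right_distrib) (simp add: mult_left_mono)
  from ell2_boundI[of S "fscale c \<xi>", OF _ this]
  show "fscale c \<xi> \<in> ell2 S" "ell2_norm S (fscale c \<xi>) \<le> cmod c * ell2_norm S \<xi>"
    using ell2_outside[OF assms] by (auto simp: fscale_def)
qed

lemma ell2_delta:
  "const_on 1 {x} \<in> ell2 S" "ell2_norm S (const_on 1 {x}) \<le> 1" if "x \<in> S"
proof -
  have "L2_set (\<lambda>g. cmod (const_on 1 {x} g)) F \<le> 1" if F: "finite F" "F \<subseteq> S" for F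
  proof -
    have "(\<Sum>g\<in>F. (cmod (const_on 1 {x} g))\<^sup>2) = (\<Sum>g\<in>F. if g = x then 1 else 0)"
      by (rule sum.cong) (auto simp: const_on_def)
    also have "\<dots> \<le> 1" using F by (simp add: sum.delta)
    finally show ?thesis by (simp add: L2_set_def)
  qed
  moreover have "const_on 1 {x} g = 0" if "g \<notin> S" for g
    using that \<open>x \<in> S\<close> by (auto simp: const_on_def)
  ultimately show "const_on 1 {x} \<in> ell2 S" "ell2_norm S (const_on 1 {x}) \<le> 1"
    using ell2_boundI[of S "const_on 1 {x}"] by blast+
qed

lemma ell2_zero: "0 \<in> ell2 S" "ell2_norm S 0 = 0"
  by (auto simp: ell2_def ell2_norm_def)

lemma ell2_diff:
  assumes "\<xi> \<in> ell2 S" "\<eta> \<in> ell2 S"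
  shows "\<xi> - \<eta> \<in> ell2 S"
  unfolding diff_eq_add_fscale by (intro ell2_add ell2_scale assms)

lemma ell2_truncate:
  assumes \<xi>: "\<xi> \<in> ell2 S" and e: "e > 0"
  obtains F where "finite F" "F \<subseteq> S" "ell2_norm S (\<xi> - (\<lambda>g. if g \<in> F then \<xi> g else 0)) \<le> e"
proof -
  let ?q = "\<lambda>g. (cmod (\<xi> g))\<^sup>2"
  have s: "?q summable_on S" using \<xi> by (simp add: ell2_def)
  obtain F where F: "finite F" "F \<subseteq> S" "dist (sum ?q F) (infsum ?q S) \<le> e\<^sup>2"
    using infsum_finite_approximation[OF s, of "e\<^sup>2"] e by auto
  let ?\<eta> = "\<xi> - (\<lambda>g. if g \<in> F then \<xi> g else 0)"
  have "ell2_norm S ?\<eta> \<le> e"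
  proof (rule ell2_boundI(2))
    fix H assume H: "finite H" "H \<subseteq> S"
    have "(\<Sum>g\<in>H. (cmod (?\<eta> g))\<^sup>2) = sum ?q (H - F)"
      by (rule sum.mono_neutral_cong_right) (use H in auto)
    also have "\<dots> = sum ?q (F \<union> (H - F)) - sum ?q F"
      by (subst sum.union_disjoint) (use F H in auto)
    also have "\<dots> \<le> infsum ?q S - sum ?q F"
      using finite_sum_le_infsum[OF s, of "F \<union> (H - F)"] F H by auto
    also have "\<dots> \<le> e\<^sup>2" using F(3) by (simp add: dist_real_def)
    finally show "L2_set (\<lambda>g. cmod (?\<eta> g)) H \<le> e"
      unfolding L2_set_def using e by (simp add: real_le_lsqrt)
  qed (use ell2_outside[OF \<xi>] in auto)
  then show ?thesis using that F by blast
qed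

section \<open>Boundedness of the convolution operators\<close>

context groupoid
begin

text \<open>The reduced norm is a supremum of real numbers and carries no information unless these
  are bounded. A bound common to all units is therefore a predicate of its own; when one exists and
  there are units, the reduced norm is the least of them.\<close>

definition opbound :: "('a \<Rightarrow> complex) \<Rightarrow> real \<Rightarrow> bool" where
  "opbound f C \<longleftrightarrow> C \<ge> 0 \<and> (\<forall>x\<in>units G. \<forall>\<xi>\<in>ell2 (src_fibre G x).
     conv f \<xi> \<in> ell2 (src_fibre G x) \<and>
     ell2_norm (src_fibre G x) (conv f \<xi>) \<le> C * ell2_norm (src_fibre G x) \<xi>)"

lemma opboundD:
  assumes "opbound f C"
  shows "C \<ge> 0"
    and "x \<in> units G \<Longrightarrow> \<xi> \<in> ell2 (src_fibre G x) \<Longrightarrow> conv f \<xi> \<in> ell2 (src_fibre G x)"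
    and "x \<in> units G \<Longrightarrow> \<xi> \<in> ell2 (src_fibre G x) \<Longrightarrow>
      ell2_norm (src_fibre G x) (conv f \<xi>) \<le> C * ell2_norm (src_fibre G x) \<xi>"
  using assms by (auto simp: opbound_def)

definition bounded_fun :: "('a \<Rightarrow> complex) \<Rightarrow> bool" where
  "bounded_fun f \<longleftrightarrow> rfinite f \<and> (\<exists>C. opbound f C)"

lemma opbound_add:
  assumes "rfinite f" "rfinite h" "opbound f C" "opbound h D"
  shows "opbound (f + h) (C + D)"
  unfolding opbound_def conv_add_left[OF assms(1,2)]
proof (intro conjI ballI)
  show "C + D \<ge> 0" using assms opboundD(1) by fastforce
  fix x \<xi> assume x: "x \<in> units G" "\<xi> \<in> ell2 (src_fibre G x)"
  let ?S = "src_fibre G x"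
  have 1: "conv f \<xi> \<in> ell2 ?S" "conv h \<xi> \<in> ell2 ?S"
    using opboundD(2)[OF _ x] assms by auto
  show "conv f \<xi> + conv h \<xi> \<in> ell2 ?S" using ell2_add 1 by blast
  have "ell2_norm ?S (conv f \<xi> + conv h \<xi>)
     \<le> ell2_norm ?S (conv f \<xi>) + ell2_norm ?S (conv h \<xi>)"
    using ell2_add 1 by blast
  also have "\<dots> \<le> C * ell2_norm ?S \<xi> + D * ell2_norm ?S \<xi>"
    using opboundD(3)[OF _ x] assms by (intro add_mono) auto
  finally show "ell2_norm ?S (conv f \<xi> + conv h \<xi>) \<le> (C + D) * ell2_norm ?S \<xi>"
    by (simp add: algebra_simps)
qed

lemma opbound_scale:
  assumes "rfinite f" "opbound f C"
  shows "opbound (fscale c f) (cmod c * C)"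
  unfolding opbound_def conv_scale_left[OF assms(1)]
proof (intro conjI ballI)
  show "cmod c * C \<ge> 0" using assms opboundD(1) by fastforce
  fix x \<xi> assume x: "x \<in> units G" "\<xi> \<in> ell2 (src_fibre G x)"
  let ?S = "src_fibre G x"
  have 1: "conv f \<xi> \<in> ell2 ?S" using opboundD(2)[OF assms(2) x] .
  show "fscale c (conv f \<xi>) \<in> ell2 ?S" using ell2_scale(1)[OF 1] .
  have "ell2_norm ?S (fscale c (conv f \<xi>)) \<le> cmod c * ell2_norm ?S (conv f \<xi>)"
    using ell2_scale(2)[OF 1] .
  also have "\<dots> \<le> cmod c * (C * ell2_norm ?S \<xi>)"
    using opboundD(3)[OF assms(2) x] by (simp add: mult_left_mono)
  finally show "ell2_norm ?S (fscale c (conv f \<xi>)) \<le> cmod c * C * ell2_norm ?S \<xi>"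
    by (simp add: mult.assoc)
qed

lemma opbound_conv:
  assumes "rfinite f" "rfinite h" "opbound f C" "opbound h D"
  shows "opbound (conv f h) (C * D)"
  unfolding opbound_def conv_assoc[OF assms(1,2)]
proof (intro conjI ballI)
  show "C * D \<ge> 0" using assms opboundD(1) by fastforce
  fix x \<xi> assume x: "x \<in> units G" "\<xi> \<in> ell2 (src_fibre G x)"
  let ?S = "src_fibre G x"
  have 1: "conv h \<xi> \<in> ell2 ?S" using opboundD(2)[OF assms(4) x] .
  show "conv f (conv h \<xi>) \<in> ell2 ?S" using opboundD(2)[OF assms(3) x(1) 1] .
  have "ell2_norm ?S (conv f (conv h \<xi>)) \<le> C * ell2_norm ?S (conv h \<xi>)"
    using opboundD(3)[OF assms(3) x(1) 1] .
  also have "\<dots> \<le> C * (D * ell2_norm ?S \<xi>)"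
    using opboundD(3)[OF assms(4) x] opboundD(1)[OF assms(3)] by (rule mult_left_mono)
  finally show "ell2_norm ?S (conv f (conv h \<xi>)) \<le> C * D * ell2_norm ?S \<xi>"
    by (simp add: mult.assoc)
qed

lemma bounded_fun_zero: "bounded_fun 0"
proof -
  have "opbound 0 0"
    by (simp only: opbound_def conv_zero_left ell2_zero) simp
  then show ?thesis unfolding bounded_fun_def using rfinite_zero by blast
qed

lemma bounded_fun_add: "bounded_fun f \<Longrightarrow> bounded_fun h \<Longrightarrow> bounded_fun (f + h)"
  and bounded_fun_scale: "bounded_fun f \<Longrightarrow> bounded_fun (fscale c f)"
  and bounded_fun_conv: "bounded_fun f \<Longrightarrow> bounded_fun h \<Longrightarrow> bounded_fun (conv f h)"
  unfolding bounded_fun_def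
  using rfinite_add rfinite_scale rfinite_conv opbound_add opbound_scale opbound_conv
  by metis+

lemma bounded_fun_diff: "bounded_fun f \<Longrightarrow> bounded_fun h \<Longrightarrow> bounded_fun (f - h)"
  by (simp only: diff_eq_add_fscale bounded_fun_add bounded_fun_scale)

lemma bounded_fun_rfinite: "bounded_fun f \<Longrightarrow> rfinite f"
  by (simp add: bounded_fun_def)

text \<open>On each source fibre, convolution by \<open>f\<close> moves coordinates along the
  partial injection from \<open>g\<close> to \<open>ginv G u \<cdot> g\<close>, where
  \<open>u\<close> is the element of \<open>U\<close> with the range of \<open>g\<close>, and
  multiplies them by numbers of modulus at most \<open>M\<close>.\<close>

lemma opbound_bisection:
  assumes U: "bisection U" and f: "\<And>u. u \<notin> U \<Longrightarrow> f u = 0" and M: "\<And>u. cmod (f u) \<le> M"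
  shows "opbound f M"
  unfolding opbound_def
proof (intro conjI ballI)
  show M0: "M \<ge> 0" using M norm_ge_zero order_trans by blast
  fix x \<xi> assume x: "x \<in> units G" "\<xi> \<in> ell2 (src_fibre G x)"
  let ?S = "src_fibre G x"
  have out: "conv f \<xi> g = 0" if g: "g \<notin> ?S" for g
  proof (cases "g \<in> arrows G")
    case True
    have "\<xi> (ginv G u \<cdot> g) = 0" if "u \<in> arrows G" "rng G u = rng G g" for u
      using that True g ell2_outside[OF x(2)] by (simp add: src_fibre_def ginv_closed src_ginv)
    then show ?thesis
      using conv_rfinite[OF rfinite_bisection[OF U f] True] by simp
  qed (simp add: conv_outside)
  have bd: "L2_set (\<lambda>g. cmod (conv f \<xi> g)) F \<le> M * ell2_norm ?S \<xi>"
    if F: "finite F" "F \<subseteq> ?S" for F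
  proof -
    let ?F = "{g \<in> F. \<exists>u\<in>U. rng G u = rng G g}"
    define w where "w g = (SOME u. u \<in> U \<and> rng G u = rng G g)" for g
    define m where "m g = ginv G (w g) \<cdot> g" for g
    have w: "w g \<in> U" "rng G (w g) = rng G g" "w g \<in> arrows G" if g: "g \<in> ?F" for g
    proof -
      have "\<exists>u. u \<in> U \<and> rng G u = rng G g" using g by blast
      from someI_ex[OF this] show "w g \<in> U" "rng G (w g) = rng G g" by (simp_all add: w_def)
      then show "w g \<in> arrows G" using U bisectionD(1) by blast
    qed
    have ga: "g \<in> arrows G" "src G g = x" if "g \<in> ?F" for g
      using that F by (auto simp: src_fibre_def)
    \<comment> \<open>The range of \<open>m g\<close> is the source of \<open>w g\<close>. It
      determines \<open>w g\<close> on a bisection, and then also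
      \<open>g = w g \<cdot> m g\<close>.\<close>
    have inj: "inj_on m ?F"
    proof (rule inj_onI)
      fix g h assume g: "g \<in> ?F" and h: "h \<in> ?F" and e: "m g = m h"
      have "rng G (m g) = src G (w g)" "rng G (m h) = src G (w h)"
        using w[OF g] w[OF h] ga[OF g] ga[OF h] by (auto simp: m_def ginv_closed src_ginv rng_ginv)
      then have "w g = w h" using e w(1)[OF g] w(1)[OF h] bisectionD(3)[OF U] by simp
      moreover have "w g \<cdot> m g = g" "w h \<cdot> m h = h"
        using w[OF g] w[OF h] ga[OF g] ga[OF h] by (auto simp: m_def inv_mul_cancel)
      ultimately show "g = h" using e by metis
    qed
    have mS: "m ` ?F \<subseteq> ?S"
    proof (rule image_subsetI)
      fix g assume g: "g \<in> ?F"
      show "m g \<in> ?S"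
        using w[OF g] ga[OF g] by (simp add: m_def src_fibre_def ginv_closed src_ginv)
    qed
    have "L2_set (\<lambda>g. cmod (conv f \<xi> g)) F = L2_set (\<lambda>g. cmod (conv f \<xi> g)) ?F"
    proof -
      have "conv f \<xi> g = 0" if "g \<in> F - ?F" for g
        by (rule conv_bisection_eq_0[OF f]) (use that in auto)
      then show ?thesis
        unfolding L2_set_def by (intro arg_cong[where f = sqrt] sum.mono_neutral_right) (use F in auto)
    qed
    also have "\<dots> \<le> L2_set (\<lambda>g. M * cmod (\<xi> (m g))) ?F"
    proof (rule L2_set_mono)
      fix g assume g: "g \<in> ?F"
      have "conv f \<xi> g = f (w g) * \<xi> (m g)"
        unfolding m_def by (rule conv_bisection[OF U f w(1)[OF g] ga(1)[OF g] w(2)[OF g]])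
      then show "cmod (conv f \<xi> g) \<le> M * cmod (\<xi> (m g))"
        using M[of "w g"] by (simp add: norm_mult mult_right_mono)
    qed simp
    also have "\<dots> = M * L2_set (\<lambda>g. cmod (\<xi> (m g))) ?F"
      using M0 by (simp add: L2_set_right_distrib)
    also have "L2_set (\<lambda>g. cmod (\<xi> (m g))) ?F = L2_set (\<lambda>g. cmod (\<xi> g)) (m ` ?F)"
      unfolding L2_set_def using inj by (simp add: sum.reindex)
    also have "M * \<dots> \<le> M * ell2_norm ?S \<xi>"
      using L2_set_le_ell2_norm[OF x(2) _ mS] F M0 by (intro mult_left_mono) auto
    finally show ?thesis .
  qed
  show "conv f \<xi> \<in> ell2 ?S" "ell2_norm ?S (conv f \<xi>) \<le> M * ell2_norm ?S \<xi>"
    using ell2_boundI[OF out bd] by auto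
qed

lemma bounded_fun_bisection:
  assumes "bisection U" "\<And>u. u \<notin> U \<Longrightarrow> f u = 0" "\<And>u. cmod (f u) \<le> M"
  shows "bounded_fun f"
  unfolding bounded_fun_def
proof (intro conjI exI)
  show "rfinite f" by (rule rfinite_bisection[OF assms(1,2)])
  show "opbound f M" by (rule opbound_bisection[OF assms])
qed

lemma conv_delta:
  assumes "rfinite f" "g \<in> arrows G" "h \<in> arrows G" "src G g = src G h"
  shows "conv f (const_on 1 {h}) g = f (g \<cdot> ginv G h)"
proof -
  have "bisection {h}" using assms(3) by (simp add: bisection_def)
  from conv_const_on_right[OF assms(1) this _ assms(4)[symmetric] assms(2), of 1]
  show ?thesis by simp
qed

text \<open>The number \<open>f g\<close> is the coordinate at \<open>g\<close> of the image of the
  unit vector at \<open>src G g\<close>, so operator bounds dominate pointwise values.\<close>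

lemma norm_le_opbound:
  assumes f: "rfinite f" "opbound f C" and g: "g \<in> arrows G"
  shows "cmod (f g) \<le> C"
proof -
  let ?x = "src G g"
  let ?S = "src_fibre G ?x"
  have x: "?x \<in> units G" "?x \<in> ?S" "ginv G ?x = ?x"
    using src_units[OF g] src_closed[OF g] src_src[OF g] ginv_unit[OF src_units[OF g]]
    by (auto simp: src_fibre_def)
  have d: "const_on 1 {?x} \<in> ell2 ?S" "ell2_norm ?S (const_on 1 {?x}) \<le> 1"
    by (rule ell2_delta[OF x(2)])+
  have "conv f (const_on 1 {?x}) g = f g"
    using conv_delta[OF f(1) g src_closed[OF g] src_src[OF g, symmetric]]
    by (simp only: x(3) mul_src[OF g])
  then have "cmod (f g) \<le> ell2_norm ?S (conv f (const_on 1 {?x}))"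
    using norm_le_ell2_norm[OF opboundD(2)[OF f(2) x(1) d(1)], of g] by simp
  also have "\<dots> \<le> C * 1"
    using opboundD(3)[OF f(2) x(1) d(1)] d(2) opboundD(1)[OF f(2)]
    by (meson mult_left_mono order_trans)
  finally show ?thesis by simp
qed

lemma ell2_onorm_le:
  assumes "opbound f C" "x \<in> units G"
  shows "ell2_onorm (src_fibre G x) (conv f) \<le> C"
  unfolding ell2_onorm_def
proof (rule cSUP_least)
  show "{\<xi> \<in> ell2 (src_fibre G x). ell2_norm (src_fibre G x) \<xi> \<le> 1} \<noteq> {}"
    using ell2_zero[of "src_fibre G x"] by force
  fix \<xi> assume \<xi>: "\<xi> \<in> {\<xi> \<in> ell2 (src_fibre G x). ell2_norm (src_fibre G x) \<xi> \<le> 1}"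
  have "ell2_norm (src_fibre G x) (conv f \<xi>) \<le> C * ell2_norm (src_fibre G x) \<xi>"
    using opboundD(3)[OF assms] \<xi> by blast
  also have "\<dots> \<le> C * 1" using \<xi> opboundD(1)[OF assms(1)] by (intro mult_left_mono) auto
  finally show "ell2_norm (src_fibre G x) (conv f \<xi>) \<le> C" by simp
qed

lemma rnorm_le:
  assumes "units G \<noteq> {}" "opbound f C"
  shows "rnorm f \<le> C"
  unfolding reduced_norm_def using assms ell2_onorm_le by (intro cSUP_least) auto

lemma opbound_rnorm:
  assumes ne: "units G \<noteq> {}" and f: "bounded_fun f"
  shows "opbound f (rnorm f)"
proof -
  obtain C where C: "opbound f C" and r: "rfinite f" using f unfolding bounded_fun_def by blast
  have 1: "ell2_norm (src_fibre G x) (conv f \<xi>) \<le> rnorm f"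
    if x: "x \<in> units G" "\<xi> \<in> ell2 (src_fibre G x)" "ell2_norm (src_fibre G x) \<xi> \<le> 1" for x \<xi>
  proof -
    let ?S = "src_fibre G x"
    \<comment> \<open>The bound \<open>C\<close> enters to make both suprema finite; the constant
      that results is \<open>rnorm f\<close>.\<close>
    have "bdd_above ((\<lambda>\<xi>. ell2_norm ?S (conv f \<xi>)) ` {\<xi> \<in> ell2 ?S. ell2_norm ?S \<xi> \<le> 1})"
    proof (rule bdd_aboveI2)
      fix \<xi> assume \<xi>: "\<xi> \<in> {\<xi> \<in> ell2 ?S. ell2_norm ?S \<xi> \<le> 1}"
      have "ell2_norm ?S (conv f \<xi>) \<le> C * ell2_norm ?S \<xi>"
        using opboundD(3)[OF C x(1)] \<xi> by blast
      also have "\<dots> \<le> C * 1" using \<xi> opboundD(1)[OF C] by (intro mult_left_mono) auto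
      finally show "ell2_norm ?S (conv f \<xi>) \<le> C" by simp
    qed
    then have "ell2_norm ?S (conv f \<xi>) \<le> ell2_onorm ?S (conv f)"
      unfolding ell2_onorm_def by (rule cSUP_upper2) (use x in auto)
    also have "\<dots> \<le> rnorm f"
      unfolding reduced_norm_def
      by (rule cSUP_upper[OF x(1)]) (auto intro!: bdd_aboveI2[where M = C] ell2_onorm_le[OF C])
    finally show ?thesis .
  qed
  have nn: "rnorm f \<ge> 0"
  proof -
    obtain x where x: "x \<in> units G" using ne by blast
    have "ell2_norm (src_fibre G x) (conv f 0) \<le> rnorm f"
      by (rule 1[OF x ell2_zero(1)]) (simp add: ell2_zero(2))
    then show ?thesis using ell2_norm_nonneg order_trans by blast
  qed
  show ?thesis unfolding opbound_def
  proof (intro conjI ballI)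
    fix x \<xi> assume x: "x \<in> units G" "\<xi> \<in> ell2 (src_fibre G x)"
    let ?S = "src_fibre G x"
    let ?t = "ell2_norm ?S \<xi>"
    show cv: "conv f \<xi> \<in> ell2 ?S" using opboundD(2)[OF C x] .
    show "ell2_norm ?S (conv f \<xi>) \<le> rnorm f * ?t"
    proof (cases "?t = 0")
      case True
      then show ?thesis using opboundD(3)[OF C x] by simp
    next
      case False
      then have t: "?t > 0" using ell2_norm_nonneg[of ?S \<xi>] by linarith
      let ?\<xi> = "fscale (complex_of_real (1 / ?t)) \<xi>"
      have "ell2_norm ?S ?\<xi> \<le> cmod (complex_of_real (1 / ?t)) * ?t" using ell2_scale(2)[OF x(2)] .
      also have "\<dots> = 1" using t by (simp add: norm_divide)
      finally have "ell2_norm ?S (conv f ?\<xi>) \<le> rnorm f"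
        using 1[OF x(1) ell2_scale(1)[OF x(2)]] by blast
      then have 2: "ell2_norm ?S (fscale (complex_of_real (1 / ?t)) (conv f \<xi>)) \<le> rnorm f"
        by (simp only: conv_scale_right[OF r])
      have "conv f \<xi> =
        fscale (complex_of_real ?t) (fscale (complex_of_real (1 / ?t)) (conv f \<xi>))"
        using t by (simp add: fscale_def fun_eq_iff)
      then have "ell2_norm ?S (conv f \<xi>) \<le>
        cmod (complex_of_real ?t) * ell2_norm ?S (fscale (complex_of_real (1 / ?t)) (conv f \<xi>))"
        using ell2_scale(2)[OF ell2_scale(1)[OF cv]] by metis
      also have "\<dots> \<le> ?t * rnorm f" using 2 t by simp
      finally show ?thesis by (simp add: mult.commute)
    qed
  qed (rule nn)
qed

end

text \<open>The reduced norm is a supremum over the units, which says nothing when there are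
  none.\<close>

locale nonempty_groupoid = groupoid +
  assumes units_nonempty: "units G \<noteq> {}"
begin

lemma rnorm_nonneg: "bounded_fun f \<Longrightarrow> rnorm f \<ge> 0"
  using opbound_rnorm[OF units_nonempty] opboundD(1) by blast

lemma norm_le_rnorm: "bounded_fun f \<Longrightarrow> g \<in> arrows G \<Longrightarrow> cmod (f g) \<le> rnorm f"
  using opbound_rnorm[OF units_nonempty] norm_le_opbound bounded_fun_rfinite by blast

lemma rnorm_add:
  "bounded_fun f \<Longrightarrow> bounded_fun h \<Longrightarrow> rnorm (f + h) \<le> rnorm f + rnorm h"
  by (intro rnorm_le[OF units_nonempty] opbound_add opbound_rnorm[OF units_nonempty]
      bounded_fun_rfinite)

lemma rnorm_scale:
  "bounded_fun f \<Longrightarrow> rnorm (fscale c f) \<le> cmod c * rnorm f"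
  by (intro rnorm_le[OF units_nonempty] opbound_scale opbound_rnorm[OF units_nonempty]
      bounded_fun_rfinite)

lemma rnorm_conv:
  "bounded_fun f \<Longrightarrow> bounded_fun h \<Longrightarrow>
   rnorm (conv f h) \<le> rnorm f * rnorm h"
  by (intro rnorm_le[OF units_nonempty] opbound_conv
      opbound_rnorm[OF units_nonempty] bounded_fun_rfinite)

lemma rnorm_bisection:
  "bisection U \<Longrightarrow> (\<And>u. u \<notin> U \<Longrightarrow> f u = 0) \<Longrightarrow> (\<And>u. cmod (f u) \<le> M) \<Longrightarrow> rnorm f \<le> M"
  by (intro rnorm_le[OF units_nonempty] opbound_bisection)

lemma rnorm_zero: "rnorm 0 = 0"
proof -
  have "opbound 0 0" by (simp only: opbound_def conv_zero_left ell2_zero) simp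
  then show ?thesis
    using rnorm_le[OF units_nonempty] rnorm_nonneg[OF bounded_fun_zero] by (metis order_antisym)
qed

lemma rnorm_commute:
  assumes "bounded_fun f" "bounded_fun h"
  shows "rnorm (f - h) = rnorm (h - f)"
proof -
  have "rnorm (a - b) \<le> rnorm (b - a)" if "bounded_fun a" "bounded_fun b" for a b
  proof -
    have "a - b = fscale (- 1) (b - a)" by (auto simp: fscale_def fun_eq_iff)
    then show ?thesis using rnorm_scale[of "b - a" "- 1"] bounded_fun_diff that by simp
  qed
  then show ?thesis using assms by (meson order_antisym)
qed

lemma rnorm_triangle:
  assumes "bounded_fun f" "bounded_fun h" "bounded_fun k"
  shows "rnorm (f - k) \<le> rnorm (f - h) + rnorm (h - k)"
proof -
  have "f - k = (f - h) + (h - k)" by simp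
  then show ?thesis using rnorm_add[of "f - h" "h - k"] bounded_fun_diff assms by simp
qed

text \<open>This amounts to injectivity of the map from the completion to functions on the arrows.\<close>

lemma rnorm_tendsto_0:
  assumes p: "\<And>n. bounded_fun (p n)"
    and cauchy: "\<And>e. e > 0 \<Longrightarrow> \<exists>N. \<forall>m\<ge>N. \<forall>n\<ge>N. rnorm (p m - p n) < e"
    and pt: "\<And>g. g \<in> arrows G \<Longrightarrow> (\<lambda>n. p n g) \<longlonglongrightarrow> 0"
  shows "(\<lambda>n. rnorm (p n)) \<longlonglongrightarrow> 0"
proof -
  have r: "rfinite (p n)" for n using p bounded_fun_rfinite by blast
  have opb: "opbound (p n) (rnorm (p n))" for n
    using opbound_rnorm[OF units_nonempty p] .
  obtain N1 where N1: "\<forall>m\<ge>N1. \<forall>n\<ge>N1. rnorm (p m - p n) < 1" using cauchy[of 1] by auto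
  define M where "M = rnorm (p N1) + 1"
  have M: "rnorm (p n) \<le> M" if "n \<ge> N1" for n
  proof -
    have "p n = (p n - p N1) + p N1" by simp
    then have "rnorm (p n) \<le> rnorm (p n - p N1) + rnorm (p N1)"
      using rnorm_add[of "p n - p N1" "p N1"] bounded_fun_diff p by metis
    then show ?thesis using N1 that unfolding M_def by (smt (verit) order_refl)
  qed
  have M0: "M > 0" using rnorm_nonneg[OF p[of N1]] by (simp add: M_def)
  \<comment> \<open>For a finitely supported vector the coordinate at \<open>g\<close> is a finite
    combination of the values \<open>p n (g \<cdot> ginv G h)\<close>, to which the pointwise
    hypothesis applies.\<close>
  have pw_fin: "(\<lambda>n. conv (p n) \<xi> g) \<longlonglongrightarrow> 0"
    if F: "finite F" "\<And>h. h \<notin> F \<Longrightarrow> \<xi> h = 0" "F \<subseteq> src_fibre G x" and g: "g \<in> src_fibre G x" for F \<xi> x g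
  proof -
    have ga: "g \<in> arrows G" "src G g = x" using g by (auto simp: src_fibre_def)
    have Fa: "h \<in> arrows G \<and> src G h = x" if "h \<in> F" for h using F(3) that by (auto simp: src_fibre_def)
    have "conv (p n) \<xi> g = (\<Sum>h\<in>F. \<xi> h * p n (g \<cdot> ginv G h))" for n
    proof -
      have "\<xi> = (\<Sum>h\<in>F. fscale (\<xi> h) (const_on 1 {h}))"
      proof
        fix k
        have "(\<Sum>h\<in>F. fscale (\<xi> h) (const_on 1 {h})) k = (\<Sum>h\<in>F. if h = k then \<xi> h else 0)"
          unfolding sum_fun_apply by (rule sum.cong) (auto simp: fscale_def const_on_def)
        also have "\<dots> = \<xi> k" using F by (simp add: sum.delta)
        finally show "\<xi> k = (\<Sum>h\<in>F. fscale (\<xi> h) (const_on 1 {h})) k" by simp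
      qed
      moreover have "conv (p n) (\<Sum>h\<in>F. fscale (\<xi> h) (const_on 1 {h}))
          = (\<Sum>h\<in>F. fscale (\<xi> h) (conv (p n) (const_on 1 {h})))"
        using F(1)
      proof (induction F rule: finite_induct)
        case (insert h F)
        then show ?case
          by (simp only: sum.insert conv_add_right[OF r] conv_scale_right[OF r] not_False_eq_True)
      qed (simp only: sum.empty conv_zero_right)
      moreover have "(\<Sum>h\<in>F. fscale (\<xi> h) (conv (p n) (const_on 1 {h}))) g
          = (\<Sum>h\<in>F. \<xi> h * p n (g \<cdot> ginv G h))"
        unfolding sum_fun_apply
        by (rule sum.cong) (use Fa ga conv_delta[OF r] in \<open>auto simp: fscale_def\<close>)
      ultimately show ?thesis by metis
    qed
    moreover have "(\<lambda>n. \<Sum>h\<in>F. \<xi> h * p n (g \<cdot> ginv G h)) \<longlonglongrightarrow> (\<Sum>h\<in>F. \<xi> h * 0)"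
      by (intro tendsto_sum tendsto_mult tendsto_const pt) (use Fa ga in \<open>auto simp: ginv_closed rng_ginv\<close>)
    ultimately show ?thesis by simp
  qed
  have pw: "(\<lambda>n. conv (p n) \<xi> g) \<longlonglongrightarrow> 0"
    if x: "x \<in> units G" and \<xi>: "\<xi> \<in> ell2 (src_fibre G x)" and g: "g \<in> src_fibre G x" for \<xi> x g
  proof (rule LIMSEQ_I)
    fix e :: real assume e: "e > 0"
    let ?S = "src_fibre G x"
    \<comment> \<open>Since \<open>M\<close> bounds the norms from \<open>N1\<close> on, the tail
      outside \<open>F\<close> contributes at most \<open>M * (e / (2 * M))\<close>, which is
      \<open>e / 2\<close>, uniformly in \<open>n\<close>.\<close>
    obtain F where F: "finite F" "F \<subseteq> ?S"
      "ell2_norm ?S (\<xi> - (\<lambda>g. if g \<in> F then \<xi> g else 0)) \<le> e / (2 * M)"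
      using ell2_truncate[OF \<xi>, of "e / (2 * M)"] e M0 by auto
    let ?\<eta> = "\<lambda>g. if g \<in> F then \<xi> g else 0"
    have \<eta>: "?\<eta> \<in> ell2 ?S"
      by (rule ell2_boundI(1)[where C = "ell2_norm ?S \<xi>"])
        (use F(2) in \<open>auto intro!: order_trans[OF L2_set_mono L2_set_le_ell2_norm[OF \<xi>]]\<close>)
    have "(\<lambda>n. conv (p n) ?\<eta> g) \<longlonglongrightarrow> 0"
      by (rule pw_fin[OF F(1) _ F(2) g]) simp
    then obtain N2 where N2: "\<forall>n\<ge>N2. norm (conv (p n) ?\<eta> g - 0) < e / 2"
      using LIMSEQ_D[of _ 0 "e / 2"] e by (meson half_gt_zero)
    have "norm (conv (p n) \<xi> g - 0) < e" if n: "n \<ge> max N1 N2" for n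
    proof -
      have d: "\<xi> - ?\<eta> \<in> ell2 ?S" using ell2_diff[OF \<xi> \<eta>] .
      have "conv (p n) \<xi> = conv (p n) ((\<xi> - ?\<eta>) + ?\<eta>)" by (simp only: diff_add_cancel)
      also have "\<dots> = conv (p n) (\<xi> - ?\<eta>) + conv (p n) ?\<eta>"
        by (rule conv_add_right[OF r])
      finally have "cmod (conv (p n) \<xi> g)
         \<le> cmod (conv (p n) (\<xi> - ?\<eta>) g) + cmod (conv (p n) ?\<eta> g)"
        by (simp add: norm_triangle_ineq)
      moreover have "cmod (conv (p n) (\<xi> - ?\<eta>) g) \<le> e / 2"
      proof -
        have "cmod (conv (p n) (\<xi> - ?\<eta>) g) \<le> ell2_norm ?S (conv (p n) (\<xi> - ?\<eta>))"
          using norm_le_ell2_norm[OF opboundD(2)[OF opb x d]] .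
        also have "\<dots> \<le> rnorm (p n) * ell2_norm ?S (\<xi> - ?\<eta>)"
          using opboundD(3)[OF opb x d] .
        also have "\<dots> \<le> M * (e / (2 * M))"
          using M n F(3) M0 by (intro mult_mono) (auto simp: ell2_norm_nonneg)
        also have "\<dots> = e / 2" using M0 by simp
        finally show ?thesis .
      qed
      moreover have "cmod (conv (p n) ?\<eta> g) < e / 2" using N2 n by simp
      ultimately show ?thesis by simp
    qed
    then show "\<exists>no. \<forall>n\<ge>no. norm (conv (p n) \<xi> g - 0) < e" by blast
  qed
  show ?thesis
  proof (rule LIMSEQ_I)
    fix e :: real assume e: "e > 0"
    then obtain N where N: "\<forall>m\<ge>N. \<forall>n\<ge>N. rnorm (p m - p n) < e / 2"
      using cauchy[of "e / 2"] by auto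
    have "opbound (p n) (e / 2)" if n: "n \<ge> N" for n
      unfolding opbound_def
    proof (intro conjI ballI)
      fix x \<xi> assume x: "x \<in> units G" and \<xi>: "\<xi> \<in> ell2 (src_fibre G x)"
      let ?S = "src_fibre G x"
      show cv: "conv (p n) \<xi> \<in> ell2 ?S" using opboundD(2)[OF opb x \<xi>] .
      show "ell2_norm ?S (conv (p n) \<xi>) \<le> e / 2 * ell2_norm ?S \<xi>"
      proof (rule ell2_boundI(2))
        fix F assume F: "finite F" "F \<subseteq> ?S"
        \<comment> \<open>For fixed \<open>n\<close> the Cauchy estimate is kept on the finite set
          \<open>F\<close> while \<open>m\<close> tends to infinity. There
          \<open>conv (p m) \<xi>\<close> tends to 0 pointwise, which leaves a bound for
          \<open>p n\<close> alone.\<close>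
        have "L2_set (\<lambda>g. cmod (conv (p n) \<xi> g - conv (p m) \<xi> g)) F
          \<le> e / 2 * ell2_norm ?S \<xi>" if m: "m \<ge> N" for m
        proof -
          have op: "opbound (p n - p m) (rnorm (p n - p m))"
            using opbound_rnorm[OF units_nonempty bounded_fun_diff] p by blast
          have eq: "conv (p n - p m) \<xi> = conv (p n) \<xi> - conv (p m) \<xi>"
            using conv_diff_left r by blast
          have "L2_set (\<lambda>g. cmod (conv (p n - p m) \<xi> g)) F
            \<le> ell2_norm ?S (conv (p n - p m) \<xi>)"
            by (rule L2_set_le_ell2_norm[OF opboundD(2)[OF op x \<xi>] F])
          also have "\<dots> \<le> rnorm (p n - p m) * ell2_norm ?S \<xi>"
            by (rule opboundD(3)[OF op x \<xi>])
          also have "\<dots> \<le> e / 2 * ell2_norm ?S \<xi>"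
            using N n m by (intro mult_right_mono) (auto simp: ell2_norm_nonneg less_imp_le)
          finally show ?thesis by (simp add: eq)
        qed
        moreover have "(\<lambda>m. L2_set (\<lambda>g. cmod (conv (p n) \<xi> g - conv (p m) \<xi> g)) F)
          \<longlonglongrightarrow> L2_set (\<lambda>g. cmod (conv (p n) \<xi> g - 0)) F"
          unfolding L2_set_def using F
          by (intro tendsto_real_sqrt tendsto_sum tendsto_power tendsto_norm tendsto_diff tendsto_const
              pw[OF x \<xi>]) auto
        ultimately have "L2_set (\<lambda>g. cmod (conv (p n) \<xi> g - 0)) F \<le> e / 2 * ell2_norm ?S \<xi>"
          by (intro LIMSEQ_le_const2) auto
        then show "L2_set (\<lambda>g. cmod (conv (p n) \<xi> g)) F \<le> e / 2 * ell2_norm ?S \<xi>" by simp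
      qed (rule ell2_outside[OF cv])
    qed (use e in simp)
    then have "norm (rnorm (p n) - 0) < e" if "n \<ge> N" for n
      using rnorm_le[OF units_nonempty] rnorm_nonneg[OF p] that e
      by (smt (verit) field_sum_of_halves real_norm_def)
    then show "\<exists>no. \<forall>n\<ge>no. norm (rnorm (p n) - 0) < e" by blast
  qed
qed

end

section \<open>The Steinberg algebra inside the reduced algebra\<close>

locale nonempty_ample_groupoid = ample_groupoid G + nonempty_groupoid G
  for G :: "'a topgroupoid"
begin

abbreviation steinberg :: "('a \<Rightarrow> complex) set" where
  "steinberg \<equiv> elems (steinberg_algebra G)"

lemma steinberg_eq: "steinberg = fun_space.span {const_on c U |c U. compact_bisection U}"
  by (simp add: steinberg_algebra_def compact_bisection_def)

lemma steinberg_zero: "0 \<in> steinberg"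
  and steinberg_add: "f \<in> steinberg \<Longrightarrow> h \<in> steinberg \<Longrightarrow> f + h \<in> steinberg"
  and steinberg_diff: "f \<in> steinberg \<Longrightarrow> h \<in> steinberg \<Longrightarrow> f - h \<in> steinberg"
  and steinberg_scale: "f \<in> steinberg \<Longrightarrow> fscale c f \<in> steinberg"
  unfolding steinberg_eq
  by (rule fun_space.span_zero fun_space.span_add fun_space.span_diff fun_space.span_scale; assumption)+

lemma const_on_steinberg: "compact_bisection U \<Longrightarrow> const_on c U \<in> steinberg"
  unfolding steinberg_eq by (rule fun_space.span_base) blast

lemma fscale_const_on: "fscale c (const_on d U) = const_on (c * d) U"
  by (auto simp: fscale_def const_on_def fun_eq_iff)

lemma steinberg_induct [consumes 1, case_names zero add]:
  assumes f: "f \<in> steinberg" and zero: "P 0"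
    and add: "\<And>c U h. compact_bisection U \<Longrightarrow> h \<in> steinberg \<Longrightarrow> P h \<Longrightarrow> P (const_on c U + h)"
  shows "P f"
proof -
  have "f \<in> steinberg \<and> P f"
    using f[unfolded steinberg_eq]
  proof (induction rule: fun_space.span_induct_alt)
    case base
    then show ?case using steinberg_zero zero by blast
  next
    case (step c x y)
    then obtain d U where x: "x = const_on d U" "compact_bisection U" by blast
    then have "fscale c x = const_on (c * d) U" by (simp only: fscale_const_on)
    then show ?case using add steinberg_add const_on_steinberg x(2) step by metis
  qed
  then show ?thesis ..
qed

lemma compact_bisectionD: "compact_bisection U \<Longrightarrow> bisection U"
  by (simp add: compact_bisection_iff)

lemma bounded_fun_const_on:
  assumes "compact_bisection U"
  shows "bounded_fun (const_on c U)"
  by (rule bounded_fun_bisection[OF compact_bisectionD[OF assms], where M = "cmod c"])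
    (auto simp: const_on_def)

lemma bounded_fun_steinberg: "f \<in> steinberg \<Longrightarrow> bounded_fun f"
proof (induction rule: steinberg_induct)
  case (add c U h)
  then show ?case by (blast intro: bounded_fun_add bounded_fun_const_on)
qed (rule bounded_fun_zero)

lemma rfinite_steinberg: "f \<in> steinberg \<Longrightarrow> rfinite f"
  using bounded_fun_steinberg bounded_fun_rfinite by blast



lemma steinberg_conv:
  assumes "f \<in> steinberg" "h \<in> steinberg"
  shows "conv f h \<in> steinberg"
  using assms(1)
proof (induction rule: steinberg_induct)
  case zero
  show ?case using steinberg_zero by (simp only: conv_zero_left)
next
  case (add c U f)
  have "conv (const_on c U) h \<in> steinberg"
    using assms(2)
  proof (induction rule: steinberg_induct)
    case zero
    show ?case using steinberg_zero by (simp only: conv_zero_right)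
  next
    case (add d V h)
    have "conv (const_on c U) (const_on d V) \<in> steinberg"
      using conv_const_on_const_on compact_bisection_set_mul const_on_steinberg
        compact_bisectionD add(1) \<open>compact_bisection U\<close> by metis
    then show ?case
      using add(3) conv_add_right steinberg_add rfinite_steinberg const_on_steinberg
        \<open>compact_bisection U\<close> by metis
  qed
  then show ?case
    using add conv_add_left steinberg_add rfinite_steinberg const_on_steinberg by metis
qed

section \<open>Density of the Steinberg algebra\<close>

lemma const_on_Cc:
  assumes "compact_bisection U"
  shows "const_on c U \<in> Cc G U"
proof -
  let ?U = "subtopology (gtop G) U"
  have "compact_space ?U" using assms by (simp add: compact_bisection_def compact_space_subtopology)
  then have "compactin ?U (?U closure_of {g \<in> U. const_on c U g \<noteq> 0})"
    by (rule closedin_compact_space) simp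
  moreover have "continuous_map ?U euclidean (const_on c U)"
    by (rule continuous_map_eq[of _ _ "\<lambda>_. c"]) (auto simp: const_on_def)
  ultimately show ?thesis by (simp add: Cc_def const_on_def)
qed

lemma steinberg_subset_Cc_span: "steinberg \<subseteq> Cc_span G"
  unfolding steinberg_eq Cc_span_def
  by (rule fun_space.span_mono) (use const_on_Cc compact_bisection_def in blast)

lemma bounded_fun_Cc:
  assumes U: "open_bisection G U" and f: "f \<in> Cc G U"
  shows "bounded_fun f"
proof -
  let ?U = "subtopology (gtop G) U"
  let ?K = "?U closure_of {g \<in> U. f g \<noteq> 0}"
  have "compactin euclidean (f ` ?K)"
    using f image_compactin unfolding Cc_def by blast
  then have "bounded (f ` ?K)" by (simp add: compact_imp_bounded)
  then obtain M where M: "\<And>g. g \<in> ?K \<Longrightarrow> cmod (f g) \<le> M" unfolding bounded_iff by blast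
  have UA: "U \<subseteq> arrows G" using U bisectionD(1) open_bisection_iff by blast
  have z: "f g = 0" if "g \<notin> U" for g using f that by (auto simp: Cc_def)
  have "cmod (f g) \<le> max M 0" for g
  proof (cases "f g = 0")
    case False
    then have "g \<in> U" using z by blast
    then have "g \<in> ?K" using False UA by (auto simp: in_closure_of)
    then show ?thesis using M by fastforce
  qed simp
  then show ?thesis
    using bounded_fun_bisection[of U f "max M 0"] z U open_bisection_iff by blast
qed

lemma Cc_span_induct [consumes 1, case_names zero add]:
  assumes f: "f \<in> Cc_span G" and zero: "P 0"
    and add: "\<And>c U f h. open_bisection G U \<Longrightarrow> f \<in> Cc G U \<Longrightarrow> h \<in> Cc_span G \<Longrightarrow> P h \<Longrightarrow>
      P (fscale c f + h)"
  shows "P f"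
proof -
  have "f \<in> Cc_span G \<and> P f"
    using f[unfolded Cc_span_def]
  proof (induction rule: fun_space.span_induct_alt)
    case base
    then show ?case using zero unfolding Cc_span_def by (simp only: fun_space.span_zero)
  next
    case (step c x y)
    then obtain U where U: "open_bisection G U" "x \<in> Cc G U" by blast
    have "x \<in> Cc_span G" unfolding Cc_span_def by (rule fun_space.span_base) (use step in blast)
    then have "fscale c x + y \<in> Cc_span G"
      using step unfolding Cc_span_def by (intro fun_space.span_add fun_space.span_scale) auto
    then show ?case using add[OF U] step by blast
  qed
  then show ?thesis ..
qed

lemma bounded_fun_Cc_span: "f \<in> Cc_span G \<Longrightarrow> bounded_fun f"
proof (induction rule: Cc_span_induct)
  case (add c U f h)
  then show ?case by (blast intro: bounded_fun_add bounded_fun_scale bounded_fun_Cc)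
qed (rule bounded_fun_zero)

text \<open>The support is covered by finitely many compact open sets on which \<open>f\<close>
  stays within \<open>e\<close> of a constant, and these are made disjoint one at a time. Vanishing
  of \<open>h\<close> off the same \<open>U\<close> matters: it keeps \<open>f - h\<close> on one
  bisection, where the sup norm bounds the reduced norm.\<close>

lemma Cc_uniform_approximation:
  assumes U: "open_bisection G U" and f: "f \<in> Cc G U" and e: "e > 0"
  obtains h where "h \<in> steinberg" "\<And>g. g \<notin> U \<Longrightarrow> h g = 0" "\<And>g. cmod (f g - h g) \<le> e"
proof -
  let ?U = "subtopology (gtop G) U"
  let ?K = "?U closure_of {g \<in> U. f g \<noteq> 0}"
  define \<W> where "\<W> = {W. compact_bisection W \<and> W \<subseteq> U \<and> (\<exists>c. \<forall>h\<in>W. cmod (f h - c) \<le> e)}"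
  have opU: "gopen U" using U by (simp add: open_bisection_def)
  then have UA: "U \<subseteq> arrows G" by (rule openin_subset)
  have cont: "continuous_map ?U euclidean f" and z: "\<And>g. g \<notin> U \<Longrightarrow> f g = 0"
    and K: "compactin ?U ?K"
    using f by (auto simp: Cc_def)
  have KG: "compactin (gtop G) ?K" "?K \<subseteq> U" using K unfolding compactin_subtopology by auto
  have cov: "?K \<subseteq> \<Union>\<W>"
  proof
    fix g assume "g \<in> ?K"
    then have gU: "g \<in> U" using KG by blast
    let ?W = "{h \<in> topspace ?U. f h \<in> ball (f g) e}"
    have "openin ?U ?W" by (rule openin_continuous_map_preimage[OF cont]) simp
    then have "gopen ?W" by (simp add: openin_open_subtopology[OF opU])
    moreover have "g \<in> ?W" using gU UA e by auto
    ultimately obtain W where W: "compact_bisection W" "g \<in> W" "W \<subseteq> ?W"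
      by (rule compact_bisection_base)
    have "\<forall>h\<in>W. cmod (f h - f g) \<le> e"
      using W(3) by (auto simp: dist_norm norm_minus_commute less_imp_le)
    then have "W \<in> \<W>" using W unfolding \<W>_def by auto
    then show "g \<in> \<Union>\<W>" using W(2) by blast
  qed
  moreover have "gopen W" if "W \<in> \<W>" for W
    using that by (simp add: \<W>_def compact_bisection_iff)
  ultimately obtain \<F> where F: "finite \<F>" "\<F> \<subseteq> \<W>" "?K \<subseteq> \<Union>\<F>"
    using KG(1) unfolding compactin_def by meson
  have "\<exists>h\<in>steinberg. (\<forall>g. g \<notin> \<Union>\<F> \<longrightarrow> h g = 0) \<and> (\<forall>g\<in>\<Union>\<F>. cmod (f g - h g) \<le> e)"
    using F(1,2)
  proof (induction \<F> rule: finite_induct)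
    case empty
    then show ?case using steinberg_zero by (intro bexI[of _ 0]) auto
  next
    case (insert W \<F>)
    then obtain h where h: "h \<in> steinberg" "\<And>g. g \<notin> \<Union>\<F> \<Longrightarrow> h g = 0"
      "\<And>g. g \<in> \<Union>\<F> \<Longrightarrow> cmod (f g - h g) \<le> e" by blast
    have W: "compact_bisection W" "W \<subseteq> U" using insert by (auto simp: \<W>_def)
    have "\<exists>c. \<forall>h\<in>W. cmod (f h - c) \<le> e" using insert by (auto simp: \<W>_def)
    then obtain c where c: "\<And>h. h \<in> W \<Longrightarrow> cmod (f h - c) \<le> e" by blast
    have D: "gopen (\<Union>\<F>)" "compactin (gtop G) (\<Union>\<F>)" "\<Union>\<F> \<subseteq> U"
      using insert by (auto simp: \<W>_def compact_bisection_iff intro!: compactin_Union)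
    have DU: "openin ?U (\<Union>\<F>)" "compactin ?U (\<Union>\<F>)"
      using D by (simp_all add: compactin_subtopology openin_open_subtopology[OF opU])
    \<comment> \<open>Compact sets need not be closed in the arrow space. Inside the Hausdorff set
      \<open>U\<close> they are, so removing the earlier sets from \<open>W\<close> leaves a set
      that is again compact and open.\<close>
    have cl: "closedin ?U (\<Union>\<F>)"
      by (rule compactin_imp_closedin[OF Hausdorff_open_bisection[OF U] DU(2)])
    have tU: "topspace ?U = U" using UA by auto
    have "openin ?U (U - \<Union>\<F>)" using cl tU unfolding closedin_def by simp
    moreover have "openin ?U W"
      using W by (simp add: openin_open_subtopology[OF opU] compact_bisection_iff)
    ultimately have "openin ?U (W \<inter> (U - \<Union>\<F>))" by blast
    then have o: "gopen (W \<inter> (U - \<Union>\<F>))" by (simp add: openin_open_subtopology[OF opU])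
    have "closedin ?U (U - \<Union>\<F>)" using closedin_diff[OF closedin_topspace DU(1)] tU by simp
    moreover have "compactin ?U W" using W by (simp add: compactin_subtopology compact_bisection_iff)
    ultimately have "compactin ?U ((U - \<Union>\<F>) \<inter> W)" by (rule closed_Int_compactin)
    then have "compactin (gtop G) (W \<inter> (U - \<Union>\<F>))" by (simp add: compactin_subtopology Int_commute)
    moreover have "bisection (W \<inter> (U - \<Union>\<F>))"
      using bisection_subset[OF compact_bisectionD[OF W(1)]] by blast
    ultimately have W': "compact_bisection (W \<inter> (U - \<Union>\<F>))"
      using o by (simp add: compact_bisection_iff)
    let ?h = "const_on c (W \<inter> (U - \<Union>\<F>)) + h"
    have "?h \<in> steinberg" using steinberg_add const_on_steinberg[OF W'] h(1) by blast
    moreover have "?h g = 0" if "g \<notin> \<Union>(insert W \<F>)" for g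
      using that h(2)[of g] by (simp add: const_on_def)
    moreover have "cmod (f g - ?h g) \<le> e" if "g \<in> \<Union>(insert W \<F>)" for g
    proof (cases "g \<in> \<Union>\<F>")
      case True
      then have "?h g = h g" by (auto simp: const_on_def)
      then show ?thesis using h(3)[OF True] by simp
    next
      case False
      then have "g \<in> W" using that by simp
      then have "?h g = c" using False h(2)[OF False] W(2) by (auto simp: const_on_def)
      then show ?thesis using c[OF \<open>g \<in> W\<close>] by simp
    qed
    ultimately show ?case by blast
  qed
  then obtain h where h: "h \<in> steinberg" "\<And>g. g \<notin> \<Union>\<F> \<Longrightarrow> h g = 0"
    "\<And>g. g \<in> \<Union>\<F> \<Longrightarrow> cmod (f g - h g) \<le> e" by blast
  have FU: "\<Union>\<F> \<subseteq> U" using F(2) by (auto simp: \<W>_def)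
  have "cmod (f g - h g) \<le> e" for g
  proof (cases "g \<in> \<Union>\<F>")
    case False
    have "f g = 0"
    proof (rule ccontr)
      assume "f g \<noteq> 0"
      then have "g \<in> U" using z by blast
      then have "g \<in> ?K" using \<open>f g \<noteq> 0\<close> UA by (auto simp: in_closure_of)
      then show False using F(3) False by blast
    qed
    then show ?thesis using h(2)[OF False] e by simp
  qed (rule h(3))
  then show ?thesis using that h(1,2) FU by blast
qed

lemma steinberg_dense:
  assumes "f \<in> Cc_span G" "e > 0"
  shows "\<exists>h\<in>steinberg. rnorm (f - h) < e"
  using assms
proof (induction arbitrary: e rule: Cc_span_induct)
  case zero
  have "rnorm (0 - 0) < e" using zero by (simp only: diff_self rnorm_zero)
  then show ?case using steinberg_zero by blast
next
  case (add c U f h)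
  \<comment> \<open>Adding 1 to \<open>cmod c\<close> keeps the tolerance positive and finite for
    \<open>c = 0\<close> as well.\<close>
  let ?d = "e / (2 * (cmod c + 1))"
  have c0: "cmod c + 1 > 0" by (simp add: add_nonneg_pos)
  then have d: "?d > 0" using add by simp
  obtain f' where f': "f' \<in> steinberg" "\<And>g. g \<notin> U \<Longrightarrow> f' g = 0" "\<And>g. cmod (f g - f' g) \<le> ?d"
    using Cc_uniform_approximation[OF add(1,2) d] by blast
  have "e / 2 > 0" using add by simp
  then obtain h' where h': "h' \<in> steinberg" "rnorm (h - h') < e / 2" using add by blast
  have bf: "bounded_fun (f - f')" "bounded_fun (h - h')"
    using bounded_fun_diff bounded_fun_Cc[OF add(1,2)] bounded_fun_Cc_span[OF add(3)]
      bounded_fun_steinberg f'(1) h'(1) by blast+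
  have "f g = 0" if "g \<notin> U" for g using add(2) that by (auto simp: Cc_def)
  then have N: "rnorm (f - f') \<le> ?d"
    using f' add(1) by (intro rnorm_bisection[of U]) (auto simp: open_bisection_iff)
  have "(fscale c f + h) - (fscale c f' + h') = fscale c (f - f') + (h - h')"
    by (auto simp: fscale_def fun_eq_iff algebra_simps)
  then have "rnorm ((fscale c f + h) - (fscale c f' + h'))
      \<le> rnorm (fscale c (f - f')) + rnorm (h - h')"
    using rnorm_add[OF bounded_fun_scale[OF bf(1)] bf(2)] by metis
  also have "rnorm (fscale c (f - f')) \<le> cmod c * ?d"
    using rnorm_scale[OF bf(1), of c] N by (meson mult_left_mono norm_ge_zero order_trans)
  also have "cmod c * ?d \<le> e / 2"
  proof -
    have "cmod c * ?d \<le> (cmod c + 1) * ?d" using d by (intro mult_right_mono) auto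
    also have "\<dots> = e / 2" using c0 by (simp add: field_simps)
    finally show ?thesis .
  qed
  also have "e / 2 + rnorm (h - h') < e" using h'(2) by simp
  finally have "rnorm ((fscale c f + h) - (fscale c f' + h')) < e" by simp
  moreover have "fscale c f' + h' \<in> steinberg" using f'(1) h'(1) steinberg_add steinberg_scale by blast
  ultimately show ?case by blast
qed

end

section \<open>Closed ideals of the completion\<close>

context nonempty_ample_groupoid
begin

section \<open>The completion through classes of Cauchy sequences\<close>

abbreviation cauchy :: "(nat \<Rightarrow> 'a \<Rightarrow> complex) set" where
  "cauchy \<equiv> cauchy_seqs (Cc_algebra G)"

abbreviation crel :: "((nat \<Rightarrow> 'a \<Rightarrow> complex) \<times> (nat \<Rightarrow> 'a \<Rightarrow> complex)) set" where
  "crel \<equiv> cauchy_rel (Cc_algebra G)"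

abbreviation Cred :: "(nat \<Rightarrow> 'a \<Rightarrow> complex) set normed_star_algebra" where
  "Cred \<equiv> completion (Cc_algebra G)"

abbreviation cls :: "(nat \<Rightarrow> 'a \<Rightarrow> complex) \<Rightarrow> (nat \<Rightarrow> 'a \<Rightarrow> complex) set" where
  "cls p \<equiv> crel `` {p}"

lemma adist_Cc: "adist (Cc_algebra G) f h = rnorm (f - h)"
proof -
  have "adist (Cc_algebra G) f h = rnorm (f + fscale (- 1) h)" by (simp add: adist_def Cc_algebra_def)
  then show ?thesis by (simp only: diff_eq_add_fscale)
qed

lemma cauchy_iff:
  "p \<in> cauchy \<longleftrightarrow> (\<forall>n. p n \<in> Cc_span G) \<and>
     (\<forall>e>0. \<exists>N. \<forall>m\<ge>N. \<forall>n\<ge>N. rnorm (p m - p n) < e)"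
  unfolding cauchy_seqs_def adist_Cc by (simp add: Cc_algebra_def)

lemma cauchy_rel_iff:
  "(p, q) \<in> crel \<longleftrightarrow>
     p \<in> cauchy \<and> q \<in> cauchy \<and> (\<lambda>n. rnorm (p n - q n)) \<longlonglongrightarrow> 0"
  unfolding cauchy_rel_def adist_Cc by simp

lemma bounded_fun_cauchy: "p \<in> cauchy \<Longrightarrow> bounded_fun (p n)"
  using bounded_fun_Cc_span cauchy_iff by blast

lemma rnorm_diff_nonneg: "bounded_fun f \<Longrightarrow> bounded_fun h \<Longrightarrow> rnorm (f - h) \<ge> 0"
  using rnorm_nonneg bounded_fun_diff by blast

lemma tendsto_0_le:
  fixes f g :: "nat \<Rightarrow> real"
  assumes "\<And>n. 0 \<le> f n" "\<And>n. f n \<le> g n" "g \<longlonglongrightarrow> 0"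
  shows "f \<longlonglongrightarrow> 0"
  by (rule tendsto_sandwich[of "\<lambda>_. 0" f _ g]) (use assms in auto)

lemma cauchy_rel_sym:
  assumes "(p, q) \<in> crel"
  shows "(q, p) \<in> crel"
proof -
  have pq: "p \<in> cauchy" "q \<in> cauchy" using assms cauchy_rel_iff by blast+
  have "rnorm (q n - p n) = rnorm (p n - q n)" for n
    using rnorm_commute bounded_fun_cauchy pq by blast
  then show ?thesis using assms by (simp add: cauchy_rel_iff)
qed

lemma cauchy_rel_trans:
  assumes "(p, q) \<in> crel" "(q, r) \<in> crel"
  shows "(p, r) \<in> crel"
proof -
  have c: "p \<in> cauchy" "q \<in> cauchy" "r \<in> cauchy" using assms cauchy_rel_iff by blast+
  have "(\<lambda>n. rnorm (p n - q n) + rnorm (q n - r n)) \<longlonglongrightarrow> 0"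
    using assms tendsto_add[of "\<lambda>n. rnorm (p n - q n)" 0 sequentially "\<lambda>n. rnorm (q n - r n)" 0]
    by (simp add: cauchy_rel_iff)
  then have "(\<lambda>n. rnorm (p n - r n)) \<longlonglongrightarrow> 0"
    by (rule tendsto_0_le[rotated 2])
      (use c bounded_fun_cauchy rnorm_diff_nonneg rnorm_triangle in blast)+
  then show ?thesis using c by (simp add: cauchy_rel_iff)
qed

lemma cauchy_rel_refl: "p \<in> cauchy \<Longrightarrow> (p, p) \<in> crel"
  unfolding cauchy_rel_iff by (simp only: diff_self rnorm_zero) simp

lemma cls_self: "p \<in> cauchy \<Longrightarrow> p \<in> cls p"
  using cauchy_rel_refl by blast

lemma cls_eqI: "(p, q) \<in> crel \<Longrightarrow> cls p = cls q"
  using cauchy_rel_sym cauchy_rel_trans by blast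

lemma cls_elems: "p \<in> cauchy \<Longrightarrow> cls p \<in> elems Cred"
  by (simp add: completion_def quotientI)

lemma rnorm_cauchy_convergent:
  assumes "p \<in> cauchy"
  obtains l where "(\<lambda>n. rnorm (p n)) \<longlonglongrightarrow> l"
proof -
  have b: "bounded_fun (p n)" for n using bounded_fun_cauchy assms by blast
  have tri: "rnorm (p m) \<le> rnorm (p m - p n) + rnorm (p n)" for m n
  proof -
    have "p m = (p m - p n) + p n" by simp
    then show ?thesis using rnorm_add[of "p m - p n" "p n"] bounded_fun_diff b by metis
  qed
  have "Cauchy (\<lambda>n. rnorm (p n))"
  proof (rule metric_CauchyI)
    fix e :: real assume "e > 0"
    then obtain N where N: "\<forall>m\<ge>N. \<forall>n\<ge>N. rnorm (p m - p n) < e"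
      using assms cauchy_iff by blast
    have "dist (rnorm (p m)) (rnorm (p n)) < e" if "m \<ge> N" "n \<ge> N" for m n
      using tri[of m n] tri[of n m] N that unfolding dist_real_def abs_less_iff by fastforce
    then show "\<exists>M. \<forall>m\<ge>M. \<forall>n\<ge>M. dist (rnorm (p m)) (rnorm (p n)) < e" by blast
  qed
  then show ?thesis using that Cauchy_convergent convergentD by blast
qed

lemma rnorm_cauchy_bounded:
  assumes "p \<in> cauchy"
  obtains M where "M > 0" "\<And>n. rnorm (p n) \<le> M"
proof -
  obtain l where "(\<lambda>n. rnorm (p n)) \<longlonglongrightarrow> l" using rnorm_cauchy_convergent assms by blast
  then have "Bseq (\<lambda>n. rnorm (p n))" using convergentI convergent_imp_Bseq by blast
  then obtain M where "M > 0" "\<And>n. norm (rnorm (p n)) \<le> M" unfolding Bseq_def by blast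
  then show ?thesis using that[of M] by (simp add: abs_le_iff)
qed

text \<open>Each error term pairs a bounded factor with a small one. This serves both for products
  of Cauchy sequences and for a change of representatives.\<close>

lemma rnorm_conv_diff:
  assumes "bounded_fun a" "bounded_fun b" "bounded_fun a'" "bounded_fun b'"
  shows "rnorm (conv a b - conv a' b')
    \<le> rnorm a * rnorm (b - b') + rnorm (a - a') * rnorm b'"
proof -
  have "conv a b - conv a' b'
      = conv a (b - b') + conv (a - a') b'"
    using assms by (simp add: conv_diff_left conv_diff_right bounded_fun_rfinite)
  then have "rnorm (conv a b - conv a' b')
      \<le> rnorm (conv a (b - b')) + rnorm (conv (a - a') b')"
    using rnorm_add bounded_fun_conv bounded_fun_diff assms by metis
  also have "\<dots> \<le> rnorm a * rnorm (b - b') + rnorm (a - a') * rnorm b'"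
    by (intro add_mono rnorm_conv bounded_fun_diff assms)
  finally show ?thesis .
qed

lemma cauchy_add:
  assumes p: "p \<in> cauchy" and q: "q \<in> cauchy"
  shows "(\<lambda>n. p n + q n) \<in> cauchy"
  unfolding cauchy_iff
proof (intro conjI allI impI)
  show "p n + q n \<in> Cc_span G" for n
    using p q unfolding cauchy_iff Cc_span_def by (simp only: fun_space.span_add)
  fix e :: real assume "e > 0"
  then have e2: "e / 2 > 0" by simp
  obtain N1 where N1: "\<forall>m\<ge>N1. \<forall>n\<ge>N1. rnorm (p m - p n) < e / 2" using p e2 cauchy_iff by blast
  obtain N2 where N2: "\<forall>m\<ge>N2. \<forall>n\<ge>N2. rnorm (q m - q n) < e / 2" using q e2 cauchy_iff by blast
  have "rnorm ((p m + q m) - (p n + q n)) < e" if "m \<ge> max N1 N2" "n \<ge> max N1 N2" for m n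
  proof -
    have "(p m + q m) - (p n + q n) = (p m - p n) + (q m - q n)" by simp
    then have "rnorm ((p m + q m) - (p n + q n)) \<le> rnorm (p m - p n) + rnorm (q m - q n)"
      using rnorm_add bounded_fun_diff bounded_fun_cauchy p q by metis
    also have "\<dots> < e / 2 + e / 2" using N1 N2 that by (intro add_strict_mono) auto
    finally show ?thesis by simp
  qed
  then show "\<exists>N. \<forall>m\<ge>N. \<forall>n\<ge>N. rnorm ((p m + q m) - (p n + q n)) < e" by blast
qed

lemma cauchy_scale:
  assumes p: "p \<in> cauchy"
  shows "(\<lambda>n. fscale c (p n)) \<in> cauchy"
  unfolding cauchy_iff
proof (intro conjI allI impI)
  show "fscale c (p n) \<in> Cc_span G" for n
    using p unfolding cauchy_iff Cc_span_def by (simp only: fun_space.span_scale)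
  fix e :: real assume e: "e > 0"
  have c: "cmod c + 1 > 0" by (simp add: add_nonneg_pos)
  then have "e / (cmod c + 1) > 0" using e by simp
  then obtain N where N: "\<forall>m\<ge>N. \<forall>n\<ge>N. rnorm (p m - p n) < e / (cmod c + 1)"
    using p cauchy_iff by blast
  have "rnorm (fscale c (p m) - fscale c (p n)) < e" if "m \<ge> N" "n \<ge> N" for m n
  proof -
    have "fscale c (p m) - fscale c (p n) = fscale c (p m - p n)"
      by (auto simp: fscale_def fun_eq_iff algebra_simps)
    then have "rnorm (fscale c (p m) - fscale c (p n)) \<le> cmod c * rnorm (p m - p n)"
      using rnorm_scale bounded_fun_diff bounded_fun_cauchy p by metis
    also have "\<dots> \<le> (cmod c + 1) * rnorm (p m - p n)"
      using rnorm_diff_nonneg bounded_fun_cauchy p by (intro mult_right_mono) auto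
    also have "\<dots> < (cmod c + 1) * (e / (cmod c + 1))"
      using N that c by (intro mult_strict_left_mono) auto
    also have "\<dots> = e" using c by simp
    finally show ?thesis .
  qed
  then show "\<exists>N. \<forall>m\<ge>N. \<forall>n\<ge>N. rnorm (fscale c (p m) - fscale c (p n)) < e" by blast
qed

lemma aplus_cls:
  assumes p: "p \<in> cauchy" and q: "q \<in> cauchy"
  shows "aplus Cred (cls p) (cls q) = cls (\<lambda>n. p n + q n)"
proof -
  have "cls (\<lambda>n. p' n + q' n) = cls (\<lambda>n. p n + q n)" if "p' \<in> cls p" "q' \<in> cls q" for p' q'
  proof (rule cls_eqI)
    have r: "(p', p) \<in> crel" "(q', q) \<in> crel"
      using that cauchy_rel_sym by blast+
    then have c: "p' \<in> cauchy" "q' \<in> cauchy" using cauchy_rel_iff by blast+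
    have "(\<lambda>n. rnorm (p' n - p n) + rnorm (q' n - q n)) \<longlonglongrightarrow> 0"
      using r tendsto_add[of "\<lambda>n. rnorm (p' n - p n)" 0 sequentially "\<lambda>n. rnorm (q' n - q n)" 0]
      by (simp add: cauchy_rel_iff)
    then have "(\<lambda>n. rnorm ((p' n + q' n) - (p n + q n))) \<longlonglongrightarrow> 0"
    proof (rule tendsto_0_le[rotated 2])
      fix n
      have b: "bounded_fun (p' n)" "bounded_fun (q' n)" "bounded_fun (p n)" "bounded_fun (q n)"
        using c p q bounded_fun_cauchy by auto
      then show "rnorm ((p' n + q' n) - (p n + q n)) \<ge> 0"
        using rnorm_diff_nonneg bounded_fun_add by blast
      have "(p' n + q' n) - (p n + q n) = (p' n - p n) + (q' n - q n)" by simp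
      then show "rnorm ((p' n + q' n) - (p n + q n)) \<le> rnorm (p' n - p n) + rnorm (q' n - q n)"
        using rnorm_add bounded_fun_diff b by metis
    qed
    then show "((\<lambda>n. p' n + q' n), (\<lambda>n. p n + q n)) \<in> crel"
      using cauchy_add c p q by (simp add: cauchy_rel_iff)
  qed
  then have "cls (\<lambda>n. p' n + q' n) \<subseteq> cls (\<lambda>n. p n + q n)" if "p' \<in> cls p" "q' \<in> cls q" for p' q'
    by (simp only: that order_refl)
  then have "(\<Union>p'\<in>cls p. \<Union>q'\<in>cls q. cls (\<lambda>n. p' n + q' n)) = cls (\<lambda>n. p n + q n)"
    using cls_self[OF p] cls_self[OF q] by blast
  then show ?thesis by (simp add: completion_def Cc_algebra_def)
qed

lemma ascale_cls:
  assumes p: "p \<in> cauchy"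
  shows "ascale Cred c (cls p) = cls (\<lambda>n. fscale c (p n))"
proof -
  have "cls (\<lambda>n. fscale c (p' n)) = cls (\<lambda>n. fscale c (p n))" if "p' \<in> cls p" for p'
  proof (rule cls_eqI)
    have r: "(p', p) \<in> crel" using that cauchy_rel_sym by blast
    then have c: "p' \<in> cauchy" using cauchy_rel_iff by blast
    have "(\<lambda>n. cmod c * rnorm (p' n - p n)) \<longlonglongrightarrow> 0"
      using r tendsto_mult_right_zero[of "\<lambda>n. rnorm (p' n - p n)" sequentially "cmod c"]
      by (simp add: cauchy_rel_iff)
    then have "(\<lambda>n. rnorm (fscale c (p' n) - fscale c (p n))) \<longlonglongrightarrow> 0"
    proof (rule tendsto_0_le[rotated 2])
      fix n
      have b: "bounded_fun (p' n)" "bounded_fun (p n)" using c p bounded_fun_cauchy by auto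
      then show "rnorm (fscale c (p' n) - fscale c (p n)) \<ge> 0"
        using rnorm_diff_nonneg bounded_fun_scale by blast
      have "fscale c (p' n) - fscale c (p n) = fscale c (p' n - p n)"
        by (auto simp: fscale_def fun_eq_iff algebra_simps)
      then show "rnorm (fscale c (p' n) - fscale c (p n)) \<le> cmod c * rnorm (p' n - p n)"
        using rnorm_scale bounded_fun_diff b by metis
    qed
    then show "((\<lambda>n. fscale c (p' n)), (\<lambda>n. fscale c (p n))) \<in> crel"
      using cauchy_scale c p by (simp add: cauchy_rel_iff)
  qed
  then have "cls (\<lambda>n. fscale c (p' n)) \<subseteq> cls (\<lambda>n. fscale c (p n))" if "p' \<in> cls p" for p'
    by (simp only: that order_refl)
  then have "(\<Union>p'\<in>cls p. cls (\<lambda>n. fscale c (p' n))) = cls (\<lambda>n. fscale c (p n))"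
    using cls_self[OF p] by blast
  then show ?thesis by (simp add: completion_def Cc_algebra_def)
qed

text \<open>
  The product of two classes is a union over all representatives; those representatives whose
  termwise product is not a Cauchy sequence contribute the empty set.
\<close>

lemma atimes_cls:
  assumes p: "p \<in> cauchy" and q: "q \<in> cauchy" and pq: "(\<lambda>n. conv (p n) (q n)) \<in> cauchy"
  shows "atimes Cred (cls p) (cls q) = cls (\<lambda>n. conv (p n) (q n))"
proof -
  have "cls (\<lambda>n. conv (p' n) (q' n)) \<subseteq> cls (\<lambda>n. conv (p n) (q n))"
    if "p' \<in> cls p" "q' \<in> cls q" for p' q'
  proof (cases "(\<lambda>n. conv (p' n) (q' n)) \<in> cauchy")
    case False
    then have "cls (\<lambda>n. conv (p' n) (q' n)) = {}" by (auto simp: cauchy_rel_iff)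
    then show ?thesis by simp
  next
    case True
    have "cls (\<lambda>n. conv (p' n) (q' n)) = cls (\<lambda>n. conv (p n) (q n))"
    proof (rule cls_eqI)
      have r: "(p', p) \<in> crel" "(q', q) \<in> crel"
        using that cauchy_rel_sym by blast+
      then have c: "p' \<in> cauchy" "q' \<in> cauchy" using cauchy_rel_iff by blast+
      obtain M1 where M1: "M1 > 0" "\<And>n. rnorm (p' n) \<le> M1" using rnorm_cauchy_bounded c by blast
      obtain M2 where M2: "M2 > 0" "\<And>n. rnorm (q n) \<le> M2" using rnorm_cauchy_bounded q by blast
      have "(\<lambda>n. M1 * rnorm (q' n - q n) + rnorm (p' n - p n) * M2) \<longlonglongrightarrow> M1 * 0 + 0 * M2"
        using r by (intro tendsto_intros) (auto simp: cauchy_rel_iff)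
      then have "(\<lambda>n. M1 * rnorm (q' n - q n) + rnorm (p' n - p n) * M2) \<longlonglongrightarrow> 0" by simp
      then have "(\<lambda>n. rnorm (conv (p' n) (q' n) - conv (p n) (q n))) \<longlonglongrightarrow> 0"
      proof (rule tendsto_0_le[rotated 2])
        fix n
        have b: "bounded_fun (p' n)" "bounded_fun (q' n)" "bounded_fun (p n)" "bounded_fun (q n)"
          using c p q bounded_fun_cauchy by auto
        then show "rnorm (conv (p' n) (q' n) - conv (p n) (q n)) \<ge> 0"
          using rnorm_diff_nonneg bounded_fun_conv by blast
        have "rnorm (conv (p' n) (q' n) - conv (p n) (q n))
          \<le> rnorm (p' n) * rnorm (q' n - q n) + rnorm (p' n - p n) * rnorm (q n)"
          by (rule rnorm_conv_diff[OF b])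
        also have "\<dots> \<le> M1 * rnorm (q' n - q n) + rnorm (p' n - p n) * M2"
          using M1 M2 b rnorm_diff_nonneg by (intro add_mono mult_left_mono mult_right_mono) auto
        finally show "rnorm (conv (p' n) (q' n) - conv (p n) (q n))
          \<le> M1 * rnorm (q' n - q n) + rnorm (p' n - p n) * M2" .
      qed
      then show "((\<lambda>n. conv (p' n) (q' n)), (\<lambda>n. conv (p n) (q n)))
        \<in> crel"
        using True pq by (simp add: cauchy_rel_iff)
    qed
    then show ?thesis by simp
  qed
  then have "(\<Union>p'\<in>cls p. \<Union>q'\<in>cls q. cls (\<lambda>n. conv (p' n) (q' n)))
      = cls (\<lambda>n. conv (p n) (q n))"
    using cls_self[OF p] cls_self[OF q] by blast
  then show ?thesis by (simp add: completion_def Cc_algebra_def)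
qed

lemma anorm_cls:
  assumes p: "p \<in> cauchy" and l: "(\<lambda>n. rnorm (p n)) \<longlonglongrightarrow> l"
  shows "anorm Cred (cls p) = l"
proof -
  have "(\<lambda>n. rnorm (q n)) \<longlonglongrightarrow> l" if "q \<in> cls p" for q
  proof -
    have r: "(q, p) \<in> crel" using that cauchy_rel_sym by blast
    then have q: "q \<in> cauchy" using cauchy_rel_iff by blast
    have b: "bounded_fun (q n)" "bounded_fun (p n)" for n using p q bounded_fun_cauchy by auto
    have bd: "norm (rnorm (q n) - rnorm (p n)) \<le> rnorm (q n - p n)" for n
    proof -
      have "q n = (q n - p n) + p n" "p n = (p n - q n) + q n" by simp_all
      then have "rnorm (q n) \<le> rnorm (q n - p n) + rnorm (p n)"
        "rnorm (p n) \<le> rnorm (p n - q n) + rnorm (q n)"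
        using rnorm_add bounded_fun_diff b by metis+
      then show ?thesis using rnorm_commute[OF b] by simp
    qed
    have lim: "(\<lambda>n. rnorm (q n - p n)) \<longlonglongrightarrow> 0" using r cauchy_rel_iff by blast
    have "(\<lambda>n. norm (rnorm (q n) - rnorm (p n))) \<longlonglongrightarrow> 0"
      by (rule tendsto_0_le[OF norm_ge_zero bd lim])
    then have "(\<lambda>n. rnorm (q n) - rnorm (p n)) \<longlonglongrightarrow> 0" by (rule tendsto_norm_zero_cancel)
    then show ?thesis using tendsto_add[OF _ l] by force
  qed
  then have "(THE l. \<forall>q\<in>cls p. (\<lambda>n. rnorm (q n)) \<longlonglongrightarrow> l) = l"
    using cls_self[OF p] LIMSEQ_unique by (intro the_equality) blast+
  then show ?thesis by (simp add: completion_def Cc_algebra_def)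
qed

text \<open>By density every class has a representative of this kind, and termwise products of such
  sequences are Cauchy again, since the Steinberg algebra is closed under convolution. Working with
  them bypasses the question whether \<open>Cc_span G\<close> is closed under convolution.\<close>

definition steinberg_seqs :: "(nat \<Rightarrow> 'a \<Rightarrow> complex) set" where
  "steinberg_seqs = {p \<in> cauchy. \<forall>n. p n \<in> steinberg}"

lemma const_steinberg_seqs: "f \<in> steinberg \<Longrightarrow> (\<lambda>_. f) \<in> steinberg_seqs"
  using steinberg_subset_Cc_span
  by (auto simp only: steinberg_seqs_def cauchy_iff diff_self rnorm_zero)

lemma steinberg_seqs_add:
  "p \<in> steinberg_seqs \<Longrightarrow> q \<in> steinberg_seqs \<Longrightarrow> (\<lambda>n. p n + q n) \<in> steinberg_seqs"
  and steinberg_seqs_scale: "p \<in> steinberg_seqs \<Longrightarrow> (\<lambda>n. fscale c (p n)) \<in> steinberg_seqs"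
  using cauchy_add cauchy_scale steinberg_add steinberg_scale by (auto simp: steinberg_seqs_def)

lemma steinberg_seqs_conv:
  assumes p: "p \<in> steinberg_seqs" and q: "q \<in> steinberg_seqs"
  shows "(\<lambda>n. conv (p n) (q n)) \<in> steinberg_seqs"
proof -
  have c: "p \<in> cauchy" "q \<in> cauchy" and s: "\<And>n. p n \<in> steinberg" "\<And>n. q n \<in> steinberg"
    using p q by (auto simp: steinberg_seqs_def)
  have b: "bounded_fun (p n)" "bounded_fun (q n)" for n using c bounded_fun_cauchy by auto
  obtain M1 where M1: "M1 > 0" "\<And>n. rnorm (p n) \<le> M1" using rnorm_cauchy_bounded c by blast
  obtain M2 where M2: "M2 > 0" "\<And>n. rnorm (q n) \<le> M2" using rnorm_cauchy_bounded c by blast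
  have "\<exists>N. \<forall>m\<ge>N. \<forall>n\<ge>N. rnorm (conv (p m) (q m) - conv (p n) (q n)) < e"
    if e: "e > 0" for e
  proof -
    obtain N1 where N1: "\<forall>m\<ge>N1. \<forall>n\<ge>N1. rnorm (q m - q n) < e / (2 * M1)"
      using c(2) e M1(1) unfolding cauchy_iff by (meson divide_pos_pos mult_pos_pos zero_less_numeral)
    obtain N2 where N2: "\<forall>m\<ge>N2. \<forall>n\<ge>N2. rnorm (p m - p n) < e / (2 * M2)"
      using c(1) e M2(1) unfolding cauchy_iff by (meson divide_pos_pos mult_pos_pos zero_less_numeral)
    have "rnorm (conv (p m) (q m) - conv (p n) (q n)) < e"
      if "m \<ge> max N1 N2" "n \<ge> max N1 N2" for m n
    proof -
      have "rnorm (conv (p m) (q m) - conv (p n) (q n))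
        \<le> rnorm (p m) * rnorm (q m - q n) + rnorm (p m - p n) * rnorm (q n)"
        by (rule rnorm_conv_diff[OF b b])
      also have "\<dots> \<le> M1 * rnorm (q m - q n) + rnorm (p m - p n) * M2"
        using M1 M2 b rnorm_diff_nonneg by (intro add_mono mult_left_mono mult_right_mono) auto
      also have "\<dots> < M1 * (e / (2 * M1)) + e / (2 * M2) * M2"
        using N1 N2 M1 M2 that by (intro add_strict_mono mult_strict_left_mono mult_strict_right_mono) auto
      also have "\<dots> = e" using M1(1) M2(1) by simp
      finally show ?thesis .
    qed
    then show ?thesis by blast
  qed
  then show ?thesis
    using s steinberg_conv steinberg_subset_Cc_span unfolding steinberg_seqs_def cauchy_iff by blast
qed

lemma completion_elem_steinberg_seqs:
  assumes "P \<in> elems Cred"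
  obtains p where "p \<in> steinberg_seqs" "P = cls p"
proof -
  obtain q where q: "q \<in> cauchy" "P = cls q"
    using assms by (auto simp: completion_def elim: quotientE)
  \<comment> \<open>The tolerances tend to 0, so the chosen sequence is Cauchy and equivalent to
    \<open>q\<close>.\<close>
  have "\<exists>h\<in>steinberg. rnorm (q n - h) < inverse (real (Suc n))" for n
    using q(1) by (intro steinberg_dense) (auto simp: cauchy_iff)
  then obtain p where p: "\<And>n. p n \<in> steinberg" "\<And>n. rnorm (q n - p n) < inverse (real (Suc n))"
    by metis
  have b: "bounded_fun (p n)" "bounded_fun (q n)" for n
    using p bounded_fun_steinberg bounded_fun_cauchy q by auto
  have lim: "(\<lambda>n. rnorm (q n - p n)) \<longlonglongrightarrow> 0"
    using LIMSEQ_inverse_real_of_nat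
    by (rule tendsto_0_le[rotated 2]) (use p(2) b rnorm_diff_nonneg less_imp_le in blast)+
  have "\<exists>N. \<forall>m\<ge>N. \<forall>n\<ge>N. rnorm (p m - p n) < e" if e: "e > 0" for e
  proof -
    have e3: "e / 3 > 0" using e by simp
    obtain N1 where N1: "\<forall>m\<ge>N1. \<forall>n\<ge>N1. rnorm (q m - q n) < e / 3" using q e3 cauchy_iff by blast
    obtain N2 where N2: "\<And>n. n \<ge> N2 \<Longrightarrow> rnorm (q n - p n) < e / 3"
      using order_tendstoD(2)[OF lim e3] unfolding eventually_sequentially by blast
    have "rnorm (p m - p n) < e" if mn: "m \<ge> max N1 N2" "n \<ge> max N1 N2" for m n
    proof -
      have "rnorm (p m - p n) \<le> rnorm (p m - q m) + rnorm (q m - p n)"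
        by (rule rnorm_triangle[OF b(1) b(2) b(1)])
      also have "\<dots> \<le> rnorm (p m - q m) + (rnorm (q m - q n) + rnorm (q n - p n))"
        by (rule add_left_mono, rule rnorm_triangle[OF b(2) b(2) b(1)])
      also have "rnorm (p m - q m) = rnorm (q m - p m)" by (rule rnorm_commute[OF b])
      finally have "rnorm (p m - p n) \<le> rnorm (q m - p m) + (rnorm (q m - q n) + rnorm (q n - p n))" .
      also have "\<dots> < e / 3 + (e / 3 + e / 3)"
        using N1 N2 mn by (intro add_strict_mono) auto
      finally show ?thesis by simp
    qed
    then show ?thesis by blast
  qed
  then have pc: "p \<in> cauchy" using p(1) steinberg_subset_Cc_span by (auto simp: cauchy_iff)
  then have "cls q = cls p" using lim q(1) by (intro cls_eqI) (simp add: cauchy_rel_iff)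
  then show ?thesis using that[of p] pc p(1) q(2) by (simp add: steinberg_seqs_def)
qed

end

section \<open>Closed ideals in terms of sequences in the Steinberg algebra\<close>

locale closed_ideal = nonempty_ample_groupoid G for G :: "'a topgroupoid" +
  fixes I :: "(nat \<Rightarrow> 'a \<Rightarrow> complex) set set"
  assumes ideal: "two_sided_ideal Cred I"
    and closed: "norm_closed Cred I"
begin

definition ideal_seqs :: "(nat \<Rightarrow> 'a \<Rightarrow> complex) set" where
  "ideal_seqs = {p \<in> steinberg_seqs. cls p \<in> I}"

lemma steinberg_seqsD: "p \<in> steinberg_seqs \<Longrightarrow> p \<in> cauchy" "p \<in> steinberg_seqs \<Longrightarrow> p n \<in> steinberg"
  by (auto simp: steinberg_seqs_def)

lemma ideal_seqsD: "p \<in> ideal_seqs \<Longrightarrow> p \<in> steinberg_seqs" "p \<in> ideal_seqs \<Longrightarrow> p n \<in> steinberg"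
  by (auto simp: ideal_seqs_def steinberg_seqs_def)

lemma ideal_seqs_add:
  assumes "p \<in> ideal_seqs" "q \<in> ideal_seqs"
  shows "(\<lambda>n. p n + q n) \<in> ideal_seqs"
proof -
  have s: "p \<in> steinberg_seqs" "q \<in> steinberg_seqs" "cls p \<in> I" "cls q \<in> I"
    using assms by (simp_all add: ideal_seqs_def)
  have "aplus Cred (cls p) (cls q) \<in> I"
    using ideal s(3,4) unfolding two_sided_ideal_def by blast
  then show ?thesis
    unfolding aplus_cls[OF steinberg_seqsD(1)[OF s(1)] steinberg_seqsD(1)[OF s(2)]]
    using steinberg_seqs_add[OF s(1,2)] by (simp add: ideal_seqs_def)
qed

lemma ideal_seqs_scale:
  assumes "p \<in> ideal_seqs"
  shows "(\<lambda>n. fscale c (p n)) \<in> ideal_seqs"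
proof -
  have s: "p \<in> steinberg_seqs" "cls p \<in> I"
    using assms by (simp_all add: ideal_seqs_def)
  have "ascale Cred c (cls p) \<in> I"
    using ideal s(2) unfolding two_sided_ideal_def by blast
  then show ?thesis
    unfolding ascale_cls[OF steinberg_seqsD(1)[OF s(1)]]
    using steinberg_seqs_scale[OF s(1)] by (simp add: ideal_seqs_def)
qed

lemma ideal_seqs_conv:
  assumes p: "p \<in> ideal_seqs" and q: "q \<in> steinberg_seqs"
  shows "(\<lambda>n. conv (p n) (q n)) \<in> ideal_seqs" "(\<lambda>n. conv (q n) (p n)) \<in> ideal_seqs"
proof -
  have ps: "p \<in> steinberg_seqs" "cls p \<in> I" using p by (auto simp: ideal_seqs_def)
  have 1: "(\<lambda>n. conv (p n) (q n)) \<in> steinberg_seqs" "(\<lambda>n. conv (q n) (p n)) \<in> steinberg_seqs"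
    using steinberg_seqs_conv ps q by blast+
  have 2: "atimes Cred (cls p) (cls q) \<in> I"
    "atimes Cred (cls q) (cls p) \<in> I"
    using ideal ps cls_elems[OF steinberg_seqsD(1)[OF q]] unfolding two_sided_ideal_def by blast+
  note c = steinberg_seqsD(1)[OF ps(1)] steinberg_seqsD(1)[OF q]
  show "(\<lambda>n. conv (p n) (q n)) \<in> ideal_seqs"
    using 2(1) 1(1) unfolding atimes_cls[OF c steinberg_seqsD(1)[OF 1(1)]] ideal_seqs_def by simp
  show "(\<lambda>n. conv (q n) (p n)) \<in> ideal_seqs"
    using 2(2) 1(2) unfolding atimes_cls[OF c(2,1) steinberg_seqsD(1)[OF 1(2)]] ideal_seqs_def by simp
qed

text \<open>The distance of two classes is the limit of the distances of the terms, so a bound that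
  holds eventually passes to the classes and closedness of \<open>I\<close> applies.\<close>

lemma ideal_seqs_closed:
  assumes q: "q \<in> steinberg_seqs"
    and ap: "\<And>e. e > 0 \<Longrightarrow> \<exists>p\<in>ideal_seqs. \<forall>\<^sub>F n in sequentially. rnorm (q n - p n) \<le> e"
  shows "q \<in> ideal_seqs"
proof -
  have qc: "q \<in> cauchy" using q steinberg_seqsD by blast
  have "\<exists>P\<in>I. adist Cred (cls q) P < e" if e: "e > 0" for e
  proof -
    obtain p where p: "p \<in> ideal_seqs" "\<forall>\<^sub>F n in sequentially. rnorm (q n - p n) \<le> e / 2"
      using ap[of "e / 2"] e by auto
    have pc: "p \<in> cauchy" "cls p \<in> I" using p(1) by (auto simp: ideal_seqs_def steinberg_seqs_def)
    let ?d = "\<lambda>n. q n + fscale (- 1) (p n)"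
    have dc: "?d \<in> cauchy" using cauchy_add[OF qc cauchy_scale[OF pc(1)]] .
    obtain l where l: "(\<lambda>n. rnorm (?d n)) \<longlonglongrightarrow> l" using rnorm_cauchy_convergent[OF dc] by blast
    have "adist Cred (cls q) (cls p) = anorm Cred (cls ?d)"
      unfolding adist_def
      by (simp only: ascale_cls[OF pc(1)] aplus_cls[OF qc cauchy_scale[OF pc(1)]])
    also have "\<dots> = l" by (rule anorm_cls[OF dc l])
    also have "l \<le> e / 2"
      using l p(2) unfolding diff_eq_add_fscale by (rule tendsto_upperbound) simp
    also have "\<dots> < e" using e by simp
    finally show ?thesis using pc(2) by blast
  qed
  then have "cls q \<in> I" using closed cls_elems[OF qc] unfolding norm_closed_def by blast
  then show ?thesis using q by (simp add: ideal_seqs_def)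
qed

lemma ideal_seqs_nonzero:
  assumes "I \<noteq> {azero Cred}"
  obtains p where "p \<in> ideal_seqs" "\<not> (\<lambda>n. rnorm (p n)) \<longlonglongrightarrow> 0"
proof -
  have "azero Cred \<in> I" using ideal by (simp add: two_sided_ideal_def)
  then obtain P where P: "P \<in> I" "P \<noteq> azero Cred" using assms by blast
  then have "P \<in> elems Cred" using ideal by (auto simp: two_sided_ideal_def)
  then obtain p where p: "p \<in> steinberg_seqs" "P = cls p" using completion_elem_steinberg_seqs by blast
  have z: "azero Cred = cls (\<lambda>_. 0)" by (simp add: completion_def Cc_algebra_def)
  have "\<not> (\<lambda>n. rnorm (p n)) \<longlonglongrightarrow> 0"
  proof
    assume "(\<lambda>n. rnorm (p n)) \<longlonglongrightarrow> 0"
    then have "(p, \<lambda>_. 0) \<in> crel"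
      using steinberg_seqsD(1)[OF p(1)] steinberg_seqsD(1)[OF const_steinberg_seqs[OF steinberg_zero]]
      by (simp only: cauchy_rel_iff diff_zero simp_thms)
    then show False using cls_eqI P(2) p(2) z by blast
  qed
  then show ?thesis using that p P(1) by (simp add: ideal_seqs_def)
qed

text \<open>The intersection of \<open>I\<close> with the Steinberg algebra, whose elements enter
  the completion as constant sequences.\<close>

definition ideal_trace :: "('a \<Rightarrow> complex) set" where
  "ideal_trace = {f \<in> steinberg. (\<lambda>_. f) \<in> ideal_seqs}"

lemma two_sided_ideal_trace: "two_sided_ideal (steinberg_algebra G) ideal_trace"
proof -
  have z: "azero Cred = cls (\<lambda>_. 0)" by (simp add: completion_def Cc_algebra_def)
  then have "(\<lambda>_. 0) \<in> ideal_seqs"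
    using ideal const_steinberg_seqs[OF steinberg_zero] by (auto simp: ideal_seqs_def two_sided_ideal_def)
  then have 0: "0 \<in> ideal_trace" using steinberg_zero by (simp add: ideal_trace_def)
  have 1: "f + h \<in> ideal_trace" if "f \<in> ideal_trace" "h \<in> ideal_trace" for f h
    using that ideal_seqs_add[of "\<lambda>_. f" "\<lambda>_. h"] steinberg_add by (simp add: ideal_trace_def)
  have 2: "fscale c f \<in> ideal_trace" if "f \<in> ideal_trace" for c f
    using that ideal_seqs_scale[of "\<lambda>_. f"] steinberg_scale by (simp add: ideal_trace_def)
  have 3: "conv a f \<in> ideal_trace" "conv f a \<in> ideal_trace"
    if "f \<in> ideal_trace" "a \<in> steinberg" for a f
    using that ideal_seqs_conv[of "\<lambda>_. f" "\<lambda>_. a"] const_steinberg_seqs steinberg_conv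
    by (auto simp: ideal_trace_def)
  have "ideal_trace \<subseteq> steinberg" by (auto simp: ideal_trace_def)
  then show ?thesis
    using 0 1 2 3 unfolding two_sided_ideal_def by (simp add: steinberg_algebra_def)
qed

text \<open>A Cauchy sequence in the Steinberg algebra is a limit of the constant sequences at its
  own terms, and these represent elements of \<open>I\<close> by assumption.\<close>

lemma ideal_eq_completion:
  assumes "steinberg \<subseteq> ideal_trace"
  shows "I = elems Cred"
proof
  show "I \<subseteq> elems Cred" using ideal by (simp add: two_sided_ideal_def)
  show "elems Cred \<subseteq> I"
  proof
    fix P assume "P \<in> elems Cred"
    then obtain q where q: "q \<in> steinberg_seqs" "P = cls q" using completion_elem_steinberg_seqs by blast
    have "q \<in> ideal_seqs"
    proof (rule ideal_seqs_closed[OF q(1)])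
      fix e :: real assume "e > 0"
      then obtain N where N: "\<forall>m\<ge>N. \<forall>n\<ge>N. rnorm (q m - q n) < e"
        using q(1) steinberg_seqsD(1) cauchy_iff by blast
      have "(\<lambda>_. q N) \<in> ideal_seqs" using assms steinberg_seqsD(2)[OF q(1)] by (auto simp: ideal_trace_def)
      moreover have "\<forall>\<^sub>F n in sequentially. rnorm (q n - q N) \<le> e"
        unfolding eventually_sequentially using N less_imp_le by blast
      ultimately show "\<exists>p\<in>ideal_seqs. \<forall>\<^sub>F n in sequentially. rnorm (q n - p n) \<le> e"
        by (intro bexI[of _ "\<lambda>_. q N"])
    qed
    then show "P \<in> I" using q(2) by (simp add: ideal_seqs_def)
  qed
qed

text \<open>The relation \<open>near\<close> encodes the quotient seminorm on the Steinberg algebra.\<close>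

definition near :: "('a \<Rightarrow> complex) \<Rightarrow> real \<Rightarrow> bool" where
  "near f e \<longleftrightarrow> (\<exists>p\<in>ideal_seqs. \<forall>\<^sub>F n in sequentially. rnorm (f - p n) \<le> e)"

lemma near_scale:
  assumes f: "f \<in> steinberg" "near f e"
  shows "near (fscale c f) (cmod c * e)"
proof -
  obtain p where p: "p \<in> ideal_seqs" "\<forall>\<^sub>F n in sequentially. rnorm (f - p n) \<le> e"
    using f(2) near_def by blast
  have "rnorm (fscale c f - fscale c (p n)) \<le> cmod c * e" if "rnorm (f - p n) \<le> e" for n
  proof -
    have "fscale c f - fscale c (p n) = fscale c (f - p n)"
      by (auto simp: fscale_def fun_eq_iff algebra_simps)
    then have "rnorm (fscale c f - fscale c (p n)) \<le> cmod c * rnorm (f - p n)"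
      using rnorm_scale bounded_fun_diff bounded_fun_steinberg f(1) ideal_seqsD(2)[OF p(1)] by metis
    also have "\<dots> \<le> cmod c * e" using that by (simp add: mult_left_mono)
    finally show ?thesis .
  qed
  then have "\<forall>\<^sub>F n in sequentially. rnorm (fscale c f - fscale c (p n)) \<le> cmod c * e"
    using p(2) by (rule eventually_mono[rotated])
  then show ?thesis
    unfolding near_def by (intro bexI[of _ "\<lambda>n. fscale c (p n)"] ideal_seqs_scale[OF p(1)])
qed

text \<open>Submultiplicativity of the quotient seminorm: the product of \<open>f - p n\<close> and
  \<open>h - q n\<close> differs from \<open>conv f h\<close> by \<open>?r n\<close>, every summand
  of which has a factor from the ideal.\<close>

lemma near_conv:
  assumes f: "f \<in> steinberg" "near f e" and h: "h \<in> steinberg" "near h d"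
  shows "near (conv f h) (e * d)"
proof -
  obtain p where p: "p \<in> ideal_seqs" "\<forall>\<^sub>F n in sequentially. rnorm (f - p n) \<le> e"
    using f(2) near_def by blast
  obtain q where q: "q \<in> ideal_seqs" "\<forall>\<^sub>F n in sequentially. rnorm (h - q n) \<le> d"
    using h(2) near_def by blast
  have b: "bounded_fun (p n)" "bounded_fun (q n)" "bounded_fun f" "bounded_fun h" for n
    using bounded_fun_steinberg ideal_seqsD(2) p q f h by auto
  let ?r = "\<lambda>n. (conv (p n) h + conv f (q n)) + fscale (- 1) (conv (p n) (q n))"
  have r: "?r \<in> ideal_seqs"
    using ideal_seqs_conv(1)[OF p(1) const_steinberg_seqs[OF h(1)]]
      ideal_seqs_conv(2)[OF q(1) const_steinberg_seqs[OF f(1)]]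
      ideal_seqs_conv(1)[OF p(1) ideal_seqsD(1)[OF q(1)]]
    by (intro ideal_seqs_add ideal_seqs_scale)
  have "rnorm (conv f h - ?r n) \<le> e * d" if n: "rnorm (f - p n) \<le> e \<and> rnorm (h - q n) \<le> d" for n
  proof -
    have rf: "rfinite f" "rfinite (p n)" "rfinite (f - p n)"
      using b bounded_fun_rfinite bounded_fun_diff by auto
    have "conv (f - p n) (h - q n) = conv f h - ?r n"
      unfolding conv_diff_left[OF rf(1,2)] conv_diff_right[OF rf(1)] conv_diff_right[OF rf(2)]
      by (auto simp: fscale_def fun_eq_iff algebra_simps)
    then have "rnorm (conv f h - ?r n) \<le> rnorm (f - p n) * rnorm (h - q n)"
      using rnorm_conv bounded_fun_diff b by metis
    also have "\<dots> \<le> e * d"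
      using n rnorm_diff_nonneg[OF b(3) b(1)[of n]] rnorm_diff_nonneg[OF b(4) b(2)[of n]]
      by (intro mult_mono) auto
    finally show ?thesis .
  qed
  then have "\<forall>\<^sub>F n in sequentially. rnorm (conv f h - ?r n) \<le> e * d"
    using eventually_conj[OF p(2) q(2)] by (rule eventually_mono[rotated])
  then show ?thesis unfolding near_def by (intro bexI[OF _ r])
qed

lemma near_rnorm: "f \<in> steinberg \<Longrightarrow> rnorm f \<le> e \<Longrightarrow> near f e"
proof -
  assume f: "f \<in> steinberg" "rnorm f \<le> e"
  have "(\<lambda>_. 0) \<in> ideal_seqs"
    using two_sided_ideal_trace by (simp add: two_sided_ideal_def ideal_trace_def steinberg_algebra_def)
  moreover have "rnorm (f - 0) \<le> e" using f(2) by (simp only: diff_zero)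
  ultimately show ?thesis unfolding near_def by (intro bexI[of _ "\<lambda>_. 0"]) auto
qed

lemma ideal_traceI:
  assumes "f \<in> steinberg" "\<And>e. e > 0 \<Longrightarrow> near f e"
  shows "f \<in> ideal_trace"
  using ideal_seqs_closed[OF const_steinberg_seqs[OF assms(1)]] assms by (simp add: ideal_trace_def near_def)

text \<open>The powers of \<open>f\<close> equal \<open>f\<close>, while the bounds on their distances from the ideal tend to 0.\<close>

lemma near_idempotent:
  assumes f: "f \<in> steinberg" "conv f f = f" and d: "near f d" "0 \<le> d" "d < 1"
  shows "f \<in> ideal_trace"
proof (rule ideal_traceI[OF f(1)])
  fix e :: real assume e: "e > 0"
  have pow: "near f (d ^ Suc n)" for n
  proof (induction n)
    case (Suc n)
    then show ?case using near_conv[OF f(1) d(1) f(1) Suc] f(2) by simp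
  qed (use d in simp)
  obtain n where "d ^ n < e" using real_arch_pow_inv[OF e d(3)] by blast
  then have "d ^ Suc n \<le> e" using d power_Suc_le_self[of d n] by (smt (verit) mult_left_le_one_le power_Suc zero_le_power)
  then show "near f e" using pow[of n] unfolding near_def by (meson eventually_mono order_trans)
qed

end

section \<open>Simple Steinberg algebras\<close>

locale simple_steinberg = nonempty_ample_groupoid G for G :: "'a topgroupoid" +
  assumes simple: "simple_algebra (steinberg_algebra G)"
begin

lemma steinberg_ideal_cases:
  assumes "J \<subseteq> steinberg" "0 \<in> J"
    and "\<And>f h. f \<in> J \<Longrightarrow> h \<in> J \<Longrightarrow> f + h \<in> J"
    and "\<And>c f. f \<in> J \<Longrightarrow> fscale c f \<in> J"
    and "\<And>a f. a \<in> steinberg \<Longrightarrow> f \<in> J \<Longrightarrow> conv a f \<in> J"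
    and "\<And>a f. a \<in> steinberg \<Longrightarrow> f \<in> J \<Longrightarrow> conv f a \<in> J"
  shows "J = {0} \<or> J = steinberg"
proof -
  have "two_sided_ideal (steinberg_algebra G) J"
    using assms unfolding two_sided_ideal_def by (simp add: steinberg_algebra_def)
  then have "J = {azero (steinberg_algebra G)} \<or> J = steinberg"
    using simple unfolding simple_algebra_def by blast
  then show ?thesis by (simp add: steinberg_algebra_def)
qed

text \<open>
  The kernel of the representation of the Steinberg algebra on functions \<open>\<phi>\<close> on the unit space is a
  proper ideal; here \<open>\<phi>\<close> is encoded as the function \<open>\<phi> \<circ> rng G\<close> on arrows.
\<close>

lemma isotropic_bisection_subset_units:
  assumes U: "compact_bisection U" and iso: "\<And>u. u \<in> U \<Longrightarrow> src G u = rng G u"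
  shows "U \<subseteq> units G"
proof (cases "U = {}")
  case False
  define E :: "('a \<Rightarrow> complex) \<Rightarrow> 'a \<Rightarrow> complex"
    where "E \<phi> = (\<lambda>g. if g \<in> arrows G then \<phi> (rng G g) else 0)" for \<phi>
  define J where "J = {f \<in> steinberg. \<forall>\<phi>. conv f (E \<phi>) = 0}"
  \<comment> \<open>The functions of the range alone form an invariant subspace; this is what makes
    the kernel \<open>J\<close> stable under multiplication from the right.\<close>
  have E: "conv a (E \<phi>) = E (conv a (E \<phi>))" if a: "a \<in> steinberg" for a \<phi>
  proof
    fix g
    show "conv a (E \<phi>) g = E (conv a (E \<phi>)) g"
    proof (cases "g \<in> arrows G")
      case True
      have "E \<phi> (ginv G u \<cdot> g) = E \<phi> (ginv G u \<cdot> rng G g)" if "u \<in> arrows G" "rng G u = rng G g" for u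
        using that True by (simp add: E_def ginv_closed src_ginv rng_ginv rng_closed rng_rng)
      then show ?thesis
        using True by (simp add: E_def[of "conv a (E \<phi>)"] rng_closed rng_rng
            conv_rfinite[OF rfinite_steinberg[OF a]])
    qed (simp add: E_def conv_outside)
  qed
  have Ub: "bisection U" using U compact_bisectionD by blast
  have rU: "compact_bisection (rng G ` U)" using U compact_bisection_rng by blast
  have rUu: "rng G ` U \<subseteq> units G" using rng_units bisectionD(1)[OF Ub] by blast
  have "J = {0} \<or> J = steinberg"
  proof (rule steinberg_ideal_cases)
    show "0 \<in> J" using steinberg_zero by (simp only: J_def conv_zero_left mem_Collect_eq simp_thms)
    fix f assume f: "f \<in> J"
    then have fs: "f \<in> steinberg" and f0: "\<And>\<phi>. conv f (E \<phi>) = 0" by (auto simp: J_def)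
    show "f + h \<in> J" if "h \<in> J" for h
    proof -
      have "conv (f + h) (E \<phi>) = 0 + 0" for \<phi>
        using conv_add_left[OF rfinite_steinberg rfinite_steinberg] fs f0 that
        by (simp add: J_def)
      then show ?thesis using that steinberg_add fs by (simp add: J_def)
    qed
    show "fscale c f \<in> J" for c
    proof -
      have "conv (fscale c f) (E \<phi>) = fscale c 0" for \<phi>
        by (simp only: conv_scale_left[OF rfinite_steinberg[OF fs]] f0)
      then show ?thesis using steinberg_scale[OF fs] by (simp add: J_def fscale_zero)
    qed
    fix a assume a: "a \<in> steinberg"
    have "conv (conv a f) (E \<phi>) = 0" for \<phi>
      by (simp only: conv_assoc[OF rfinite_steinberg[OF a] rfinite_steinberg[OF fs]] f0
          conv_zero_right)
    then show "conv a f \<in> J" using steinberg_conv[OF a fs] by (simp add: J_def)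
    have "conv (conv f a) (E \<phi>) = 0" for \<phi>
      using f0 E[OF a]
      by (metis conv_assoc[OF rfinite_steinberg[OF fs] rfinite_steinberg[OF a]])
    then show "conv f a \<in> J" using steinberg_conv[OF fs a] by (simp add: J_def)
  qed (auto simp: J_def)
  moreover have "J \<noteq> steinberg"
  proof
    assume "J = steinberg"
    then have "const_on 1 (rng G ` U) \<in> J" using const_on_steinberg[OF rU] by blast
    then have z: "conv (const_on 1 (rng G ` U)) (E (\<lambda>_. 1)) = 0" by (simp add: J_def)
    obtain u where u: "u \<in> U" using False by blast
    then have ua: "u \<in> arrows G" using bisectionD(1)[OF Ub] by blast
    have "conv (const_on 1 (rng G ` U)) (E (\<lambda>_. 1)) u = 1"
      using conv_const_on_units_left[OF rUu ua] u ua by (simp add: E_def)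
    then show False using z by simp
  qed
  ultimately have J0: "J = {0}" by blast
  \<comment> \<open>An isotropic bisection and the set of its ranges both act on the unit space as
    the identity of that set, so the difference of their indicator functions acts as 0.\<close>
  let ?d = "const_on 1 U - const_on 1 (rng G ` U) :: 'a \<Rightarrow> complex"
  have "?d \<in> J"
  proof -
    have s: "const_on 1 U \<in> steinberg" "const_on 1 (rng G ` U) \<in> steinberg"
      using U rU const_on_steinberg by blast+
    have "conv (const_on 1 U) (E \<phi>) = conv (const_on 1 (rng G ` U)) (E \<phi>)" for \<phi>
    proof
      fix g
      show "conv (const_on 1 U) (E \<phi>) g = conv (const_on 1 (rng G ` U)) (E \<phi>) g"
      proof (cases "g \<in> arrows G")
        case g: True
        show ?thesis
        proof (cases "\<exists>u\<in>U. rng G u = rng G g")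
          case True
          then obtain u where u: "u \<in> U" "rng G u = rng G g" by blast
          then have ua: "u \<in> arrows G" using bisectionD(1)[OF Ub] by blast
          have "conv (const_on 1 U) (E \<phi>) g = const_on 1 U u * E \<phi> (ginv G u \<cdot> g)"
            by (rule conv_bisection[OF Ub _ u(1) g u(2)]) (simp add: const_on_def)
          also have "\<dots> = \<phi> (rng G g)"
            using u ua g iso[OF u(1)] by (simp add: const_on_def E_def ginv_closed src_ginv rng_ginv)
          also have "\<dots> = conv (const_on 1 (rng G ` U)) (E \<phi>) g"
          proof -
            have "rng G g \<in> rng G ` U" using imageI[OF u(1), of "rng G"] u(2) by simp
            then show ?thesis using conv_const_on_units_left[OF rUu g] g by (simp add: E_def)
          qed
          finally show ?thesis .
        next
          case False
          have "conv (const_on 1 U) (E \<phi>) g = 0"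
            by (rule conv_bisection_eq_0[of U]) (use False in \<open>auto simp: const_on_def\<close>)
          moreover have "rng G g \<notin> rng G ` U" using False by force
          ultimately show ?thesis using conv_const_on_units_left[OF rUu g] by simp
        qed
      qed (simp add: conv_outside)
    qed
    then have "conv ?d (E \<phi>) = 0" for \<phi>
      by (simp only: conv_diff_left[OF s[THEN rfinite_steinberg]] diff_self)
    then show ?thesis using steinberg_diff[OF s] by (simp add: J_def)
  qed
  then have d0: "?d = 0" using J0 by blast
  show ?thesis
  proof
    fix u assume u: "u \<in> U"
    have "?d u = 0" by (simp only: d0 zero_fun_def)
    then have "u \<in> rng G ` U" using u by (auto simp: const_on_def split: if_splits)
    then show "u \<in> units G" using rUu by blast
  qed
qed simp

text \<open>
  This is where effectiveness enters: a bisection disjoint from an open set of units either has no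
  source in that set or moves one of its points, so it misses the corner of a smaller set.
\<close>

lemma scalar_corner:
  assumes f: "f \<in> steinberg" and W: "gopen W" "W \<noteq> {}" "W \<subseteq> units G"
  shows "\<exists>V c. compact_bisection V \<and> V \<noteq> {} \<and> V \<subseteq> W \<and>
    (\<forall>g\<in>arrows G. src G g \<in> V \<longrightarrow> rng G g \<in> V \<longrightarrow> f g = (if g \<in> V then c else 0))"
  using f
proof (induction rule: steinberg_induct)
  case zero
  obtain w where "w \<in> W" using W by blast
  then obtain V where V: "compact_bisection V" "w \<in> V" "V \<subseteq> W"
    using compact_bisection_base[OF W(1)] by blast
  have "(0 :: 'a \<Rightarrow> complex) g = (if g \<in> V then 0 else 0)" for g by simp
  then show ?case using V by blast
next
  case (add d U h)
  then obtain V1 c1 where V1: "compact_bisection V1" "V1 \<noteq> {}" "V1 \<subseteq> W"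
    and c1: "\<And>g. g \<in> arrows G \<Longrightarrow> src G g \<in> V1 \<Longrightarrow> rng G g \<in> V1 \<Longrightarrow> h g = (if g \<in> V1 then c1 else 0)"
    by blast
  have V1u: "V1 \<subseteq> units G" using V1 W by blast
  have V1o: "gopen V1" using V1 by (simp add: compact_bisection_iff)
  have Uo: "gopen U" using add(1) by (simp add: compact_bisection_iff)
  have Ub: "bisection U" using add(1) compact_bisectionD by blast
  \<comment> \<open>Shrinking \<open>V1\<close> keeps the corner of \<open>h\<close> scalar with the
    same constant, so it suffices to find a smaller set at which \<open>const_on d U\<close> has a
    scalar corner.\<close>
  have reduce: ?case if V: "compact_bisection V" "V \<noteq> {}" "V \<subseteq> V1"
    and c: "\<And>g. g \<in> arrows G \<Longrightarrow> src G g \<in> V \<Longrightarrow> rng G g \<in> V \<Longrightarrow> const_on d U g = (if g \<in> V then c else 0)"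
    for V c
  proof -
    have "(const_on d U + h) g = (if g \<in> V then c + c1 else 0)"
      if g: "g \<in> arrows G" "src G g \<in> V" "rng G g \<in> V" for g
    proof -
      have "g \<in> V1 \<longleftrightarrow> g \<in> V" using g V(3) V1u src_unit by (metis subsetD)
      moreover have "h g = (if g \<in> V1 then c1 else 0)" using c1 g V(3) by blast
      ultimately show ?thesis using c[OF g] by simp
    qed
    then show ?thesis using V V1(3) by (intro exI[of _ V] exI[of _ "c + c1"]) auto
  qed
  consider (meet) "U \<inter> V1 \<noteq> {}" | (move) g0 where "g0 \<in> U" "src G g0 \<in> V1" "src G g0 \<noteq> rng G g0"
    | (isotropic) "U \<inter> V1 = {}" "\<And>g. g \<in> U \<Longrightarrow> src G g \<in> V1 \<Longrightarrow> src G g = rng G g"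
    by blast
  then show ?case
  proof cases
    case meet
    then obtain x where x: "x \<in> U \<inter> V1" by blast
    have "gopen (U \<inter> V1)" using Uo V1o by blast
    then obtain V where V: "compact_bisection V" "x \<in> V" "V \<subseteq> U \<inter> V1"
      using compact_bisection_base x by blast
    show ?thesis
    proof (rule reduce[of V d])
      fix g assume g: "g \<in> arrows G" "src G g \<in> V" "rng G g \<in> V"
      \<comment> \<open>The source of \<open>g\<close> lies in \<open>V\<close> and so in
        \<open>U\<close>; it is its own source, and injectivity of the source map on
        \<open>U\<close> makes it equal to \<open>g\<close>.\<close>
      have "g = src G g" if "g \<in> U"
        using bisectionD(3)[OF Ub that, of "src G g"] g V(3) src_src by force
      then have "g \<in> U \<longleftrightarrow> g \<in> V" using g V(3) by auto
      then show "const_on d U g = (if g \<in> V then d else 0)" by (simp add: const_on_def)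
    qed (use V in auto)
  next
    case move
    have g0: "g0 \<in> arrows G" using move bisectionD(1)[OF Ub] by blast
    \<comment> \<open>Source and range of \<open>g0\<close> are separated in the unit space. On
      sources close to that of \<open>g0\<close> the bisection \<open>U\<close> maps into
      \<open>B\<close>, so no arrow of \<open>U\<close> both starts and ends in a small set inside
      \<open>A\<close>.\<close>
    obtain A B where AB: "openin unit_space A"
      "openin unit_space B" "src G g0 \<in> A" "rng G g0 \<in> B" "disjnt A B"
      using Hausdorff_units move(3) src_units[OF g0] rng_units[OF g0] src_closed[OF g0] rng_closed[OF g0]
      unfolding Hausdorff_space_def by (auto simp: Int_iff) blast
    then have ABo: "gopen A" "gopen B" using open_units_iff by blast+
    let ?U = "U \<inter> {g \<in> arrows G. rng G g \<in> B}"
    have "gopen (V1 \<inter> A \<inter> src G ` ?U)"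
      by (intro openin_Int open_src open_rng_vimage V1o ABo Uo)
    moreover have "src G g0 \<in> V1 \<inter> A \<inter> src G ` ?U" using move AB g0 by blast
    ultimately obtain V where V: "compact_bisection V" "src G g0 \<in> V" "V \<subseteq> V1 \<inter> A \<inter> src G ` ?U"
      by (rule compact_bisection_base)
    show ?thesis
    proof (rule reduce[of V 0])
      fix g assume g: "g \<in> arrows G" "src G g \<in> V" "rng G g \<in> V"
      have "g \<notin> U"
      proof
        assume gU: "g \<in> U"
        obtain u where u: "u \<in> ?U" "src G g = src G u" using g V(3) by blast
        then have "g = u" using bisectionD(3)[OF Ub gU] by blast
        then have "rng G g \<in> B" using u by blast
        moreover have "rng G g \<in> A" using g V(3) by blast
        ultimately show False using AB(5) by (auto simp: disjnt_iff)
      qed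
      then show "const_on d U g = (if g \<in> V then 0 else 0)" by (simp add: const_on_def)
    qed (use V in auto)
  next
    case isotropic
    have none: "src G g \<notin> V1" if g: "g \<in> U" for g
    proof
      assume s: "src G g \<in> V1"
      have ga: "g \<in> arrows G" using g bisectionD(1)[OF Ub] by blast
      have "gopen (U \<inter> {g \<in> arrows G. src G g \<in> V1})" using Uo V1o open_src_vimage by blast
      then obtain V where V: "compact_bisection V" "g \<in> V" "V \<subseteq> U \<inter> {g \<in> arrows G. src G g \<in> V1}"
        using compact_bisection_base g s ga by blast
      \<comment> \<open>Effectiveness: an open piece of isotropy consists of units. Then
        \<open>g\<close> would be a unit in both \<open>U\<close> and \<open>V1\<close>, which are
        disjoint.\<close>
      have "V \<subseteq> units G"
        by (rule isotropic_bisection_subset_units[OF V(1)]) (use V(3) isotropic(2) in blast)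
      then have "src G g = g" using V(2) src_unit by blast
      then show False using s g isotropic(1) by auto
    qed
    show ?thesis
    proof (rule reduce[of V1 0])
      fix g assume "g \<in> arrows G" "src G g \<in> V1" "rng G g \<in> V1"
      then show "const_on d U g = (if g \<in> V1 then 0 else 0)" using none by (auto simp: const_on_def)
    qed (use V1 in auto)
  qed
qed

text \<open>Vanishing on a dense open set of arrows, in local form: the union of the sets
  \<open>W'\<close> is such a set. In this form a sum is handled by shrinking twice.\<close>

definition singular :: "('a \<Rightarrow> complex) \<Rightarrow> bool" where
  "singular f \<longleftrightarrow> (\<forall>W. gopen W \<longrightarrow> W \<noteq> {} \<longrightarrow>
     (\<exists>W'. gopen W' \<and> W' \<noteq> {} \<and> W' \<subseteq> W \<and> (\<forall>w\<in>W'. f w = 0)))"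

lemma singularI:
  "(\<And>W. gopen W \<Longrightarrow> W \<noteq> {} \<Longrightarrow>
     \<exists>W'. gopen W' \<and> W' \<noteq> {} \<and> W' \<subseteq> W \<and> (\<forall>w\<in>W'. f w = 0)) \<Longrightarrow> singular f"
  by (simp add: singular_def)

lemma singularE:
  assumes "singular f" "gopen W" "W \<noteq> {}"
  obtains W' where "gopen W'" "W' \<noteq> {}" "W' \<subseteq> W" "\<And>w. w \<in> W' \<Longrightarrow> f w = 0"
  using assms(1)[unfolded singular_def, rule_format, OF assms(2,3)] that by blast

lemma singular_zero: "singular 0"
  by (auto simp: singular_def)

lemma singular_add:
  assumes "singular f" "singular h"
  shows "singular (f + h)"
proof (rule singularI)
  fix W assume W: "gopen W" "W \<noteq> {}"
  obtain W1 where W1: "gopen W1" "W1 \<noteq> {}" "W1 \<subseteq> W" "\<And>w. w \<in> W1 \<Longrightarrow> f w = 0"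
    using singularE[OF assms(1) W] by blast
  obtain W2 where W2: "gopen W2" "W2 \<noteq> {}" "W2 \<subseteq> W1" "\<And>w. w \<in> W2 \<Longrightarrow> h w = 0"
    using singularE[OF assms(2) W1(1,2)] by blast
  have "(f + h) w = 0" if "w \<in> W2" for w using that W1(4)[of w] W2 by auto
  then show "\<exists>W'. gopen W' \<and> W' \<noteq> {} \<and> W' \<subseteq> W \<and> (\<forall>w\<in>W'. (f + h) w = 0)"
    using W1 W2 by blast
qed

lemma singular_scale: "singular f \<Longrightarrow> singular (fscale c f)"
  unfolding singular_def fscale_def by (metis mult_zero_right)

text \<open>Translation by \<open>U\<close> and by its inverse maps open sets to open sets. So
  \<open>W\<close> is translated back to \<open>?Z\<close>, shrunk there to a set on which
  \<open>f\<close> vanishes, and the result is translated forward. If no arrow of \<open>W\<close>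
  has its range among those of \<open>U\<close>, the product is 0 on all of
  \<open>W\<close>.\<close>

lemma singular_conv_left:
  assumes f: "singular f" and U: "compact_bisection U"
  shows "singular (conv (const_on c U) f)"
proof (rule singularI)
  fix W assume W: "gopen W" "W \<noteq> {}"
  have Uo: "gopen U" and Ub: "bisection U" using U by (simp_all add: compact_bisection_iff)
  let ?W = "W \<inter> {g \<in> arrows G. rng G g \<in> rng G ` U}"
  show "\<exists>W'. gopen W' \<and> W' \<noteq> {} \<and> W' \<subseteq> W \<and> (\<forall>w\<in>W'. conv (const_on c U) f w = 0)"
  proof (cases "?W = {}")
    case True
    have "conv (const_on c U) f w = 0" if "w \<in> W" for w
    proof (rule conv_bisection_eq_0[of U])
      have "w \<in> arrows G" using that W openin_subset by blast
      then have "rng G w \<notin> rng G ` U" using True that by blast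
      then show "\<And>u. u \<in> U \<Longrightarrow> rng G u \<noteq> rng G w" by (auto simp: image_iff)
    qed (simp add: const_on_def)
    then show ?thesis using W by blast
  next
    case False
    have Wo: "gopen ?W" using W Uo open_rng open_rng_vimage by blast
    let ?Z = "set_mul (ginv G ` U) ?W"
    have "gopen ?Z" using open_set_mul open_ginv Uo Wo by blast
    moreover have "?Z \<noteq> {}"
    proof -
      obtain w u where "w \<in> ?W" "u \<in> U" "rng G u = rng G w" using False by force
      moreover have "src G (ginv G u) = rng G w" using calculation src_ginv bisectionD(1)[OF Ub] by simp
      ultimately have "ginv G u \<cdot> w \<in> ?Z" unfolding set_mul_def by blast
      then show ?thesis by blast
    qed
    ultimately obtain Z where Z: "gopen Z" "Z \<noteq> {}" "Z \<subseteq> ?Z" "\<And>z. z \<in> Z \<Longrightarrow> f z = 0"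
      using singularE[OF f] by blast
    have el: "\<exists>v w. v \<in> U \<and> w \<in> ?W \<and> rng G v = rng G w \<and> z = ginv G v \<cdot> w" if "z \<in> Z" for z
    proof -
      have "z \<in> ?Z" using \<open>z \<in> Z\<close> Z(3) by blast
      then obtain v w where vw: "v \<in> U" "w \<in> ?W" "src G (ginv G v) = rng G w" "z = ginv G v \<cdot> w"
        unfolding set_mul_def by blast
      then have "src G (ginv G v) = rng G v" using src_ginv bisectionD(1)[OF Ub] by simp
      then show ?thesis using vw by (intro exI[of _ v] exI[of _ w]) simp
    qed
    have main: "u \<cdot> z \<in> W \<and> conv (const_on c U) f (u \<cdot> z) = 0"
      if uz: "u \<in> U" "z \<in> Z" "src G u = rng G z" for u z
    proof -
      obtain v w where vw: "v \<in> U" "w \<in> ?W" "rng G v = rng G w" "z = ginv G v \<cdot> w" using el uz(2) by blast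
      have a: "v \<in> arrows G" "w \<in> arrows G" "u \<in> arrows G" using vw uz bisectionD(1)[OF Ub] by auto
      have za: "z \<in> arrows G" "rng G z = src G v" using vw a by (auto simp: ginv_closed src_ginv rng_ginv)
      have "u = v" using bisectionD(3)[OF Ub uz(1) vw(1)] uz(3) za(2) by simp
      then have "u \<cdot> z = w" using inv_mul_cancel(2)[OF a(1,2) vw(3)] vw(4) by simp
      moreover have "conv (const_on c U) f (u \<cdot> z) = const_on c U u * f (ginv G u \<cdot> (u \<cdot> z))"
        by (rule conv_bisection[OF Ub _ uz(1)]) (use a za uz in \<open>auto simp: const_on_def\<close>)
      moreover have "ginv G u \<cdot> (u \<cdot> z) = z" using inv_mul_cancel(1)[OF a(3) za(1) uz(3)] .
      ultimately show ?thesis using Z(4)[OF uz(2)] vw(2) by simp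
    qed
    have "set_mul U Z \<noteq> {}"
    proof -
      obtain z where z: "z \<in> Z" using Z(2) by blast
      obtain v w where vw: "v \<in> U" "w \<in> ?W" "rng G v = rng G w" "z = ginv G v \<cdot> w" using el z by blast
      have "v \<in> arrows G" "w \<in> arrows G" using vw bisectionD(1)[OF Ub] by auto
      then have "src G v = rng G z" using vw by (simp add: ginv_closed src_ginv rng_ginv)
      then show ?thesis using vw(1) z unfolding set_mul_def by blast
    qed
    moreover have "gopen (set_mul U Z)" using open_set_mul Uo Z(1) by blast
    moreover have "set_mul U Z \<subseteq> W" "\<forall>w\<in>set_mul U Z. conv (const_on c U) f w = 0"
      using main unfolding set_mul_def by blast+
    ultimately show ?thesis by blast
  qed
qed

text \<open>Right translation by a bisection is open in both directions too; the argument for the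
  left side carries over with sources in place of ranges.\<close>

lemma singular_conv_right:
  assumes f: "singular f" "rfinite f" and V: "compact_bisection V"
  shows "singular (conv f (const_on c V))"
proof (rule singularI)
  fix W assume W: "gopen W" "W \<noteq> {}"
  have Vo: "gopen V" and Vb: "bisection V" using V by (simp_all add: compact_bisection_iff)
  let ?W = "W \<inter> {g \<in> arrows G. src G g \<in> src G ` V}"
  show "\<exists>W'. gopen W' \<and> W' \<noteq> {} \<and> W' \<subseteq> W \<and> (\<forall>w\<in>W'. conv f (const_on c V) w = 0)"
  proof (cases "?W = {}")
    case True
    have "conv f (const_on c V) w = 0" if "w \<in> W" for w
    proof (rule conv_const_on_right_eq_0[OF f(2)])
      have "w \<in> arrows G" using that W openin_subset by blast
      then have "src G w \<notin> src G ` V" using True that by blast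
      then show "\<And>u. u \<in> V \<Longrightarrow> src G u \<noteq> src G w" by (auto simp: image_iff)
    qed
    then show ?thesis using W by blast
  next
    case False
    have Wo: "gopen ?W" using W Vo open_src open_src_vimage by blast
    let ?Z = "set_mul ?W (ginv G ` V)"
    have "gopen ?Z" using open_set_mul open_ginv Vo Wo by blast
    moreover have "?Z \<noteq> {}"
    proof -
      obtain w v where "w \<in> ?W" "v \<in> V" "src G v = src G w" using False by force
      moreover have "rng G (ginv G v) = src G w" using calculation rng_ginv bisectionD(1)[OF Vb] by simp
      ultimately have "w \<cdot> ginv G v \<in> ?Z" unfolding set_mul_def by force
      then show ?thesis by blast
    qed
    ultimately obtain Z where Z: "gopen Z" "Z \<noteq> {}" "Z \<subseteq> ?Z" "\<And>z. z \<in> Z \<Longrightarrow> f z = 0"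
      using singularE[OF f(1)] by blast
    have el: "\<exists>w v. w \<in> ?W \<and> v \<in> V \<and> src G w = src G v \<and> z = w \<cdot> ginv G v" if "z \<in> Z" for z
    proof -
      have "z \<in> ?Z" using \<open>z \<in> Z\<close> Z(3) by blast
      then obtain v w where vw: "v \<in> V" "w \<in> ?W" "src G w = rng G (ginv G v)" "z = w \<cdot> ginv G v"
        unfolding set_mul_def by blast
      then have "rng G (ginv G v) = src G v" using rng_ginv bisectionD(1)[OF Vb] by simp
      then show ?thesis using vw by (intro exI[of _ w] exI[of _ v]) simp
    qed
    have main: "z \<cdot> v \<in> W \<and> conv f (const_on c V) (z \<cdot> v) = 0"
      if zv: "z \<in> Z" "v \<in> V" "src G z = rng G v" for z v
    proof -
      obtain w v' where wv: "w \<in> ?W" "v' \<in> V" "src G w = src G v'" "z = w \<cdot> ginv G v'" using el zv(1) by blast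
      have a: "v' \<in> arrows G" "w \<in> arrows G" "v \<in> arrows G" using wv zv bisectionD(1)[OF Vb] by auto
      have za: "z \<in> arrows G" "src G z = rng G v'" using wv a by (auto simp: ginv_closed src_ginv rng_ginv)
      have "v = v'" using bisectionD(2)[OF Vb zv(2) wv(2)] zv(3) za(2) by simp
      then have "z \<cdot> v = w" using mul_inv_cancel(2)[OF a(1,2) wv(3)] wv(4) by simp
      moreover have "conv f (const_on c V) (z \<cdot> v) = c * f ((z \<cdot> v) \<cdot> ginv G v)"
        by (rule conv_const_on_right[OF f(2) Vb zv(2)]) (use a za zv in auto)
      moreover have "(z \<cdot> v) \<cdot> ginv G v = z" using mul_inv_cancel(1)[OF a(3) za(1) zv(3)] .
      ultimately show ?thesis using Z(4)[OF zv(1)] wv(1) by simp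
    qed
    have "set_mul Z V \<noteq> {}"
    proof -
      obtain z where z: "z \<in> Z" using Z(2) by blast
      obtain w v where wv: "w \<in> ?W" "v \<in> V" "src G w = src G v" "z = w \<cdot> ginv G v" using el z by blast
      have "v \<in> arrows G" "w \<in> arrows G" using wv bisectionD(1)[OF Vb] by auto
      then have "src G z = rng G v" using wv by (simp add: ginv_closed src_ginv rng_ginv)
      then show ?thesis using wv(2) z unfolding set_mul_def by blast
    qed
    moreover have "gopen (set_mul Z V)" using open_set_mul Vo Z(1) by blast
    moreover have "set_mul Z V \<subseteq> W" "\<forall>w\<in>set_mul Z V. conv f (const_on c V) w = 0"
      using main unfolding set_mul_def by blast+
    ultimately show ?thesis by blast
  qed
qed

lemma steinberg_singular_eq_0:
  assumes f: "f \<in> steinberg" "singular f"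
  shows "f = 0"
proof -
  let ?J = "{f \<in> steinberg. singular f}"
  have "?J = {0} \<or> ?J = steinberg"
  proof (rule steinberg_ideal_cases)
    show "0 \<in> ?J" using steinberg_zero singular_zero by blast
    fix f assume f: "f \<in> ?J"
    show "f + h \<in> ?J" if "h \<in> ?J" for h using f that steinberg_add singular_add by blast
    show "fscale c f \<in> ?J" for c using f steinberg_scale singular_scale by blast
    fix a assume a: "a \<in> steinberg"
    have "singular (conv a f)" using a
    proof (induction rule: steinberg_induct)
      case zero
      show ?case using singular_zero by (simp only: conv_zero_left)
    next
      case (add c U h)
      then show ?case
        unfolding conv_add_left[OF rfinite_steinberg[OF const_on_steinberg[OF add(1)]] rfinite_steinberg[OF add(2)]]
        using f by (intro singular_add singular_conv_left) auto
    qed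
    then show "conv a f \<in> ?J" using a f steinberg_conv by blast
    have "singular (conv f a)" using a
    proof (induction rule: steinberg_induct)
      case zero
      show ?case using singular_zero by (simp only: conv_zero_right)
    next
      case (add c U h)
      have r: "rfinite f" using f rfinite_steinberg by blast
      show ?case
        unfolding conv_add_right[OF r]
        using f add r by (intro singular_add singular_conv_right) auto
    qed
    then show "conv f a \<in> ?J" using a f steinberg_conv by blast
  qed auto
  \<comment> \<open>The indicator function of a nonempty open set is 1 throughout that set, hence
    not singular.\<close>
  moreover have "?J \<noteq> steinberg"
  proof
    assume eq: "?J = steinberg"
    obtain x where "x \<in> units G" using units_nonempty by blast
    then obtain V where V: "compact_bisection V" "x \<in> V"
      using compact_bisection_base[OF open_units] by blast
    have "singular (const_on 1 V)" using eq const_on_steinberg[OF V(1)] by blast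
    moreover have "gopen V" "V \<noteq> {}" using V by (auto simp: compact_bisection_iff)
    ultimately obtain W' where W': "gopen W'" "W' \<noteq> {}" "W' \<subseteq> V"
      "\<And>w. w \<in> W' \<Longrightarrow> const_on 1 V w = (0 :: complex)"
      using singularE by metis
    then obtain w where "w \<in> W'" by blast
    then have "w \<in> V" "const_on 1 V w = (0 :: complex)" using W'(3,4) by blast+
    then show False by (simp add: const_on_def)
  qed
  ultimately show ?thesis using f by blast
qed

end

section \<open>Finite normal subsets of a group\<close>

text \<open>
  A variant of Dietzmann's lemma: if a word over \<open>F\<close> contains a letter twice, conjugation moves the
  two occurrences next to each other, and their product is again in \<open>F\<close>; so words of length at most
  \<open>card F\<close> represent all products.
\<close>

lemma (in group) finite_set_absorbing_conj_closed:
  assumes fin: "finite F" and sub: "F \<subseteq> carrier G"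
    and conj: "\<And>f g. f \<in> F \<Longrightarrow> g \<in> F \<Longrightarrow> inv g \<otimes> f \<otimes> g \<in> F"
    and sq: "\<And>g. g \<in> F \<Longrightarrow> g \<otimes> g \<in> F"
  obtains H where "finite H" "H \<subseteq> carrier G" "\<one> \<in> H" "\<And>f h. f \<in> F \<Longrightarrow> h \<in> H \<Longrightarrow> f \<otimes> h \<in> H"
proof -
  define P where "P xs = foldr (\<otimes>) xs \<one>" for xs
  have P_simps: "P [] = \<one>" "P (x # xs) = x \<otimes> P xs" for x xs by (simp_all add: P_def)
  have closed: "P xs \<in> carrier G" if "set xs \<subseteq> F" for xs
    using that sub by (induction xs) (auto simp: P_simps)
  have app: "P (xs @ ys) = P xs \<otimes> P ys" if "set xs \<subseteq> F" "set ys \<subseteq> F" for xs ys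
    using that(1)
  proof (induction xs)
    case Nil
    then show ?case using closed[OF that(2)] by (simp add: P_simps)
  next
    case (Cons x xs)
    then show ?case using closed[OF that(2)] closed[of xs] sub by (simp add: P_simps m_assoc subset_iff)
  qed
  \<comment> \<open>Moving \<open>g\<close> to the front conjugates every letter that it passes, and
    the conjugated letters stay in \<open>F\<close>.\<close>
  have move: "P xs \<otimes> g = g \<otimes> P (map (\<lambda>b. inv g \<otimes> b \<otimes> g) xs)" if g: "g \<in> F" and xs: "set xs \<subseteq> F" for g xs
    using xs
  proof (induction xs)
    case Nil
    then show ?case using g sub by (auto simp: P_simps)
  next
    case (Cons x xs)
    let ?c = "\<lambda>b. inv g \<otimes> b \<otimes> g"
    have c: "g \<in> carrier G" "x \<in> carrier G" "P xs \<in> carrier G" using g Cons(2) sub closed[of xs] by auto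
    have "set (map ?c xs) \<subseteq> F" using conj g Cons(2) by auto
    then have m: "P (map ?c xs) \<in> carrier G" by (rule closed)
    have "P (x # xs) \<otimes> g = x \<otimes> (P xs \<otimes> g)" using c by (simp add: P_simps m_assoc)
    also have "\<dots> = x \<otimes> (g \<otimes> P (map ?c xs))" using Cons by simp
    also have "\<dots> = g \<otimes> (?c x \<otimes> P (map ?c xs))"
      using c m by (simp add: m_assoc[symmetric])
    also have "\<dots> = g \<otimes> P (map ?c (x # xs))" by (simp add: P_simps)
    finally show ?case .
  qed
  have short: "\<exists>ys. set ys \<subseteq> F \<and> length ys \<le> card F \<and> P ys = P xs" if "set xs \<subseteq> F" for xs
    using that
  proof (induction xs rule: length_induct)
    case (1 xs)
    show ?case
    proof (cases "length xs \<le> card F")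
      case False
      have "\<not> distinct xs"
      proof
        assume "distinct xs"
        then have "length xs = card (set xs)" by (simp add: distinct_card)
        then show False using False card_mono[OF fin 1(2)] by simp
      qed
      then obtain as bs cs g where xs: "xs = as @ [g] @ bs @ [g] @ cs" using not_distinct_decomp by metis
      have F: "set as \<subseteq> F" "set bs \<subseteq> F" "set cs \<subseteq> F" "g \<in> F" using 1(2) xs by auto
      let ?bs = "map (\<lambda>b. inv g \<otimes> b \<otimes> g) bs"
      \<comment> \<open>The two copies of \<open>g\<close> are merged into the single letter
        \<open>g \<otimes> g\<close>, so the word becomes shorter by one.\<close>
      let ?ys = "as @ [g \<otimes> g] @ ?bs @ cs"
      have bs: "set ?bs \<subseteq> F" using F conj by auto
      have ysF: "set ?ys \<subseteq> F" using F bs sq by auto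
      have gc: "g \<in> carrier G" using F sub by blast
      have "P ?ys = P as \<otimes> (g \<otimes> g \<otimes> (P ?bs \<otimes> P cs))"
        using F bs sq by (simp add: app P_simps)
      also have "g \<otimes> g \<otimes> (P ?bs \<otimes> P cs) = g \<otimes> ((g \<otimes> P ?bs) \<otimes> P cs)"
        using gc closed[OF bs] closed[OF F(3)] by (simp add: m_assoc)
      also have "g \<otimes> P ?bs = P bs \<otimes> g" using move[OF F(4,2)] by simp
      also have "g \<otimes> ((P bs \<otimes> g) \<otimes> P cs) = g \<otimes> (P bs \<otimes> (g \<otimes> P cs))"
        using gc closed[OF F(2)] closed[OF F(3)] by (simp add: m_assoc)
      also have "P as \<otimes> (g \<otimes> (P bs \<otimes> (g \<otimes> P cs))) = P xs"
        using F by (simp add: xs app P_simps)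
      finally have "P ?ys = P xs" .
      moreover have "length ?ys < length xs" by (simp add: xs)
      ultimately show ?thesis using 1(1) ysF by metis
    qed (use 1 in blast)
  qed
  let ?H = "P ` {xs. set xs \<subseteq> F}"
  have "?H \<subseteq> P ` {xs. set xs \<subseteq> F \<and> length xs \<le> card F}" using short by (force simp: image_iff)
  then have "finite ?H" using finite_lists_length_le[OF fin] finite_surj by blast
  moreover have "\<one> \<in> ?H" using P_simps(1) by (intro image_eqI[of _ _ "[]"]) auto
  moreover have "f \<otimes> h \<in> ?H" if "f \<in> F" "h \<in> ?H" for f h
  proof -
    from \<open>h \<in> ?H\<close> obtain xs where "h = P xs" "set xs \<subseteq> F" by blast
    then show ?thesis using that(1) P_simps(2)[of f xs] by (intro image_eqI[of _ _ "f # xs"]) auto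
  qed
  moreover have "?H \<subseteq> carrier G" using closed by blast
  ultimately show ?thesis using that by blast
qed

section \<open>Local expansion of Steinberg functions\<close>

context ample_groupoid
begin

text \<open>A unit \<open>y\<close> near \<open>g\<close> satisfies \<open>y \<cdot> y = y\<close>,
  so units also accumulate at \<open>g \<cdot> g\<close>. For two different points, units close to
  one need not be close to the other, and the argument says nothing about their product.\<close>

lemma unit_closure_fibre_square:
  assumes "g \<in> unit_closure_fibre G x"
  shows "g \<cdot> g \<in> unit_closure_fibre G x"
proof -
  have g: "g \<in> gtop G closure_of units G" "g \<in> arrows G" "src G g = x" "rng G g = x"
    using assms by (auto simp: unit_closure_fibre_def isotropy_def)
  have "\<exists>y. y \<in> units G \<and> y \<in> T" if T: "g \<cdot> g \<in> T" "gopen T" for T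
  proof -
    obtain A B where AB: "gopen A" "gopen B" "g \<in> A" "g \<in> B"
      "\<And>a b. a \<in> A \<Longrightarrow> b \<in> B \<Longrightarrow> src G a = rng G b \<Longrightarrow> a \<cdot> b \<in> T"
      using mul_open_neighbourhoods[of g g T] g T by metis
    have "gopen (A \<inter> B)" "g \<in> A \<inter> B" using AB by blast+
    then obtain y where y: "y \<in> units G" "y \<in> A" "y \<in> B" using g(1) unfolding in_closure_of by blast
    then have "y \<cdot> y \<in> T" using AB(5)[of y y] src_unit rng_unit by simp
    then show ?thesis using y(1) mul_unit_left[OF y(1) units_arrows[OF y(1)] rng_unit[OF y(1)]] by auto
  qed
  then show ?thesis using g by (simp add: unit_closure_fibre_def isotropy_def in_closure_of)
qed

text \<open>Units \<open>y\<close> near \<open>f\<close> are conjugated by arrows \<open>e\<close>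
  near \<open>k\<close>; the result is again a unit and lies near the conjugate of \<open>f\<close>.
  As \<open>e\<close> has to end at \<open>y\<close>, openness of the range map is what provides
  it.\<close>

lemma unit_closure_fibre_conj:
  assumes f: "f \<in> unit_closure_fibre G x" and k: "k \<in> isotropy G x"
  shows "ginv G k \<cdot> f \<cdot> k \<in> unit_closure_fibre G x"
proof -
  have f: "f \<in> gtop G closure_of units G" "f \<in> arrows G" "src G f = x" "rng G f = x"
    using f by (auto simp: unit_closure_fibre_def isotropy_def)
  have k: "k \<in> arrows G" "src G k = x" "rng G k = x" using k by (auto simp: isotropy_def)
  have k': "ginv G k \<in> arrows G" "src G (ginv G k) = x" "rng G (ginv G k) = x"
    using k by (auto simp: ginv_closed src_ginv rng_ginv)
  have kf: "ginv G k \<cdot> f \<in> arrows G" "src G (ginv G k \<cdot> f) = x" "rng G (ginv G k \<cdot> f) = x"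
    using k' f by auto
  have "\<exists>y. y \<in> units G \<and> y \<in> T" if T: "ginv G k \<cdot> f \<cdot> k \<in> T" "gopen T" for T
  proof -
    obtain A B where AB: "gopen A" "gopen B" "ginv G k \<cdot> f \<in> A" "k \<in> B"
      "\<And>a b. a \<in> A \<Longrightarrow> b \<in> B \<Longrightarrow> src G a = rng G b \<Longrightarrow> a \<cdot> b \<in> T"
      using mul_open_neighbourhoods[of "ginv G k \<cdot> f" k T] kf k T by metis
    obtain C D where CD: "gopen C" "gopen D" "ginv G k \<in> C" "f \<in> D"
      "\<And>a b. a \<in> C \<Longrightarrow> b \<in> D \<Longrightarrow> src G a = rng G b \<Longrightarrow> a \<cdot> b \<in> A"
      using mul_open_neighbourhoods[of "ginv G k" f A] k' f AB by metis
    let ?E = "B \<inter> ginv G ` C"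
    have E: "gopen ?E" "k \<in> ?E"
      using AB CD open_ginv ginv_ginv[OF k(1)] by (auto intro: image_eqI[of _ _ "ginv G k"])
    let ?S = "D \<inter> {g \<in> arrows G. rng G g \<in> rng G ` ?E}"
    have So: "gopen ?S"
      by (intro openin_Int CD open_rng_vimage open_rng E)
    have "f \<in> ?S"
      using CD(4) f(2,4) imageI[OF E(2), of "rng G"] k(3) by simp
    then have "\<exists>y. y \<in> units G \<and> y \<in> ?S"
      using f(1) So unfolding in_closure_of by (elim conjE allE[of _ ?S]) simp
    then obtain y where y: "y \<in> units G" "y \<in> D" "rng G y \<in> rng G ` ?E" by blast
    obtain e where e: "e \<in> B" "e \<in> ginv G ` C" "rng G y = rng G e" using y(3) by blast
    have ea: "e \<in> arrows G" using E(1) e openin_subset by blast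
    obtain c where c: "c \<in> C" "e = ginv G c" using e(2) by blast
    then have "c \<in> arrows G" using CD(1) openin_subset by blast
    then have eC: "ginv G e \<in> C" using c ginv_ginv by simp
    have ey: "src G (ginv G e) = y" "rng G y = y" using src_ginv[OF ea] e(3) rng_unit[OF y(1)] by simp_all
    have "ginv G e \<cdot> y \<in> A" using CD(5)[OF eC y(2)] ey by simp
    then have "ginv G e \<in> A" using mul_src[OF ginv_closed[OF ea]] ey by simp
    then have "ginv G e \<cdot> e \<in> T" using AB(5)[OF _ e(1)] src_ginv[OF ea] by blast
    then show ?thesis using ginv_mul[OF ea] src_units[OF ea] by auto
  qed
  then show ?thesis
    using kf k by (simp add: unit_closure_fibre_def isotropy_def in_closure_of)
qed

text \<open>Absorption isolates \<open>H\<close> from the other arrows starting at \<open>x\<close>: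
  if \<open>k\<close> is in \<open>H\<close> and such an arrow \<open>w\<close> is not, then
  \<open>w \<cdot> ginv G k\<close> is outside the closure of the units.\<close>

lemma finite_absorbing_set:
  assumes x: "x \<in> units G" and fin: "finite (unit_closure_fibre G x)"
  obtains H where "finite H" "H \<subseteq> isotropy G x" "x \<in> H"
    "\<And>f h. f \<in> unit_closure_fibre G x \<Longrightarrow> h \<in> H \<Longrightarrow> f \<cdot> h \<in> H"
proof -
  interpret iso: group "isotropy_group x" by (rule group_isotropy_group[OF x])
  have sub: "unit_closure_fibre G x \<subseteq> isotropy G x" by (auto simp: unit_closure_fibre_def)
  note simps = isotropy_group_def
  obtain H where "finite H" "H \<subseteq> carrier (isotropy_group x)" "\<one>\<^bsub>isotropy_group x\<^esub> \<in> H"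
    "\<And>f h. f \<in> unit_closure_fibre G x \<Longrightarrow> h \<in> H \<Longrightarrow> f \<otimes>\<^bsub>isotropy_group x\<^esub> h \<in> H"
  proof (rule iso.finite_set_absorbing_conj_closed[OF fin])
    show "unit_closure_fibre G x \<subseteq> carrier (isotropy_group x)" using sub by (simp add: simps)
    show "inv\<^bsub>isotropy_group x\<^esub> g \<otimes>\<^bsub>isotropy_group x\<^esub> f \<otimes>\<^bsub>isotropy_group x\<^esub> g \<in> unit_closure_fibre G x"
      if "f \<in> unit_closure_fibre G x" "g \<in> unit_closure_fibre G x" for f g
    proof -
      have "g \<in> isotropy G x" using that sub by blast
      then have "inv\<^bsub>isotropy_group x\<^esub> g = ginv G g" "ginv G g \<cdot> f \<cdot> g \<in> unit_closure_fibre G x"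
        using inv_isotropy_group[OF x] unit_closure_fibre_conj[OF that(1)] by blast+
      then show ?thesis by (simp add: simps)
    qed
    show "g \<otimes>\<^bsub>isotropy_group x\<^esub> g \<in> unit_closure_fibre G x" if "g \<in> unit_closure_fibre G x" for g
      using unit_closure_fibre_square[OF that] by (simp add: simps)
  qed blast
  then show ?thesis using that by (simp add: simps)
qed

text \<open>A common arrow \<open>y\<close> of \<open>W\<close> and \<open>U\<close> yields the unit
  \<open>y \<cdot> ginv G y\<close>. Over a small neighbourhood of \<open>x\<close> this would be
  the quotient of an arrow near \<open>w\<close> by one near \<open>k\<close>, and such quotients
  avoid the units because \<open>w \<cdot> ginv G k\<close> is outside their closure. If no arrow of
  \<open>W\<close> starts at \<open>x\<close>, compactness of \<open>W\<close> keeps its sources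
  away from \<open>x\<close>.\<close>

lemma disjoint_bisections_near:
  assumes W: "compact_bisection W" and U: "compact_bisection U"
    and k: "k \<in> U" "k \<in> isotropy G x"
    and no: "\<And>w. w \<in> W \<Longrightarrow> src G w = x \<Longrightarrow> w \<cdot> ginv G k \<notin> unit_closure_fibre G x"
  obtains V where "gopen V" "x \<in> V" "\<And>y. y \<in> W \<Longrightarrow> y \<in> U \<Longrightarrow> src G y \<notin> V"
proof -
  have Wb: "bisection W" and Wo: "gopen W" and Wc: "compactin (gtop G) W"
    using W by (simp_all add: compact_bisection_iff)
  have Ub: "bisection U" and Uo: "gopen U" using U by (simp_all add: compact_bisection_iff)
  have ka: "k \<in> arrows G" "src G k = x" "rng G k = x" using k by (auto simp: isotropy_def)
  have x: "x \<in> units G" using src_units[OF ka(1)] ka(2) by simp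
  show ?thesis
  proof (cases "\<exists>w\<in>W. src G w = x")
    case False
    let ?X = "unit_space"
    have "src G ` W \<subseteq> units G" using src_units bisectionD(1)[OF Wb] by blast
    moreover have "compactin (gtop G) (src G ` W)" using continuous_src Wc image_compactin by blast
    ultimately have "compactin ?X (src G ` W)" by (simp add: compactin_subtopology)
    then have "closedin ?X (src G ` W)" using Hausdorff_units compactin_imp_closedin by blast
    then have "openin ?X (topspace ?X - src G ` W)" by (simp add: closedin_def)
    then have "gopen (topspace ?X - src G ` W)" using open_units_iff by blast
    moreover have "x \<in> topspace ?X - src G ` W" using False x units_arrows by auto
    ultimately show ?thesis using that[of "topspace ?X - src G ` W"] by blast
  next
    case True
    then obtain w where w: "w \<in> W" "src G w = x" by blast
    have wa: "w \<in> arrows G" using w bisectionD(1)[OF Wb] by blast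
    have wk: "w \<cdot> ginv G k \<in> arrows G" "src G (w \<cdot> ginv G k) = x"
      using wa w ka by (auto simp: ginv_closed src_ginv rng_ginv)
    \<comment> \<open>The hypothesis \<open>no\<close> concerns the isotropy at \<open>x\<close>,
      while \<open>w\<close> may end elsewhere; an arrow in the closure of the units is isotropic in
      any case.\<close>
    have "w \<cdot> ginv G k \<notin> gtop G closure_of units G"
    proof
      assume cl: "w \<cdot> ginv G k \<in> gtop G closure_of units G"
      then have "w \<cdot> ginv G k \<in> unit_closure_fibre G x"
        using closure_units_isotropic(2)[OF cl] wk by (simp add: unit_closure_fibre_def isotropy_def)
      then show False using no w by blast
    qed
    then obtain T where T: "w \<cdot> ginv G k \<in> T" "gopen T" "\<And>y. y \<in> units G \<Longrightarrow> y \<notin> T"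
      using wk(1) unfolding in_closure_of by blast
    obtain A B where AB: "gopen A" "gopen B" "w \<in> A" "k \<in> B"
      "\<And>a b. a \<in> A \<Longrightarrow> b \<in> B \<Longrightarrow> src G a = src G b \<Longrightarrow> a \<cdot> ginv G b \<in> T"
      using div_open_neighbourhoods[of w k T] wa ka w T by metis
    let ?V = "src G ` (A \<inter> W) \<inter> src G ` (B \<inter> U)"
    show ?thesis
    proof (rule that[of ?V])
      show "gopen ?V" by (intro openin_Int open_src AB Wo Uo)
      show "x \<in> ?V"
        using imageI[of w "A \<inter> W" "src G"] imageI[of k "B \<inter> U" "src G"] w AB k ka by simp
      fix y assume y: "y \<in> W" "y \<in> U"
      show "src G y \<notin> ?V"
      proof
        assume "src G y \<in> ?V"
        then obtain a b where a: "a \<in> A" "a \<in> W" "src G y = src G a"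
          and b: "b \<in> B" "b \<in> U" "src G y = src G b" by blast
        have "y = a" "y = b" using bisectionD(3)[OF Wb y(1) a(2,3)] bisectionD(3)[OF Ub y(2) b(2,3)] by auto
        then have "y \<cdot> ginv G y \<in> T" using AB(5) a b by blast
        moreover have "y \<in> arrows G" using y bisectionD(1)[OF Wb] by blast
        ultimately show False using T(3)[of "rng G y"] mul_ginv rng_units by simp
      qed
    qed
  qed
qed

end

context nonempty_ample_groupoid
begin

text \<open>It suffices to treat the indicator function of a compact open bisection
  \<open>W\<close>. If \<open>W\<close> passes through a point \<open>h0\<close> of
  \<open>H\<close>, it agrees with \<open>U h0\<close> near \<open>x\<close>. Otherwise absorption
  keeps \<open>W\<close> disjoint from every \<open>U k\<close> near \<open>x\<close>. This is why
  the formula is confined to the sets \<open>U k\<close>: elsewhere \<open>W\<close> may still be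
  present.\<close>

lemma steinberg_local_expansion:
  assumes x: "x \<in> units G" and H: "finite H" "H \<subseteq> isotropy G x"
    and absorb: "\<And>f h. f \<in> unit_closure_fibre G x \<Longrightarrow> h \<in> H \<Longrightarrow> f \<cdot> h \<in> H"
    and U: "\<And>h. h \<in> H \<Longrightarrow> compact_bisection (U h)" "\<And>h. h \<in> H \<Longrightarrow> h \<in> U h"
    and f: "f \<in> steinberg"
  shows "\<exists>V. gopen V \<and> x \<in> V \<and>
    (\<forall>k\<in>H. \<forall>y\<in>U k. src G y \<in> V \<longrightarrow> f y = (\<Sum>h\<in>H. if y \<in> U h then f h else 0))"
  using f
proof (induction rule: steinberg_induct)
  case zero
  have "(0 :: 'a \<Rightarrow> complex) y = (\<Sum>h\<in>H. if y \<in> U h then (0 :: 'a \<Rightarrow> complex) h else 0)" for y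
    by (simp cong: if_cong)
  then show ?case using x open_units by blast
next
  case (add c W f)
  then obtain V1 where V1: "gopen V1" "x \<in> V1"
    "\<And>k y. k \<in> H \<Longrightarrow> y \<in> U k \<Longrightarrow> src G y \<in> V1 \<Longrightarrow> f y = (\<Sum>h\<in>H. if y \<in> U h then f h else 0)"
    by blast
  have Wb: "bisection W" and Wo: "gopen W" using add(1) by (simp_all add: compact_bisection_iff)
  have Hs: "h \<in> arrows G" "src G h = x" "rng G h = x" if "h \<in> H" for h
    using H(2) that by (auto simp: isotropy_def)
  have Ub: "bisection (U h)" and Uo: "gopen (U h)" if "h \<in> H" for h
    using U(1)[OF that] by (simp_all add: compact_bisection_iff)
  have "\<exists>V. gopen V \<and> x \<in> V \<and> (\<forall>k\<in>H. \<forall>y\<in>U k. src G y \<in> V \<longrightarrow>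
      const_on c W y = (\<Sum>h\<in>H. if y \<in> U h then const_on c W h else 0))"
  proof (cases "H \<inter> W = {}")
    case False
    then obtain h0 where h0: "h0 \<in> H" "h0 \<in> W" by blast
    \<comment> \<open>Over these sources the bisections \<open>W\<close> and \<open>U h0\<close>
      coincide, and \<open>h0\<close> is the one point of \<open>H\<close> in
      \<open>W\<close>.\<close>
    let ?V = "src G ` (W \<inter> U h0)"
    have iff: "h \<in> W \<longleftrightarrow> h = h0" if "h \<in> H" for h
    proof -
      have "src G h = src G h0" by (simp only: Hs(2)[OF that] Hs(2)[OF h0(1)])
      then show ?thesis using bisectionD(3)[OF Wb _ h0(2)] h0(2) by blast
    qed
    have "const_on c W y = (\<Sum>h\<in>H. if y \<in> U h then const_on c W h else 0)" if y: "src G y \<in> ?V" for y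
    proof -
      obtain z where z: "z \<in> W" "z \<in> U h0" "src G y = src G z" using y by blast
      have "y \<in> W \<longleftrightarrow> y \<in> U h0"
        using bisectionD(3)[OF Wb _ z(1) z(3)] bisectionD(3)[OF Ub[OF h0(1)] _ z(2) z(3)] z(1,2) by auto
      moreover have "(\<Sum>h\<in>H. if y \<in> U h then const_on c W h else 0)
          = (\<Sum>h\<in>H. if h = h0 then (if y \<in> U h0 then c else 0) else 0)"
        by (rule sum.cong) (auto simp: const_on_def iff)
      moreover have "\<dots> = (if y \<in> U h0 then c else 0)" using H(1) h0(1) by (simp add: sum.delta)
      ultimately show ?thesis by (simp add: const_on_def)
    qed
    moreover have "gopen ?V" by (intro open_src openin_Int Wo Uo h0)
    moreover have "x \<in> ?V" using imageI[of h0 "W \<inter> U h0" "src G"] h0 U(2) Hs by simp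
    ultimately show ?thesis by blast
  next
    case True
    have "\<exists>V. gopen V \<and> x \<in> V \<and> (\<forall>y. y \<in> W \<longrightarrow> y \<in> U k \<longrightarrow> src G y \<notin> V)" if k: "k \<in> H" for k
    proof -
      have no: "w \<cdot> ginv G k \<notin> unit_closure_fibre G x" if w: "w \<in> W" "src G w = x" for w
      proof
        assume "w \<cdot> ginv G k \<in> unit_closure_fibre G x"
        then have "(w \<cdot> ginv G k) \<cdot> k \<in> H" using absorb k by blast
        moreover have "(w \<cdot> ginv G k) \<cdot> k = w"
          using mul_inv_cancel(2)[OF Hs(1)[OF k], of w] w Hs(2)[OF k] bisectionD(1)[OF Wb] by simp
        ultimately show False using True w by auto
      qed
      have "k \<in> isotropy G x" using k H(2) by blast
      from disjoint_bisections_near[OF add(1) U(1)[OF k] U(2)[OF k] this no]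
      show ?thesis by blast
    qed
    then obtain V where V: "\<And>k. k \<in> H \<Longrightarrow> gopen (V k)" "\<And>k. k \<in> H \<Longrightarrow> x \<in> V k"
      "\<And>k y. k \<in> H \<Longrightarrow> y \<in> W \<Longrightarrow> y \<in> U k \<Longrightarrow> src G y \<notin> V k" by metis
    \<comment> \<open>Intersecting with \<open>units G\<close> keeps the set inside the arrows when
      \<open>H\<close> is empty.\<close>
    let ?V = "units G \<inter> (\<Inter>k\<in>H. V k)"
    have "gopen ?V"
    proof (cases "H = {}")
      case False
      then show ?thesis using V(1) H(1) open_units by (intro openin_Int openin_INT2) auto
    qed (use open_units in simp)
    moreover have "x \<in> ?V" using V(2) x by blast
    moreover have "const_on c W y = (\<Sum>h\<in>H. if y \<in> U h then const_on c W h else 0)"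
      if "k \<in> H" "y \<in> U k" "src G y \<in> ?V" for k y
    proof -
      have "y \<notin> W" using V(3)[OF that(1) _ that(2)] that by blast
      moreover have "(\<Sum>h\<in>H. if y \<in> U h then const_on c W h else 0) = 0"
        by (rule sum.neutral) (use True in \<open>auto simp: const_on_def\<close>)
      ultimately show ?thesis by (simp add: const_on_def)
    qed
    ultimately show ?thesis by blast
  qed
  then obtain V2 where V2: "gopen V2" "x \<in> V2"
    "\<And>k y. k \<in> H \<Longrightarrow> y \<in> U k \<Longrightarrow> src G y \<in> V2 \<Longrightarrow>
      const_on c W y = (\<Sum>h\<in>H. if y \<in> U h then const_on c W h else 0)" by blast
  have "(const_on c W + f) y = (\<Sum>h\<in>H. if y \<in> U h then (const_on c W + f) h else 0)"
    if "k \<in> H" "y \<in> U k" "src G y \<in> V1 \<inter> V2" for k y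
  proof -
    have "(\<Sum>h\<in>H. if y \<in> U h then (const_on c W + f) h else 0)
      = (\<Sum>h\<in>H. (if y \<in> U h then const_on c W h else 0) + (if y \<in> U h then f h else 0))"
      by (rule sum.cong) auto
    then show ?thesis using V1(3)[OF that(1,2)] V2(3)[OF that(1,2)] that(3) by (simp add: sum.distrib)
  qed
  moreover have "gopen (V1 \<inter> V2)" "x \<in> V1 \<inter> V2" using V1 V2 by blast+
  ultimately show ?case by blast
qed

end

section \<open>Simplicity of the reduced algebra\<close>

locale simple_closed_ideal = simple_steinberg G + closed_ideal G I
  for G :: "'a topgroupoid" and I +
  assumes trivial_trace: "ideal_trace = {0}"
begin

lemma near_corner:
  assumes f: "f \<in> steinberg" "near f e" and e: "e \<ge> 0"
    and V: "compact_bisection V" "V \<noteq> {}" "V \<subseteq> units G"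
    and c: "\<And>g. g \<in> arrows G \<Longrightarrow> src G g \<in> V \<Longrightarrow> rng G g \<in> V \<Longrightarrow> f g = (if g \<in> V then c else 0)"
  shows "cmod c \<le> e"
proof (rule ccontr)
  assume "\<not> cmod c \<le> e"
  then have ce: "e < cmod c" by simp
  then have c0: "c \<noteq> 0" using e by auto
  define p :: "'a \<Rightarrow> complex" where "p = const_on 1 V"
  have p: "p \<in> steinberg" unfolding p_def by (rule const_on_steinberg[OF V(1)])
  have "rnorm p \<le> 1" unfolding p_def
    by (rule rnorm_bisection[OF compact_bisectionD[OF V(1)]]) (auto simp: const_on_def)
  then have np: "near p 1" by (rule near_rnorm[OF p])
  have pf: "conv p f \<in> steinberg" by (rule steinberg_conv[OF p f(1)])
  let ?q = "conv (conv p f) p"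
  have q: "?q \<in> steinberg" by (rule steinberg_conv[OF pf p])
  \<comment> \<open>Both factors \<open>p\<close> have norm at most 1, so the compression keeps the
    bound \<open>e\<close>.\<close>
  have nq: "near ?q (1 * e * 1)" by (intro near_conv np f p pf)
  have Va: "V \<subseteq> arrows G" using V(3) units_arrows by blast
  have "?q = const_on c V"
  proof
    fix g
    show "?q g = const_on c V g"
    proof (cases "g \<in> arrows G")
      case True
      have "?q g = (if src G g \<in> V then conv p f g else 0)"
        using conv_const_on_units_right[OF rfinite_steinberg[OF pf] V(3) True, of 1] by (simp add: p_def)
      also have "\<dots> = (if src G g \<in> V \<and> rng G g \<in> V then f g else 0)"
        using conv_const_on_units_left[OF V(3) True, of 1 f] by (simp add: p_def)
      also have "\<dots> = const_on c V g"
      proof (cases "g \<in> V")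
        case gV: True
        then have "src G g = g" "rng G g = g" using V(3) src_unit rng_unit by blast+
        then show ?thesis using gV c[OF True] by (simp add: const_on_def)
      next
        case False
        then show ?thesis using c[OF True] by (simp add: const_on_def)
      qed
      finally show ?thesis .
    next
      case False
      then show ?thesis using Va conv_outside by (auto simp: const_on_def)
    qed
  qed
  then have "fscale (1 / c) ?q = p" using c0 by (simp add: p_def fscale_const_on)
  then have "near p (cmod (1 / c) * e)" using near_scale[OF q nq, of "1 / c"] by simp
  moreover have "conv p p = p"
  proof
    fix g
    show "conv p p g = p g"
    proof (cases "g \<in> arrows G")
      case True
      have "p g = 0" if "rng G g \<notin> V" using that V(3) rng_unit by (auto simp: p_def const_on_def)
      then show ?thesis using conv_const_on_units_left[OF V(3) True, of 1 p] by (auto simp: p_def)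
    next
      case False
      then show ?thesis using Va conv_outside by (auto simp: p_def const_on_def)
    qed
  qed
  moreover have "0 \<le> cmod (1 / c) * e" "cmod (1 / c) * e < 1"
    using e ce c0 by (simp_all add: norm_divide)
  ultimately have "p \<in> ideal_trace" using near_idempotent p by blast
  then have "p = 0" using trivial_trace by blast
  moreover obtain x where "x \<in> V" using V(2) by blast
  then have "p x = 1" by (simp add: p_def const_on_def)
  ultimately show False by simp
qed

text \<open>The corner estimate concerns units, while \<open>W\<close> may contain none. Translation
  by the inverse of a bisection inside \<open>W\<close> turns the value at \<open>w\<close> into the
  value at \<open>src G w\<close>; the translating function has norm at most 1, so the bound
  \<open>e\<close> is unchanged.\<close>

lemma near_bound_on_open:
  assumes f: "f \<in> steinberg" "near f e" and e: "e \<ge> 0" and W: "gopen W" "W \<noteq> {}"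
  obtains W' where "gopen W'" "W' \<noteq> {}" "W' \<subseteq> W" "\<And>w. w \<in> W' \<Longrightarrow> cmod (f w) \<le> e"
proof -
  obtain w0 where w0: "w0 \<in> W" using W by blast
  then obtain U where U: "compact_bisection U" "w0 \<in> U" "U \<subseteq> W"
    using compact_bisection_base[OF W(1)] by blast
  have Ub: "bisection U" and Uo: "gopen U" using U(1) by (simp_all add: compact_bisection_iff)
  have U': "compact_bisection (ginv G ` U)" by (rule compact_bisection_ginv[OF U(1)])
  define a :: "'a \<Rightarrow> complex" where "a = const_on 1 (ginv G ` U)"
  have a: "a \<in> steinberg" unfolding a_def by (rule const_on_steinberg[OF U'])
  have "rnorm a \<le> 1" unfolding a_def
    by (rule rnorm_bisection[OF compact_bisectionD[OF U']]) (auto simp: const_on_def)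
  then have na: "near a 1" by (rule near_rnorm[OF a])
  have nf: "near (conv a f) e" using near_conv[OF a na f] by simp
  have shift: "conv a f (src G w) = f w" if w: "w \<in> U" for w
  proof -
    have wa: "w \<in> arrows G" using w bisectionD(1)[OF Ub] by blast
    have "conv a f (src G w) = a (ginv G w) * f (ginv G (ginv G w) \<cdot> src G w)"
      by (rule conv_bisection[OF compact_bisectionD[OF U']])
        (use w wa in \<open>auto simp: a_def const_on_def src_closed rng_ginv rng_src\<close>)
    then show ?thesis using w wa by (simp add: a_def const_on_def ginv_ginv mul_src)
  qed
  have "src G ` U \<subseteq> units G" using src_units bisectionD(1)[OF Ub] by blast
  moreover have "gopen (src G ` U)" "src G ` U \<noteq> {}" using open_src[OF Uo] U(2) by auto
  ultimately obtain V c where V: "compact_bisection V" "V \<noteq> {}" "V \<subseteq> src G ` U"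
    and c: "\<forall>g\<in>arrows G. src G g \<in> V \<longrightarrow> rng G g \<in> V \<longrightarrow> conv a f g = (if g \<in> V then c else 0)"
    using scalar_corner[OF steinberg_conv[OF a f(1)]] by metis
  have Vu: "V \<subseteq> units G" using V(3) \<open>src G ` U \<subseteq> units G\<close> by blast
  have ce: "cmod c \<le> e"
    by (rule near_corner[OF steinberg_conv[OF a f(1)] nf e V(1,2) Vu]) (use c in blast)
  let ?W = "U \<inter> {g \<in> arrows G. src G g \<in> V}"
  have "gopen ?W"
    using V(1) by (intro openin_Int Uo open_src_vimage) (simp add: compact_bisection_iff)
  moreover have "?W \<noteq> {}"
  proof -
    obtain x where "x \<in> V" using V(2) by blast
    then obtain u where "u \<in> U" "src G u \<in> V" using V(3) by blast
    then have "u \<in> ?W" using bisectionD(1)[OF Ub] by blast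
    then show ?thesis by blast
  qed
  moreover have "?W \<subseteq> W" using U(3) by blast
  moreover have "cmod (f w) \<le> e" if w: "w \<in> ?W" for w
  proof -
    have s: "src G w \<in> V" "w \<in> U" using w by auto
    then have "src G w \<in> units G" using Vu by blast
    then have "conv a f (src G w) = c"
      using c s(1) src_unit rng_unit units_arrows by simp
    then show ?thesis using shift[OF s(2)] ce by simp
  qed
  ultimately show ?thesis using that by blast
qed

lemma ideal_seqs_pointwise:
  assumes p: "p \<in> ideal_seqs" and g: "g \<in> arrows G"
  shows "convergent (\<lambda>n. p n g)"
proof -
  have c: "p \<in> cauchy" using p ideal_seqsD(1) steinberg_seqsD(1) by blast
  have "Cauchy (\<lambda>n. p n g)"
  proof (rule metric_CauchyI)
    fix e :: real assume "e > 0"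
    then obtain N where N: "\<forall>m\<ge>N. \<forall>n\<ge>N. rnorm (p m - p n) < e" using c cauchy_iff by blast
    have "dist (p m g) (p n g) < e" if "m \<ge> N" "n \<ge> N" for m n
      using norm_le_rnorm[OF bounded_fun_diff[OF bounded_fun_cauchy[OF c] bounded_fun_cauchy[OF c]] g, of m n]
        N that by (fastforce simp: dist_norm)
    then show "\<exists>M. \<forall>m\<ge>M. \<forall>n\<ge>M. dist (p m g) (p n g) < e" by blast
  qed
  then show ?thesis by (rule Cauchy_convergent)
qed

text \<open>A late term of \<open>p\<close> is close to \<open>p\<close> itself, which lies in the
  ideal. Since the norm dominates pointwise values, the same term is also uniformly close to the
  pointwise limit.\<close>

lemma ideal_seqs_near:
  assumes p: "p \<in> ideal_seqs" and e: "e > 0"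
  shows "\<exists>n. near (p n) e \<and> (\<forall>g\<in>arrows G. cmod (p n g - lim (\<lambda>m. p m g)) \<le> e)"
proof -
  have c: "p \<in> cauchy" using p ideal_seqsD(1) steinberg_seqsD(1) by blast
  obtain N where N: "\<And>m n. m \<ge> N \<Longrightarrow> n \<ge> N \<Longrightarrow> rnorm (p m - p n) < e" using c e cauchy_iff by blast
  have "\<forall>\<^sub>F n in sequentially. rnorm (p N - p n) \<le> e"
    unfolding eventually_sequentially using N less_imp_le by blast
  then have "near (p N) e" using p unfolding near_def by blast
  moreover have "cmod (p N g - lim (\<lambda>m. p m g)) \<le> e" if g: "g \<in> arrows G" for g
  proof (rule LIMSEQ_le_const2)
    have "(\<lambda>m. p m g) \<longlonglongrightarrow> lim (\<lambda>m. p m g)"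
      using ideal_seqs_pointwise[OF p g] by (simp add: convergent_LIMSEQ_iff)
    then show "(\<lambda>m. cmod (p N g - p m g)) \<longlonglongrightarrow> cmod (p N g - lim (\<lambda>m. p m g))"
      by (intro tendsto_norm tendsto_diff tendsto_const)
    have "cmod (p N g - p m g) \<le> e" if "m \<ge> N" for m
      using norm_le_rnorm[OF bounded_fun_diff[OF bounded_fun_cauchy[OF c] bounded_fun_cauchy[OF c]] g, of N m]
        N[OF order_refl that] by simp
    then show "\<exists>M. \<forall>m\<ge>M. cmod (p N g - p m g) \<le> e" by blast
  qed
  ultimately show ?thesis by blast
qed

text \<open>
  Near a unit \<open>x\<close> whose unit closure fibre is finite, an element of the ideal is uniformly
  approximated by a single element \<open>f0\<close> of the Steinberg algebra, built from its values on a finite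
  subset of the isotropy group. As \<open>f0\<close> takes finitely many values, it inherits singularity from the
  ideal.
\<close>

lemma ideal_seqs_lim_unit_eq_0:
  assumes q: "q \<in> ideal_seqs" and x: "x \<in> units G" and fin: "finite (unit_closure_fibre G x)"
  shows "lim (\<lambda>n. q n x) = 0"
proof -
  define \<alpha> where "\<alpha> h = lim (\<lambda>n. q n h)" for h
  obtain H where H: "finite H" "H \<subseteq> isotropy G x" "x \<in> H"
    and absorb: "\<And>f h. f \<in> unit_closure_fibre G x \<Longrightarrow> h \<in> H \<Longrightarrow> f \<cdot> h \<in> H"
    using finite_absorbing_set[OF x fin] by metis
  have Hs: "h \<in> arrows G" "src G h = x" if "h \<in> H" for h
    using H(2) that by (auto simp: isotropy_def)
  have "\<exists>U. compact_bisection U \<and> h \<in> U" if "h \<in> H" for h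
    using compact_bisection_base[OF openin_topspace Hs(1)[OF that]] by blast
  then obtain U where U: "\<And>h. h \<in> H \<Longrightarrow> compact_bisection (U h)" "\<And>h. h \<in> H \<Longrightarrow> h \<in> U h"
    by metis
  \<comment> \<open>All nonzero moduli that \<open>f0\<close> can take are in \<open>S\<close>. It
    depends on \<open>\<alpha>\<close> and \<open>H\<close> alone, so the gap \<open>\<eta>\<close>
    is fixed before the approximant \<open>q n\<close> is chosen.\<close>
  define S where "S = (\<lambda>T. cmod (sum \<alpha> T)) ` Pow H - {0}"
  have finS: "finite S" using H(1) by (simp add: S_def)
  obtain \<eta> where \<eta>: "\<eta> > 0" "\<And>s. s \<in> S \<Longrightarrow> \<eta> \<le> s"
  proof (cases "S = {}")
    case True
    then show ?thesis using that[of 1] by simp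
  next
    case False
    have "Min S \<in> S" by (rule Min_in[OF finS False])
    then have "Min S > 0" by (auto simp: S_def)
    then show ?thesis using that[of "Min S"] finS by simp
  qed
  \<comment> \<open>Where the expansion holds, \<open>f0\<close> and \<open>f\<close> differ by at
    most \<open>card H * e\<close>, and on a smaller open set \<open>f\<close> is at most
    \<open>e\<close>. The sum of the two is \<open>\<eta> / 2\<close>, strictly below the
    gap.\<close>
  define e where "e = \<eta> / (2 * (real (card H) + 1))"
  have e: "e > 0" using \<eta>(1) by (simp add: e_def)
  obtain n where n: "near (q n) e" "\<And>g. g \<in> arrows G \<Longrightarrow> cmod (q n g - \<alpha> g) \<le> e"
    using ideal_seqs_near[OF q e] unfolding \<alpha>_def by blast
  define f where "f = q n"
  have fs: "f \<in> steinberg" using ideal_seqsD(2)[OF q] by (simp add: f_def)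
  obtain V where V: "gopen V" "x \<in> V"
    and expand: "\<And>k y. k \<in> H \<Longrightarrow> y \<in> U k \<Longrightarrow> src G y \<in> V \<Longrightarrow> f y = (\<Sum>h\<in>H. if y \<in> U h then f h else 0)"
    using steinberg_local_expansion[OF x H(1,2) absorb U fs] by blast
  obtain V0 where V0: "compact_bisection V0" "x \<in> V0" "V0 \<subseteq> V \<inter> units G"
    using compact_bisection_base[of "V \<inter> units G" x] V x open_units by blast
  define f0 where "f0 = (\<Sum>h\<in>H. const_on (\<alpha> h) (U h))"
  have f0s: "f0 \<in> steinberg" unfolding f0_def
    using H(1) U(1) by (induction H rule: finite_induct)
      (simp_all only: sum.empty sum.insert steinberg_zero steinberg_add const_on_steinberg insertI1 insertI2
        not_False_eq_True)
  have f0: "f0 y = (\<Sum>h\<in>H. if y \<in> U h then \<alpha> h else 0)" for y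
    unfolding f0_def sum_fun_apply by (simp add: const_on_def)
  have f0_small: "f0 y = 0" if "cmod (f0 y) < \<eta>" for y
  proof -
    have "f0 y = sum \<alpha> {h \<in> H. y \<in> U h}" unfolding f0 using H(1) by (simp add: sum.If_cases Int_def)
    then have "cmod (f0 y) \<in> S \<or> cmod (f0 y) = 0" unfolding S_def by auto
    then show ?thesis using \<eta>(2) that by fastforce
  qed
  \<comment> \<open>Cutting off to sources in \<open>V0\<close> keeps only the region where the
    expansion of \<open>f\<close> is valid, and yields a function on all arrows, to which the
    vanishing of singular functions applies.\<close>
  define \<phi> where "\<phi> = conv f0 (const_on 1 V0)"
  have \<phi>s: "\<phi> \<in> steinberg" unfolding \<phi>_def by (intro steinberg_conv f0s const_on_steinberg V0)
  have \<phi>: "\<phi> y = (if src G y \<in> V0 then f0 y else 0)" if "y \<in> arrows G" for y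
    unfolding \<phi>_def using conv_const_on_units_right[OF rfinite_steinberg[OF f0s] _ that] V0(3) by simp
  have "singular \<phi>"
  proof (rule singularI)
    fix W assume W: "gopen W" "W \<noteq> {}"
    have Wa: "W \<subseteq> arrows G" using W openin_subset by blast
    show "\<exists>W'. gopen W' \<and> W' \<noteq> {} \<and> W' \<subseteq> W \<and> (\<forall>w\<in>W'. \<phi> w = 0)"
    proof (cases "\<exists>k\<in>H. W \<inter> U k \<inter> {g \<in> arrows G. src G g \<in> V0} \<noteq> {}")
      case True
      then obtain k where k: "k \<in> H" "W \<inter> U k \<inter> {g \<in> arrows G. src G g \<in> V0} \<noteq> {}" by blast
      have Wk: "gopen (W \<inter> U k \<inter> {g \<in> arrows G. src G g \<in> V0})"
        using U(1)[OF k(1)] V0(1)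
        by (intro openin_Int W open_src_vimage) (simp_all add: compact_bisection_iff)
      obtain W' where W': "gopen W'" "W' \<noteq> {}"
        "W' \<subseteq> W \<inter> U k \<inter> {g \<in> arrows G. src G g \<in> V0}" "\<And>w. w \<in> W' \<Longrightarrow> cmod (f w) \<le> e"
        using near_bound_on_open[OF fs n(1)[folded f_def] less_imp_le[OF e] Wk k(2)] by metis
      have "\<phi> w = 0" if w: "w \<in> W'" for w
      proof -
        have w': "w \<in> U k" "w \<in> arrows G" "src G w \<in> V0" using w W'(3) by auto
        have "f0 w - f w = (\<Sum>h\<in>H. if w \<in> U h then \<alpha> h - f h else 0)"
          using expand[OF k(1) w'(1)] w'(3) V0(3)
          by (simp add: f0 sum_subtractf[symmetric] subset_iff if_distrib cong: if_cong)
        then have "cmod (f0 w - f w) \<le> (\<Sum>h\<in>H. cmod (if w \<in> U h then \<alpha> h - f h else 0))"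
          by (simp only: norm_sum)
        also have "\<dots> \<le> (\<Sum>h\<in>H. e)"
        proof (rule sum_mono)
          fix h assume "h \<in> H"
          then show "cmod (if w \<in> U h then \<alpha> h - f h else 0) \<le> e"
            using n(2)[OF Hs(1)] e by (simp add: f_def norm_minus_commute)
        qed
        also have "\<dots> = real (card H) * e" by simp
        finally have "cmod (f0 w - f w) \<le> real (card H) * e" .
        moreover have "cmod (f0 w) \<le> cmod (f0 w - f w) + cmod (f w)"
          using norm_triangle_ineq[of "f0 w - f w" "f w"] by simp
        ultimately have "cmod (f0 w) \<le> (real (card H) + 1) * e"
          using W'(4)[OF w] by (simp add: algebra_simps)
        also have "\<dots> = \<eta> / 2" unfolding e_def by (simp add: field_simps add_nonneg_eq_0_iff)
        also have "\<dots> < \<eta>" using \<eta>(1) by simp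
        finally show ?thesis using f0_small \<phi>[OF w'(2)] by simp
      qed
      then show ?thesis using W' by blast
    next
      case False
      \<comment> \<open>Over \<open>V0\<close> the set \<open>W\<close> misses every
        \<open>U h\<close>, so all summands of \<open>f0\<close> are 0 there; elsewhere the cut-off
        is 0.\<close>
      have "\<phi> w = 0" if w: "w \<in> W" for w
      proof -
        have wa: "w \<in> arrows G" using w Wa by blast
        have "w \<notin> U h" if "src G w \<in> V0" "h \<in> H" for h using False that w wa by blast
        then have "f0 w = 0" if "src G w \<in> V0" unfolding f0 using that by (intro sum.neutral) auto
        then show ?thesis using \<phi>[OF wa] by simp
      qed
      then show ?thesis using W by blast
    qed
  qed
  then have "\<phi> = 0" using steinberg_singular_eq_0[OF \<phi>s] by blast
  then have "\<phi> x = 0" by (simp add: zero_fun_eq)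
  moreover have "\<phi> x = f0 x" using \<phi>[OF units_arrows[OF x]] V0(2) src_unit[OF x] by simp
  moreover have "f0 x = (\<Sum>h\<in>H. if h = x then \<alpha> x else 0)"
    unfolding f0
  proof (rule sum.cong)
    fix h assume h: "h \<in> H"
    \<comment> \<open>The only arrow of \<open>U h\<close> with source \<open>x\<close> is
      \<open>h\<close>, so at \<open>x\<close> the sum reduces to the coefficient of
      \<open>x\<close> itself, which occurs because \<open>x\<close> belongs to
      \<open>H\<close>.\<close>
    have "x \<in> U h \<longleftrightarrow> h = x"
    proof -
      have "src G h = src G x" by (simp only: Hs(2)[OF h] src_unit[OF x])
      then show ?thesis
        using bisectionD(3)[OF compact_bisectionD[OF U(1)[OF h]] U(2)[OF h]] U(2)[OF h] by blast
    qed
    then show "(if x \<in> U h then \<alpha> h else 0) = (if h = x then \<alpha> x else 0)" by simp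
  qed simp
  moreover have "\<dots> = \<alpha> x" using H(1,3) by (simp add: sum.delta)
  ultimately show ?thesis by (simp add: \<alpha>_def)
qed

text \<open>For sequences of the ideal the pointwise limit is already known to vanish at units.
  Multiplying by the indicator function of the inverse of a bisection through \<open>g\<close> stays
  in the ideal and carries the value at \<open>g\<close> to the unit \<open>src G g\<close>;
  vanishing at all arrows then forces the norms to 0.\<close>

lemma trivial_ideal:
  assumes fin: "\<And>x. x \<in> units G \<Longrightarrow> finite (unit_closure_fibre G x)"
  shows "I = {azero Cred}"
proof (rule ccontr)
  assume "I \<noteq> {azero Cred}"
  then obtain p where p: "p \<in> ideal_seqs" "\<not> (\<lambda>n. rnorm (p n)) \<longlonglongrightarrow> 0"
    using ideal_seqs_nonzero by blast
  have pc: "p \<in> cauchy" using p ideal_seqsD(1) steinberg_seqsD(1) by blast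
  have "(\<lambda>n. p n g) \<longlonglongrightarrow> 0" if g: "g \<in> arrows G" for g
  proof -
    obtain U where U: "compact_bisection U" "g \<in> U" "U \<subseteq> arrows G"
      by (rule compact_bisection_base[OF openin_topspace g])
    have Ub: "bisection U" by (rule compact_bisectionD[OF U(1)])
    have U': "compact_bisection (ginv G ` U)" by (rule compact_bisection_ginv[OF U(1)])
    let ?a = "const_on 1 (ginv G ` U)"
    let ?q = "\<lambda>n. conv ?a (p n)"
    have q: "?q \<in> ideal_seqs"
      by (rule ideal_seqs_conv(2)[OF p(1) const_steinberg_seqs[OF const_on_steinberg[OF U']]])
    have "?q n (src G g) = p n g" for n
    proof -
      have "?q n (src G g) = ?a (ginv G g) * p n (ginv G (ginv G g) \<cdot> src G g)"
        by (rule conv_bisection[OF compact_bisectionD[OF U']])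
          (use U g in \<open>auto simp: const_on_def src_closed rng_ginv rng_src\<close>)
      then show ?thesis using U g by (simp add: const_on_def ginv_ginv mul_src)
    qed
    then have "lim (\<lambda>n. p n g) = 0"
      using ideal_seqs_lim_unit_eq_0[OF q src_units[OF g] fin[OF src_units[OF g]]] by simp
    then show ?thesis using ideal_seqs_pointwise[OF p(1) g] by (simp add: convergent_LIMSEQ_iff)
  qed
  then have "(\<lambda>n. rnorm (p n)) \<longlonglongrightarrow> 0"
    using rnorm_tendsto_0[of p] bounded_fun_cauchy[OF pc] pc unfolding cauchy_iff by blast
  then show False using p(2) by blast
qed

end

text \<open>The reduced norm dominates pointwise values, so the indicator function of a nonempty
  compact open set of units has norm at least 1.\<close>

lemma (in nonempty_ample_groupoid) completion_nonzero:
  "elems Cred \<noteq> {azero Cred}"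
proof
  assume eq: "elems Cred = {azero Cred}"
  obtain x where x: "x \<in> units G" using units_nonempty by blast
  then obtain V where V: "compact_bisection V" "x \<in> V"
    using compact_bisection_base[OF open_units] by blast
  let ?p = "const_on 1 V"
  have c: "(\<lambda>_. ?p) \<in> cauchy" "(\<lambda>_. 0) \<in> cauchy"
    using const_steinberg_seqs[OF const_on_steinberg[OF V(1)]] const_steinberg_seqs[OF steinberg_zero]
    by (simp_all add: steinberg_seqs_def)
  have "cls (\<lambda>_. ?p) = azero Cred"
    using cls_elems[OF c(1)] by (simp only: eq singleton_iff)
  also have "\<dots> = cls (\<lambda>_. 0)" by (simp add: completion_def Cc_algebra_def)
  finally have "(\<lambda>_. 0, \<lambda>_. ?p) \<in> crel" using cls_self[OF c(1)] by blast
  then have "((\<lambda>_. ?p), (\<lambda>_. 0)) \<in> crel" by (rule cauchy_rel_sym)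
  then have "(\<lambda>n. rnorm ?p) \<longlonglongrightarrow> 0" by (simp only: cauchy_rel_iff diff_zero simp_thms)
  then have "rnorm ?p = 0" by (simp add: LIMSEQ_const_iff)
  moreover have "cmod (?p x) \<le> rnorm ?p"
    by (rule norm_le_rnorm[OF bounded_fun_const_on[OF V(1)] units_arrows[OF x]])
  ultimately show False using V(2) by (simp add: const_on_def)
qed

theorem corollary4p10:
  fixes G :: "'a topgroupoid"
  assumes "ample_groupoid G"
    and "\<not> Hausdorff_space (gtop G)"
    and "\<And>x. x \<in> units G \<Longrightarrow> finite (unit_closure_fibre G x)"
    and "simple_algebra (steinberg_algebra G)"
  shows "simple_cstar_algebra (reduced_cstar_algebra G)"
proof -
  interpret ample_groupoid G by (rule assms(1))
  \<comment> \<open>The empty space is Hausdorff, so failure of the Hausdorff property provides an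
    arrow and hence a unit.\<close>
  have "units G \<noteq> {}"
  proof
    assume "units G = {}"
    then have "arrows G = {}" using src_units by blast
    then have "Hausdorff_space (gtop G)" by (simp add: Hausdorff_space_def)
    then show False using assms(2) by blast
  qed
  then interpret simple_steinberg G
    using assms(4) by unfold_locales
  show ?thesis
    unfolding simple_cstar_algebra_def reduced_cstar_algebra_def
  proof (intro conjI allI impI)
    show "elems (completion (Cc_algebra G)) \<noteq> {azero (completion (Cc_algebra G))}"
      by (rule completion_nonzero)
    fix I assume I: "two_sided_ideal (completion (Cc_algebra G)) I \<and> norm_closed (completion (Cc_algebra G)) I"
    then interpret closed_ideal G I by unfold_locales auto
    have "ideal_trace = {azero (steinberg_algebra G)} \<or> ideal_trace = steinberg"
      using simple two_sided_ideal_trace unfolding simple_algebra_def by blast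
    then have "ideal_trace = {0} \<or> ideal_trace = steinberg" by (simp add: steinberg_algebra_def)
    then show "I = {azero (completion (Cc_algebra G))} \<or> I = elems (completion (Cc_algebra G))"
    proof
      assume "ideal_trace = {0}"
      then interpret simple_closed_ideal G I by unfold_locales
      show ?thesis using trivial_ideal assms(3) by blast
    next
      assume "ideal_trace = steinberg"
      then show ?thesis using ideal_eq_completion by blast
    qed
  qed
qed

end
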